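(* The order-$1$ PHFL model-checking problem (given a finite Markov chain $M$ and a closed order-$1$ PHFL formula $\varphi$ of type $\mathbf{Prop}$, decide whether $M\models\varphi$) is $\Pi^1_1$-hard and $\Sigma^1_1$-hard.
   Context: A Markov chain over a set $AP$ of atomic propositions is a tuple $M=(S,P,L,s_{in})$ with $S$ finite, $P:S\times S\to[0,1]$ with $\sum_{s'}P(s,s')=1$ for each $s$, $L:AP\to2^S$, $s_{in}\in S$; $AP$ is closed under negation. PHFL types: $\tau::=\mathbf{Prop}\mid\tau_1\to\tau_2$, $\mathrm{ord}(\mathbf{Prop})=0$, $\mathrm{ord}(\tau_1\to\tau_2)=\max(\mathrm{ord}(\tau_1)+1,\mathrm{ord}(\tau_2))$. PHFL formulas: $\varphi::=p\mid X\mid\varphi_1\lor\varphi_2\mid\varphi_1\land\varphi_2\mid[\varphi]_J\mid\Box\varphi\mid\Diamond\varphi\mid\bigcirc\varphi\mid\mu X.\varphi\mid\nu X.\varphi\mid\lambda X.\varphi\mid\varphi_1\,\varphi_2$ with $J$ of the form "$>r$" or "$\ge r$", $r\in[0,1]$ rational (excluding $>1$, $\ge0$); simply typed ($p:\mathbf{Prop}$; the connectives $\lor,\land,[\cdot]_J,\Box,\Diamond,\bigcirc$ act on $\mathbf{Prop}$; $\mu X.\varphi,\nu X.\varphi:\tau$ when $\varphi:\tau$ under $X:\tau$; $\lambda$/application as usual). Order of a formula = largest order of types in its typing derivation. Semantics: $[\![\mathbf{Prop}]\!]=[0,1]^S$ pointwise ordered, $[\![\tau_1\to\tau_2]\!]=$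 monotone functions pointwise ordered; $[\![p]\!](s)=1$ iff $s\in L(p)$, else $0$; $\land,\lor$ pointwise min/max; $[\![[\varphi]_J]\!](s)=1$ iff $[\![\varphi]\!](s)\in J$, else $0$; $\Box/\Diamond$: min/max of $[\![\varphi]\!](s')$ over $s'$ with $P(s,s')>0$; $[\![\bigcirc\varphi]\!](s)=\sum_{s'}P(s,s')[\![\varphi]\!](s')$; $\mu/\nu$ least/greatest fixpoints; $\lambda$, application as usual. $M\models\varphi$ iff $[\![\varphi]\!](s_{in})=1$. *)

theory Defs
  imports Complex_Main "HOL-Library.FuncSet" "HOL-Library.Nat_Bijection"
begin

section \<open>Markov chains\<close>

record ('s, 'p) mchain =
  states :: "'s set"
  prob :: "'s \<Rightarrow> 's \<Rightarrow> real"
  label :: "'p \<Rightarrow> 's set"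
  init :: 's

definition markov_chain :: "'p set \<Rightarrow> ('s, 'p) mchain \<Rightarrow> bool" where
  "markov_chain AP M \<longleftrightarrow>
     finite (states M) \<and> init M \<in> states M \<and>
     (\<forall>s\<in>states M. \<forall>s'\<in>states M. 0 \<le> prob M s s' \<and> prob M s s' \<le> 1) \<and>
     (\<forall>s\<in>states M. (\<Sum>s'\<in>states M. prob M s s') = 1) \<and>
     (\<forall>p\<in>AP. label M p \<subseteq> states M) \<and>
     (\<forall>p\<in>AP. \<exists>q\<in>AP. label M q = states M - label M p)"


section \<open>PHFL: types, formulas, typing\<close>

datatype ty = Prp | Arr ty ty (infixr \<open>\<rightarrow>\<^sub>t\<close> 60)

primrec ord_ty :: "ty \<Rightarrow> nat" where
  "ord_ty Prp = 0"
| "ord_ty (\<sigma> \<rightarrow>\<^sub>t \<tau>) = max (ord_ty \<sigma> + 1) (ord_ty \<tau>)"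

datatype threshold = Gt rat | Ge rat

primrec threshold_ok :: "threshold \<Rightarrow> bool" where
  "threshold_ok (Gt r) \<longleftrightarrow> 0 \<le> r \<and> r < 1"
| "threshold_ok (Ge r) \<longleftrightarrow> 0 < r \<and> r \<le> 1"

primrec in_threshold :: "real \<Rightarrow> threshold \<Rightarrow> bool" where
  "in_threshold x (Gt r) \<longleftrightarrow> x > of_rat r"
| "in_threshold x (Ge r) \<longleftrightarrow> x \<ge> of_rat r"

text \<open>Binders carry the type of the bound variable, so that a formula determines its typing
  derivation; both its order and its semantics depend on that derivation.\<close>

datatype (props: 'p) phfl =
  Atom 'p
| Var nat
| Or "'p phfl" "'p phfl"
| And "'p phfl" "'p phfl"
| Thr threshold "'p phfl"
| Box "'p phfl"
| Dia "'p phfl"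
| Nxt "'p phfl"
| Mu nat ty "'p phfl"
| Nu nat ty "'p phfl"
| Lam nat ty "'p phfl"
| App "'p phfl" "'p phfl"

text \<open>\<open>typing \<Gamma> \<phi> \<tau> k\<close>: the judgement \<open>\<Gamma> \<turnstile> \<phi> : \<tau>\<close> has a derivation in which \<open>k\<close> is the largest order
  of a type assigned to a subformula.  For a closed formula, the types in the contexts do not
  contribute beyond that: the type of a variable bound by \<open>\<mu>\<close> or \<open>\<nu>\<close> is the type of the fixpoint
  formula, and the type of a variable bound by \<open>\<lambda>\<close> has smaller order than that of the abstraction.\<close>

inductive typing :: "(nat \<rightharpoonup> ty) \<Rightarrow> 'p phfl \<Rightarrow> ty \<Rightarrow> nat \<Rightarrow> bool" where
  "typing \<Gamma> (Atom p) Prp 0"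
| "\<Gamma> X = Some \<tau> \<Longrightarrow> typing \<Gamma> (Var X) \<tau> (ord_ty \<tau>)"
| "typing \<Gamma> \<phi> Prp k \<Longrightarrow> typing \<Gamma> \<psi> Prp l \<Longrightarrow> typing \<Gamma> (Or \<phi> \<psi>) Prp (max k l)"
| "typing \<Gamma> \<phi> Prp k \<Longrightarrow> typing \<Gamma> \<psi> Prp l \<Longrightarrow> typing \<Gamma> (And \<phi> \<psi>) Prp (max k l)"
| "typing \<Gamma> \<phi> Prp k \<Longrightarrow> threshold_ok J \<Longrightarrow> typing \<Gamma> (Thr J \<phi>) Prp k"
| "typing \<Gamma> \<phi> Prp k \<Longrightarrow> typing \<Gamma> (Box \<phi>) Prp k"
| "typing \<Gamma> \<phi> Prp k \<Longrightarrow> typing \<Gamma> (Dia \<phi>) Prp k"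
| "typing \<Gamma> \<phi> Prp k \<Longrightarrow> typing \<Gamma> (Nxt \<phi>) Prp k"
| "typing (\<Gamma>(X \<mapsto> \<tau>)) \<phi> \<tau> k \<Longrightarrow> typing \<Gamma> (Mu X \<tau> \<phi>) \<tau> k"
| "typing (\<Gamma>(X \<mapsto> \<tau>)) \<phi> \<tau> k \<Longrightarrow> typing \<Gamma> (Nu X \<tau> \<phi>) \<tau> k"
| "typing (\<Gamma>(X \<mapsto> \<sigma>)) \<phi> \<tau> k \<Longrightarrow> typing \<Gamma> (Lam X \<sigma> \<phi>) (\<sigma> \<rightarrow>\<^sub>t \<tau>) (max k (ord_ty (\<sigma> \<rightarrow>\<^sub>t \<tau>)))"
| "typing \<Gamma> \<phi> (\<sigma> \<rightarrow>\<^sub>t \<tau>) k \<Longrightarrow> typing \<Gamma> \<psi> \<sigma> l \<Longrightarrow> typing \<Gamma> (App \<phi> \<psi>) \<tau> (max k l)"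

text \<open>Closed formulas of type \<open>Prop\<close> and of order \<open>k\<close> over the atomic propositions \<open>AP\<close>.\<close>

definition closed_prop_formula :: "'p set \<Rightarrow> nat \<Rightarrow> 'p phfl \<Rightarrow> bool" where
  "closed_prop_formula AP k \<phi> \<longleftrightarrow> props \<phi> \<subseteq> AP \<and> typing Map.empty \<phi> Prp k"


section \<open>Semantics of PHFL up to order 1\<close>

text \<open>A single HOL type cannot hold the interpretations of all simple types.  Types of order at most
  1 have the form \<open>Prop \<rightarrow> \<dots> \<rightarrow> Prop \<rightarrow> Prop\<close>, and for these the following curried values suffice.
  The interpretation of a type of higher order is the empty set by convention; such types do not
  occur in formulas of order at most 1.\<close>

datatype 's val = Base (base: "'s \<Rightarrow> real") | Fun (funv: "('s \<Rightarrow> real) \<Rightarrow> 's val")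

definition preds :: "'s set \<Rightarrow> ('s \<Rightarrow> real) set" where
  "preds S = S \<rightarrow>\<^sub>E {0..1}"

definition le_pred :: "'s set \<Rightarrow> ('s \<Rightarrow> real) \<Rightarrow> ('s \<Rightarrow> real) \<Rightarrow> bool" where
  "le_pred S f g \<longleftrightarrow> (\<forall>s\<in>S. f s \<le> g s)"

primrec le_val :: "'s set \<Rightarrow> ty \<Rightarrow> 's val \<Rightarrow> 's val \<Rightarrow> bool" where
  "le_val S Prp u v \<longleftrightarrow> le_pred S (base u) (base v)"
| "le_val S (\<sigma> \<rightarrow>\<^sub>t \<tau>) u v \<longleftrightarrow> (\<forall>x\<in>preds S. le_val S \<tau> (funv u x) (funv v x))"

primrec dom_ty :: "'s set \<Rightarrow> ty \<Rightarrow> 's val set" where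
  "dom_ty S Prp = Base ` preds S"
| "dom_ty S (\<sigma> \<rightarrow>\<^sub>t \<tau>) =
     (if \<sigma> = Prp
      then {Fun F | F. F \<in> preds S \<rightarrow>\<^sub>E dom_ty S \<tau> \<and>
              (\<forall>x\<in>preds S. \<forall>y\<in>preds S. le_pred S x y \<longrightarrow> le_val S \<tau> (F x) (F y))}
      else {})"

definition least_fixpoint :: "'s set \<Rightarrow> ty \<Rightarrow> ('s val \<Rightarrow> 's val) \<Rightarrow> 's val" where
  "least_fixpoint S \<tau> F =
     (THE v. v \<in> dom_ty S \<tau> \<and> F v = v \<and> (\<forall>w\<in>dom_ty S \<tau>. F w = w \<longrightarrow> le_val S \<tau> v w))"

definition greatest_fixpoint :: "'s set \<Rightarrow> ty \<Rightarrow> ('s val \<Rightarrow> 's val) \<Rightarrow> 's val" where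
  "greatest_fixpoint S \<tau> F =
     (THE v. v \<in> dom_ty S \<tau> \<and> F v = v \<and> (\<forall>w\<in>dom_ty S \<tau>. F w = w \<longrightarrow> le_val S \<tau> w v))"

primrec sem :: "('s, 'p) mchain \<Rightarrow> 'p phfl \<Rightarrow> (nat \<Rightarrow> 's val) \<Rightarrow> 's val" where
  "sem M (Atom p) \<rho> = Base (\<lambda>s\<in>states M. if s \<in> label M p then 1 else 0)"
| "sem M (Var X) \<rho> = \<rho> X"
| "sem M (Or \<phi> \<psi>) \<rho> = Base (\<lambda>s\<in>states M. max (base (sem M \<phi> \<rho>) s) (base (sem M \<psi> \<rho>) s))"
| "sem M (And \<phi> \<psi>) \<rho> = Base (\<lambda>s\<in>states M. min (base (sem M \<phi> \<rho>) s) (base (sem M \<psi> \<rho>) s))"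
| "sem M (Thr J \<phi>) \<rho> = Base (\<lambda>s\<in>states M. if in_threshold (base (sem M \<phi> \<rho>) s) J then 1 else 0)"
| "sem M (Box \<phi>) \<rho> =
     Base (\<lambda>s\<in>states M. Min (base (sem M \<phi> \<rho>) ` {s'\<in>states M. prob M s s' > 0}))"
| "sem M (Dia \<phi>) \<rho> =
     Base (\<lambda>s\<in>states M. Max (base (sem M \<phi> \<rho>) ` {s'\<in>states M. prob M s s' > 0}))"
| "sem M (Nxt \<phi>) \<rho> =
     Base (\<lambda>s\<in>states M. \<Sum>s'\<in>states M. prob M s s' * base (sem M \<phi> \<rho>) s')"
| "sem M (Mu X \<tau> \<phi>) \<rho> = least_fixpoint (states M) \<tau> (\<lambda>v. sem M \<phi> (\<rho>(X := v)))"
| "sem M (Nu X \<tau> \<phi>) \<rho> = greatest_fixpoint (states M) \<tau> (\<lambda>v. sem M \<phi> (\<rho>(X := v)))"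
| "sem M (Lam X \<sigma> \<phi>) \<rho> = Fun (\<lambda>x\<in>preds (states M). sem M \<phi> (\<rho>(X := Base x)))"
| "sem M (App \<phi> \<psi>) \<rho> = funv (sem M \<phi> \<rho>) (base (sem M \<psi> \<rho>))"

text \<open>Meaningful for closed formulas of type \<open>Prop\<close> and order at most 1; the initial environment is
  then irrelevant.\<close>

definition models :: "('s, 'p) mchain \<Rightarrow> 'p phfl \<Rightarrow> bool" (infix \<open>\<Turnstile>\<^sub>P\<close> 50) where
  "M \<Turnstile>\<^sub>P \<phi> \<longleftrightarrow> base (sem M \<phi> (\<lambda>_. undefined)) (init M) = 1"


section \<open>The model-checking problem on coded instances\<close>

text \<open>To be the input of an algorithm, a Markov chain must have rational transition probabilities.
  It is presented by its transition matrix, the list of state sets labelled by the atomic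
  propositions \<open>0, 1, \<dots>\<close>, and the initial state; the states are the row indices.\<close>

type_synonym mc_pres = "rat list list \<times> nat list list \<times> nat"

fun chain_of :: "mc_pres \<Rightarrow> (nat, nat) mchain" where
  "chain_of (rows, labs, s0) =
     \<lparr>states = {..<length rows}, prob = (\<lambda>i j. of_rat (rows ! i ! j)),
      label = (\<lambda>p. set (labs ! p)), init = s0\<rparr>"

fun AP_of :: "mc_pres \<Rightarrow> nat set" where
  "AP_of (rows, labs, s0) = {..<length labs}"

fun mc_pres_ok :: "mc_pres \<Rightarrow> bool" where
  "mc_pres_ok (rows, labs, s0) \<longleftrightarrow>
     (\<forall>row\<in>set rows. length row = length rows) \<and>
     markov_chain (AP_of (rows, labs, s0)) (chain_of (rows, labs, s0))"

definition rat_code :: "rat \<Rightarrow> nat" where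
  "rat_code r = (case quotient_of r of (a, b) \<Rightarrow> prod_encode (int_encode a, int_encode b))"

fun mc_code :: "mc_pres \<Rightarrow> nat" where
  "mc_code (rows, labs, s0) =
     prod_encode (list_encode (map (\<lambda>row. list_encode (map rat_code row)) rows),
       prod_encode (list_encode (map list_encode labs), s0))"

primrec ty_code :: "ty \<Rightarrow> nat" where
  "ty_code Prp = 0"
| "ty_code (\<sigma> \<rightarrow>\<^sub>t \<tau>) = Suc (prod_encode (ty_code \<sigma>, ty_code \<tau>))"

primrec threshold_code :: "threshold \<Rightarrow> nat" where
  "threshold_code (Gt r) = prod_encode (0, rat_code r)"
| "threshold_code (Ge r) = prod_encode (1, rat_code r)"

primrec phfl_code :: "nat phfl \<Rightarrow> nat" where
  "phfl_code (Atom p) = prod_encode (0, p)"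
| "phfl_code (Var X) = prod_encode (1, X)"
| "phfl_code (Or \<phi> \<psi>) = prod_encode (2, prod_encode (phfl_code \<phi>, phfl_code \<psi>))"
| "phfl_code (And \<phi> \<psi>) = prod_encode (3, prod_encode (phfl_code \<phi>, phfl_code \<psi>))"
| "phfl_code (Thr J \<phi>) = prod_encode (4, prod_encode (threshold_code J, phfl_code \<phi>))"
| "phfl_code (Box \<phi>) = prod_encode (5, phfl_code \<phi>)"
| "phfl_code (Dia \<phi>) = prod_encode (6, phfl_code \<phi>)"
| "phfl_code (Nxt \<phi>) = prod_encode (7, phfl_code \<phi>)"
| "phfl_code (Mu X \<tau> \<phi>) = prod_encode (8, prod_encode (X, prod_encode (ty_code \<tau>, phfl_code \<phi>)))"
| "phfl_code (Nu X \<tau> \<phi>) = prod_encode (9, prod_encode (X, prod_encode (ty_code \<tau>, phfl_code \<phi>)))"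
| "phfl_code (Lam X \<tau> \<phi>) = prod_encode (10, prod_encode (X, prod_encode (ty_code \<tau>, phfl_code \<phi>)))"
| "phfl_code (App \<phi> \<psi>) = prod_encode (11, prod_encode (phfl_code \<phi>, phfl_code \<psi>))"

definition instance_code :: "mc_pres \<Rightarrow> nat phfl \<Rightarrow> nat" where
  "instance_code m \<phi> = prod_encode (mc_code m, phfl_code \<phi>)"

lemma rat_code_inject: "rat_code r = rat_code r' \<longleftrightarrow> r = r'"
proof
  assume "rat_code r = rat_code r'"
  then have "quotient_of r = quotient_of r'"
    by (simp add: rat_code_def prod.case_eq_if prod_eq_iff int_encode_eq)
  then show "r = r'" by (rule quotient_of_inject)
qed simp

lemma ty_code_inject: "ty_code \<sigma> = ty_code \<tau> \<longleftrightarrow> \<sigma> = \<tau>"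
proof (induction \<sigma> arbitrary: \<tau>)
  case Prp
  show ?case by (cases \<tau>) auto
next
  case (Arr \<sigma>1 \<sigma>2)
  then show ?case by (cases \<tau>) auto
qed

lemma threshold_code_inject: "threshold_code J = threshold_code J' \<longleftrightarrow> J = J'"
  by (cases J; cases J') (auto simp: rat_code_inject)

lemma phfl_code_inject: "phfl_code \<phi> = phfl_code \<psi> \<longleftrightarrow> \<phi> = \<psi>"
proof (induction \<phi> arbitrary: \<psi>)
  case (Atom p)
  then show ?case by (cases \<psi>) (simp_all add: ty_code_inject threshold_code_inject)
next
  case (Var X)
  then show ?case by (cases \<psi>) (simp_all add: ty_code_inject threshold_code_inject)
next
  case (Or a b)
  then show ?case by (cases \<psi>) (simp_all add: ty_code_inject threshold_code_inject)
next
  case (And a b)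
  then show ?case by (cases \<psi>) (simp_all add: ty_code_inject threshold_code_inject)
next
  case (Thr J a)
  then show ?case by (cases \<psi>) (simp_all add: ty_code_inject threshold_code_inject)
next
  case (Box a)
  then show ?case by (cases \<psi>) (simp_all add: ty_code_inject threshold_code_inject)
next
  case (Dia a)
  then show ?case by (cases \<psi>) (simp_all add: ty_code_inject threshold_code_inject)
next
  case (Nxt a)
  then show ?case by (cases \<psi>) (simp_all add: ty_code_inject threshold_code_inject)
next
  case (Mu X t a)
  then show ?case by (cases \<psi>) (simp_all add: ty_code_inject threshold_code_inject)
next
  case (Nu X t a)
  then show ?case by (cases \<psi>) (simp_all add: ty_code_inject threshold_code_inject)
next
  case (Lam X t a)
  then show ?case by (cases \<psi>) (simp_all add: ty_code_inject threshold_code_inject)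
next
  case (App a b)
  then show ?case by (cases \<psi>) (simp_all add: ty_code_inject threshold_code_inject)
qed

lemma mc_code_inject: "mc_code m = mc_code m' \<longleftrightarrow> m = m'"
proof -
  have "inj rat_code" by (simp add: inj_def rat_code_inject)
  moreover have "inj list_encode" by (simp add: inj_def list_encode_eq)
  moreover have "inj (\<lambda>row. list_encode (map rat_code row))"
    by (rule injI) (simp add: list_encode_eq inj_map_eq_map \<open>inj rat_code\<close>)
  ultimately show ?thesis
    by (cases m; cases m') (simp add: list_encode_eq inj_map_eq_map)
qed

lemma instance_code_inject:
  "instance_code m \<phi> = instance_code m' \<phi>' \<longleftrightarrow> m = m' \<and> \<phi> = \<phi>'"
  by (simp add: instance_code_def mc_code_inject phfl_code_inject)

text \<open>A decision problem consists of its set of (coded) instances and the subset of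
  yes-instances.\<close>

type_synonym problem = "nat set \<times> nat set"

definition phfl_model_checking :: "nat \<Rightarrow> problem" where
  "phfl_model_checking k =
     ({instance_code m \<phi> | m \<phi>. mc_pres_ok m \<and> closed_prop_formula (AP_of m) k \<phi>},
      {instance_code m \<phi> | m \<phi>. mc_pres_ok m \<and> closed_prop_formula (AP_of m) k \<phi> \<and> chain_of m \<Turnstile>\<^sub>P \<phi>})"

text \<open>The semantics covers formulas of order at most 1 only, so \<open>phfl_model_checking k\<close> is
  meaningful for \<open>k \<le> 1\<close>.\<close>

abbreviation order1_phfl_model_checking :: problem where
  "order1_phfl_model_checking \<equiv> phfl_model_checking 1"


section \<open>Computable functions\<close>

datatype recf = RZero | RSucc | RProj nat | RComp recf "recf list" | RPrim recf recf | RMin recf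

text \<open>\<open>reval r xs y\<close>: the partial recursive function denoted by \<open>r\<close> is defined at \<open>xs\<close> with value
  \<open>y\<close>.  The recursion and minimisation variable is the first argument.\<close>

inductive reval :: "recf \<Rightarrow> nat list \<Rightarrow> nat \<Rightarrow> bool" where
  "reval RZero xs 0"
| "reval RSucc [x] (Suc x)"
| "i < length xs \<Longrightarrow> reval (RProj i) xs (xs ! i)"
| "length ys = length gs \<Longrightarrow> (\<forall>i<length gs. reval (gs ! i) xs (ys ! i)) \<Longrightarrow> reval f ys z
    \<Longrightarrow> reval (RComp f gs) xs z"
| "reval f xs y \<Longrightarrow> reval (RPrim f g) (0 # xs) y"
| "reval (RPrim f g) (n # xs) r \<Longrightarrow> reval g (n # r # xs) y \<Longrightarrow> reval (RPrim f g) (Suc n # xs) y"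
| "reval f (n # xs) 0 \<Longrightarrow> (\<forall>m<n. \<exists>y. reval f (m # xs) (Suc y)) \<Longrightarrow> reval (RMin f) xs n"

definition computable :: "(nat \<Rightarrow> nat) \<Rightarrow> bool" where
  "computable f \<longleftrightarrow> (\<exists>r. \<forall>n. reval r [n] (f n))"


section \<open>Second-order arithmetic and the classes of the analytical hierarchy\<close>

datatype aterm = TVar nat | TZero | TSuc aterm | TAdd aterm aterm | TMul aterm aterm

primrec tval :: "aterm \<Rightarrow> (nat \<Rightarrow> nat) \<Rightarrow> nat" where
  "tval (TVar x) e = e x"
| "tval TZero e = 0"
| "tval (TSuc t) e = Suc (tval t e)"
| "tval (TAdd t u) e = tval t e + tval u e"
| "tval (TMul t u) e = tval t e * tval u e"

datatype so_formula =
  SEq aterm aterm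
| SLess aterm aterm
| SMem aterm nat
| SNot so_formula
| SAnd so_formula so_formula
| SOr so_formula so_formula
| SExNum nat so_formula
| SAllNum nat so_formula
| SExSet nat so_formula
| SAllSet nat so_formula

primrec so_sat :: "so_formula \<Rightarrow> (nat \<Rightarrow> nat) \<Rightarrow> (nat \<Rightarrow> nat set) \<Rightarrow> bool" where
  "so_sat (SEq t u) e V \<longleftrightarrow> tval t e = tval u e"
| "so_sat (SLess t u) e V \<longleftrightarrow> tval t e < tval u e"
| "so_sat (SMem t X) e V \<longleftrightarrow> tval t e \<in> V X"
| "so_sat (SNot \<phi>) e V \<longleftrightarrow> \<not> so_sat \<phi> e V"
| "so_sat (SAnd \<phi> \<psi>) e V \<longleftrightarrow> so_sat \<phi> e V \<and> so_sat \<psi> e V"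
| "so_sat (SOr \<phi> \<psi>) e V \<longleftrightarrow> so_sat \<phi> e V \<or> so_sat \<psi> e V"
| "so_sat (SExNum x \<phi>) e V \<longleftrightarrow> (\<exists>n. so_sat \<phi> (e(x := n)) V)"
| "so_sat (SAllNum x \<phi>) e V \<longleftrightarrow> (\<forall>n. so_sat \<phi> (e(x := n)) V)"
| "so_sat (SExSet X \<phi>) e V \<longleftrightarrow> (\<exists>A. so_sat \<phi> e (V(X := A)))"
| "so_sat (SAllSet X \<phi>) e V \<longleftrightarrow> (\<forall>A. so_sat \<phi> e (V(X := A)))"

primrec arithmetical :: "so_formula \<Rightarrow> bool" where
  "arithmetical (SEq t u) \<longleftrightarrow> True"
| "arithmetical (SLess t u) \<longleftrightarrow> True"
| "arithmetical (SMem t X) \<longleftrightarrow> True"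
| "arithmetical (SNot \<phi>) \<longleftrightarrow> arithmetical \<phi>"
| "arithmetical (SAnd \<phi> \<psi>) \<longleftrightarrow> arithmetical \<phi> \<and> arithmetical \<psi>"
| "arithmetical (SOr \<phi> \<psi>) \<longleftrightarrow> arithmetical \<phi> \<and> arithmetical \<psi>"
| "arithmetical (SExNum x \<phi>) \<longleftrightarrow> arithmetical \<phi>"
| "arithmetical (SAllNum x \<phi>) \<longleftrightarrow> arithmetical \<phi>"
| "arithmetical (SExSet X \<phi>) \<longleftrightarrow> False"
| "arithmetical (SAllSet X \<phi>) \<longleftrightarrow> False"

inductive Sigma11_formula :: "so_formula \<Rightarrow> bool" where
  "arithmetical \<phi> \<Longrightarrow> Sigma11_formula \<phi>"
| "Sigma11_formula \<phi> \<Longrightarrow> Sigma11_formula (SExSet X \<phi>)"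

inductive Pi11_formula :: "so_formula \<Rightarrow> bool" where
  "arithmetical \<phi> \<Longrightarrow> Pi11_formula \<phi>"
| "Pi11_formula \<phi> \<Longrightarrow> Pi11_formula (SAllSet X \<phi>)"

text \<open>The set of numbers defined by a formula in the number variable 0.  There are no parameters:
  any other free variable is read as 0 or as the empty set.\<close>

definition defined_set :: "so_formula \<Rightarrow> nat set" where
  "defined_set \<phi> = {n. so_sat \<phi> ((\<lambda>_. 0)(0 := n)) (\<lambda>_. {})}"

definition Sigma11 :: "nat set set" where
  "Sigma11 = {defined_set \<phi> | \<phi>. Sigma11_formula \<phi>}"

definition Pi11 :: "nat set set" where
  "Pi11 = {defined_set \<phi> | \<phi>. Pi11_formula \<phi>}"


section \<open>Hardness\<close>

definition many_one_reducible :: "nat set \<Rightarrow> problem \<Rightarrow> bool" where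
  "many_one_reducible A Q \<longleftrightarrow>
     (\<exists>f. computable f \<and> (\<forall>n. f n \<in> fst Q \<and> (n \<in> A \<longleftrightarrow> f n \<in> snd Q)))"

definition hard_for :: "nat set set \<Rightarrow> problem \<Rightarrow> bool" where
  "hard_for C Q \<longleftrightarrow> (\<forall>A\<in>C. many_one_reducible A Q)"

end

theory Submission
  imports Defs "HOL-Library.Countable" "HOL-Number_Theory.Cong"
begin

text \<open>On the uniform complete chain with \<open>2 N\<close> states, a predicate can store an assignment of numbers
  \<open>e 0, \<dots>, e (N - 1)\<close>: state \<open>2 i\<close> carries \<open>q ^ e i\<close> and state \<open>2 i + 1\<close> carries \<open>1 - q ^ e i\<close>, where
  \<open>q = 1 / (2 N)\<close>.  Copying, resetting and incrementing entries, and comparing them through a threshold on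
  an average, are all expressible.  The codes form an antichain, so a monotone
  transformer can represent any relation on assignments, and fixpoints of type \<open>Prop \<rightarrow> Prop\<close>
  compute least and greatest fixpoints of monotone operators on such relations.  This yields number quantifiers,
  addition and multiplication, hence all arithmetical relations and their complements.

  A sentence with existential set quantifiers over an arithmetical matrix is true iff some function
  \<open>f\<close> records, for every instance of every subformula, a truth value (and a witness for
  existential instances) without local inconsistency, that is, iff every finite restriction of
  \<open>f\<close> is consistent.  Since finite sequences are numbers, the existence of such an \<open>f\<close> is the
  existence of an infinite path in an arithmetical relation: a greatest fixpoint, whose complement is
  a least fixpoint.  The input number enters as an iterated application of the successor
  operation.\<close>

section \<open>Fixpoints of predicate transformers\<close>

text \<open>Formulas denote monotone functions, so negation is the obstacle throughout. No formula
  can succeed at one code and fail at a larger one; this is why codes must be incomparable, and why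
  every relation is treated together with its complement. The base of the exponentials comes from
  the chain: the next-step average of a predicate supported on one of the \<open>2 N\<close> states
  is its value there divided by \<open>2 N\<close>, so with this base an increment is a single
  averaging. A fixpoint ranges over all predicates, including those that code nothing, and could
  take fractional values; it is therefore squeezed at the codes between extremal transformers.
  Witnesses are recorded because an existential claim whose instances are all false is wrong only
  globally: no finite restriction would refute it. With a named witness every error shows in
  finitely many values. Witnesses are unbounded, so the tree of consistent finite sequences may
  branch infinitely, and arbitrarily long sequences need not yield an infinite one. Hence a fixpoint
  over relations, not a quantifier over lengths.\<close>

lemma fixpoint_exists:
  assumes refl: "\<And>x. x \<in> D \<Longrightarrow> le x x"
    and antisym: "\<And>x y. x \<in> D \<Longrightarrow> y \<in> D \<Longrightarrow> le x y \<Longrightarrow> le y x \<Longrightarrow> x = y"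
    and trans: "\<And>x y z. x \<in> D \<Longrightarrow> y \<in> D \<Longrightarrow> z \<in> D \<Longrightarrow> le x y \<Longrightarrow> le y z \<Longrightarrow> le x z"
    and inf: "\<And>A. A \<subseteq> D \<Longrightarrow> \<exists>m\<in>D. (\<forall>a\<in>A. le m a) \<and> (\<forall>l\<in>D. (\<forall>a\<in>A. le l a) \<longrightarrow> le l m)"
    and maps: "\<And>x. x \<in> D \<Longrightarrow> G x \<in> D"
    and mono: "\<And>x y. x \<in> D \<Longrightarrow> y \<in> D \<Longrightarrow> le x y \<Longrightarrow> le (G x) (G y)"
  shows "\<exists>v\<in>D. G v = v \<and> (\<forall>w\<in>D. le (G w) w \<longrightarrow> le v w)"
proof -
  \<comment> \<open>The pre-fixpoints, whose infimum is \<open>v\<close>. The conclusion keeps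
    \<open>v\<close> below every pre-fixpoint, not just below fixpoints; later comparisons rely on
    this form.\<close>
  let ?A = "{w \<in> D. le (G w) w}"
  obtain v where v: "v \<in> D" "\<And>w. w \<in> D \<Longrightarrow> le (G w) w \<Longrightarrow> le v w"
    and gr: "\<And>l. l \<in> D \<Longrightarrow> (\<And>w. w \<in> D \<Longrightarrow> le (G w) w \<Longrightarrow> le l w) \<Longrightarrow> le l v"
    using inf[of ?A] by blast
  have "le (G v) v"
    by (rule gr) (meson maps mono trans v)+
  moreover from this have "le v (G v)"
    by (intro v(2)) (simp_all add: maps mono v(1))
  ultimately show ?thesis
    using antisym maps v by metis
qed

section \<open>The complete lattice of monotone predicate transformers\<close>

abbreviation fn_ty :: ty where "fn_ty \<equiv> Prp \<rightarrow>\<^sub>t Prp"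

lemma preds_ext: "x \<in> preds S \<Longrightarrow> y \<in> preds S \<Longrightarrow> (\<And>s. s \<in> S \<Longrightarrow> x s = y s) \<Longrightarrow> x = y"
  unfolding preds_def by (rule PiE_ext)

lemma preds_bounds: "x \<in> preds S \<Longrightarrow> s \<in> S \<Longrightarrow> 0 \<le> x s \<and> x s \<le> 1"
  unfolding preds_def by (auto dest: PiE_mem)

lemma restrict_in_preds: "(\<And>s. s \<in> S \<Longrightarrow> 0 \<le> f s \<and> f s \<le> 1) \<Longrightarrow> restrict f S \<in> preds S"
  unfolding preds_def by auto

lemma fn_dom_iff:
  "v \<in> dom_ty S fn_ty \<longleftrightarrow> (\<exists>F. v = Fun F \<and> F \<in> extensional (preds S)
     \<and> (\<forall>x\<in>preds S. F x \<in> Base ` preds S)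
     \<and> (\<forall>x\<in>preds S. \<forall>y\<in>preds S. le_pred S x y \<longrightarrow> le_pred S (base (F x)) (base (F y))))"
  by (simp add: PiE_def Pi_def) blast

lemma fn_domI:
  assumes "\<And>x. x \<in> preds S \<Longrightarrow> F x \<in> preds S"
    and "\<And>x y. x \<in> preds S \<Longrightarrow> y \<in> preds S \<Longrightarrow> le_pred S x y \<Longrightarrow> le_pred S (F x) (F y)"
  shows "Fun (\<lambda>x\<in>preds S. Base (F x)) \<in> dom_ty S fn_ty"
  unfolding fn_dom_iff using assms by auto

lemma fn_dom_app: "v \<in> dom_ty S fn_ty \<Longrightarrow> x \<in> preds S \<Longrightarrow> \<exists>y\<in>preds S. funv v x = Base y"
  unfolding fn_dom_iff by auto

lemma fn_dom_mono: "v \<in> dom_ty S fn_ty \<Longrightarrow> x \<in> preds S \<Longrightarrow> y \<in> preds S \<Longrightarrow> le_pred S x y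
   \<Longrightarrow> le_pred S (base (funv v x)) (base (funv v y))"
  unfolding fn_dom_iff by auto

lemma le_val_refl: "le_val S \<tau> v v"
  by (induction \<tau> arbitrary: v) (auto simp: le_pred_def)

lemma le_val_trans: "le_val S \<tau> u v \<Longrightarrow> le_val S \<tau> v w \<Longrightarrow> le_val S \<tau> u w"
  by (induction \<tau> arbitrary: u v w) (auto simp: le_pred_def intro: order_trans)

lemma le_pred_antisym: "x \<in> preds S \<Longrightarrow> y \<in> preds S \<Longrightarrow> le_pred S x y \<Longrightarrow> le_pred S y x \<Longrightarrow> x = y"
  by (rule preds_ext) (auto simp: le_pred_def intro: antisym)

lemma fn_antisym:
  assumes "u \<in> dom_ty S fn_ty" "v \<in> dom_ty S fn_ty" "le_val S fn_ty u v" "le_val S fn_ty v u"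
  shows "u = v"
proof -
  obtain F G where F: "u = Fun F" "F \<in> extensional (preds S)" "\<forall>x\<in>preds S. F x \<in> Base ` preds S"
    and G: "v = Fun G" "G \<in> extensional (preds S)" "\<forall>x\<in>preds S. G x \<in> Base ` preds S"
    using assms(1,2) unfolding fn_dom_iff by blast
  have "F = G"
  proof (rule extensionalityI[OF F(2) G(2)])
    fix x assume "x \<in> preds S"
    moreover from this obtain y z where "F x = Base y" "G x = Base z" "y \<in> preds S" "z \<in> preds S"
      using F(3) G(3) by blast
    ultimately show "F x = G x"
      using bspec[OF assms(3)[unfolded le_val.simps F(1) G(1)], of x]
        bspec[OF assms(4)[unfolded le_val.simps F(1) G(1)], of x] le_pred_antisym[of y S z] by auto
  qed
  then show ?thesis by (simp add: F G)
qed

lemma fn_inf: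
  assumes A: "A \<subseteq> dom_ty S fn_ty"
  shows "\<exists>m\<in>dom_ty S fn_ty. (\<forall>a\<in>A. le_val S fn_ty m a)
           \<and> (\<forall>l\<in>dom_ty S fn_ty. (\<forall>a\<in>A. le_val S fn_ty l a) \<longrightarrow> le_val S fn_ty l m)"
proof -
  \<comment> \<open>The element 1 keeps the set nonempty, so the real infimum obeys its laws; the
    empty family gets the constant 1, which is the top transformer.\<close>
  define B where "B x s = insert 1 ((\<lambda>a. base (funv a x) s) ` A)" for x s
  define h where "h x = (\<lambda>s\<in>S. Inf (B x s))" for x
  have bnd: "0 \<le> base (funv a x) s \<and> base (funv a x) s \<le> 1"
    if "a \<in> A" "x \<in> preds S" "s \<in> S" for a x s
    using fn_dom_app[of a S x] A that by (force dest: preds_bounds)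
  have bdd: "bdd_below (B x s)" if "x \<in> preds S" "s \<in> S" for x s
    unfolding B_def using that bnd by (intro bdd_belowI[of _ 0]) auto
  have hle: "h x s \<le> b" if "x \<in> preds S" "s \<in> S" "b \<in> B x s" for x s b
    using that bdd by (simp add: h_def cInf_lower)
  have hge: "c \<le> h x s" if "s \<in> S" "\<And>b. b \<in> B x s \<Longrightarrow> c \<le> b" for x s c
    using that by (simp add: h_def) (rule cInf_greatest, auto simp: B_def)
  have hp: "h x \<in> preds S" if x: "x \<in> preds S" for x
    unfolding h_def
  proof (rule restrict_in_preds)
    fix s assume s: "s \<in> S"
    show "0 \<le> Inf (B x s) \<and> Inf (B x s) \<le> 1"
    proof
      have "0 \<le> h x s" by (rule hge[OF s]) (use bnd[OF _ x s] in \<open>auto simp: B_def\<close>)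
      then show "0 \<le> Inf (B x s)" using s by (simp add: h_def)
      have "h x s \<le> 1" by (rule hle[OF x s]) (simp add: B_def)
      then show "Inf (B x s) \<le> 1" using s by (simp add: h_def)
    qed
  qed
  let ?m = "Fun (\<lambda>x\<in>preds S. Base (h x))"
  have "?m \<in> dom_ty S fn_ty"
  proof (rule fn_domI[OF hp])
    fix x y assume x: "x \<in> preds S" and y: "y \<in> preds S" and le: "le_pred S x y"
    show "le_pred S (h x) (h y)"
      unfolding le_pred_def
    proof (intro ballI hge)
      fix s b assume s: "s \<in> S" and b: "b \<in> B y s"
      show "h x s \<le> b"
      proof (cases "b = 1")
        case True
        then show ?thesis by (intro hle x s) (simp add: B_def)
      next
        case False
        then obtain a where a: "a \<in> A" "b = base (funv a y) s" using b by (auto simp: B_def)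
        have "h x s \<le> base (funv a x) s" by (intro hle x s) (simp add: B_def a)
        also have "\<dots> \<le> b"
          using fn_dom_mono[OF _ x y le, of a] A a s by (auto simp: le_pred_def)
        finally show ?thesis .
      qed
    qed
  qed
  moreover have "le_val S fn_ty ?m a" if "a \<in> A" for a
    using that by (auto simp: le_pred_def B_def intro!: hle)
  moreover have "le_val S fn_ty l ?m"
    if l: "l \<in> dom_ty S fn_ty" "\<forall>a\<in>A. le_val S fn_ty l a" for l
  proof -
    have "base (funv l x) s \<le> h x s" if x: "x \<in> preds S" and s: "s \<in> S" for x s
      using hge[OF s] fn_dom_app[OF l(1) x] preds_bounds[OF _ s] l(2) x s
      by (force simp: B_def le_pred_def)
    then show ?thesis by (auto simp: le_pred_def)
  qed
  ultimately show ?thesis by blast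
qed

text \<open>A supremum is the infimum of the upper bounds.\<close>

lemma fn_sup:
  assumes A: "A \<subseteq> dom_ty S fn_ty"
  shows "\<exists>m\<in>dom_ty S fn_ty. (\<forall>a\<in>A. le_val S fn_ty a m)
           \<and> (\<forall>l\<in>dom_ty S fn_ty. (\<forall>a\<in>A. le_val S fn_ty a l) \<longrightarrow> le_val S fn_ty m l)"
  using fn_inf[of "{u \<in> dom_ty S fn_ty. \<forall>a\<in>A. le_val S fn_ty a u}" S] A
  by (smt (verit, best) mem_Collect_eq subset_iff)

text \<open>\<open>least_fixpoint\<close> is a definite description: Knaster-Tarski gives existence
  and antisymmetry gives uniqueness, after which the value lies even below all
  pre-fixpoints.\<close>

lemma least_fixpoint_fn:
  assumes maps: "\<And>x. x \<in> dom_ty S fn_ty \<Longrightarrow> G x \<in> dom_ty S fn_ty"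
    and mono: "\<And>x y. x \<in> dom_ty S fn_ty \<Longrightarrow> y \<in> dom_ty S fn_ty \<Longrightarrow> le_val S fn_ty x y
                 \<Longrightarrow> le_val S fn_ty (G x) (G y)"
  defines "v \<equiv> least_fixpoint S fn_ty G"
  shows "v \<in> dom_ty S fn_ty" "G v = v"
    "\<And>w. w \<in> dom_ty S fn_ty \<Longrightarrow> le_val S fn_ty (G w) w \<Longrightarrow> le_val S fn_ty v w"
proof -
  have ex: "\<exists>u\<in>dom_ty S fn_ty. G u = u
      \<and> (\<forall>w\<in>dom_ty S fn_ty. le_val S fn_ty (G w) w \<longrightarrow> le_val S fn_ty u w)"
    by (rule fixpoint_exists[where le = "le_val S fn_ty"])
      (blast intro: le_val_refl fn_antisym le_val_trans fn_inf maps mono)+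
  obtain u where u: "u \<in> dom_ty S fn_ty" "G u = u"
    "\<And>w. w \<in> dom_ty S fn_ty \<Longrightarrow> le_val S fn_ty (G w) w \<Longrightarrow> le_val S fn_ty u w"
    using ex by blast
  have "v = u"
    unfolding v_def least_fixpoint_def
    by (rule the_equality) (use u le_val_refl fn_antisym in \<open>metis+\<close>)
  then show "v \<in> dom_ty S fn_ty" "G v = v"
    "\<And>w. w \<in> dom_ty S fn_ty \<Longrightarrow> le_val S fn_ty (G w) w \<Longrightarrow> le_val S fn_ty v w"
    using u by simp_all
qed

lemma greatest_fixpoint_fn:
  assumes maps: "\<And>x. x \<in> dom_ty S fn_ty \<Longrightarrow> G x \<in> dom_ty S fn_ty"
    and mono: "\<And>x y. x \<in> dom_ty S fn_ty \<Longrightarrow> y \<in> dom_ty S fn_ty \<Longrightarrow> le_val S fn_ty x y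
                 \<Longrightarrow> le_val S fn_ty (G x) (G y)"
  defines "v \<equiv> greatest_fixpoint S fn_ty G"
  shows "v \<in> dom_ty S fn_ty" "G v = v"
    "\<And>w. w \<in> dom_ty S fn_ty \<Longrightarrow> le_val S fn_ty w (G w) \<Longrightarrow> le_val S fn_ty w v"
proof -
  have ex: "\<exists>u\<in>dom_ty S fn_ty. G u = u
      \<and> (\<forall>w\<in>dom_ty S fn_ty. le_val S fn_ty w (G w) \<longrightarrow> le_val S fn_ty w u)"
    \<comment> \<open>The order is reversed, so suprema take the place of infima.\<close>
    by (rule fixpoint_exists[where le = "\<lambda>x y. le_val S fn_ty y x"])
      (blast intro: le_val_refl fn_antisym le_val_trans fn_sup maps mono)+
  obtain u where u: "u \<in> dom_ty S fn_ty" "G u = u"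
    "\<And>w. w \<in> dom_ty S fn_ty \<Longrightarrow> le_val S fn_ty w (G w) \<Longrightarrow> le_val S fn_ty w u"
    using ex by blast
  have "v = u"
    unfolding v_def greatest_fixpoint_def
    by (rule the_equality) (use u le_val_refl fn_antisym in \<open>metis+\<close>)
  then show "v \<in> dom_ty S fn_ty" "G v = v"
    "\<And>w. w \<in> dom_ty S fn_ty \<Longrightarrow> le_val S fn_ty w (G w) \<Longrightarrow> le_val S fn_ty w v"
    using u by simp_all
qed

section \<open>Formulas over the uniform chain\<close>

locale uniform_chain =
  fixes N :: nat
  assumes N_pos: "0 < N"
begin

definition sz :: nat where "sz = 2 * N"

abbreviation S :: "nat set" where "S \<equiv> {..<sz}"

text \<open>Proposition \<open>p < sz\<close> names the single state \<open>p\<close>, and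
  \<open>sz + p\<close> its complement. Besides closing the propositions under negation, such a pair
  acts as a mask that selects or protects one state. All transition probabilities are equal and
  positive, so \<open>Dia\<close> is the maximum and \<open>Nxt\<close> the average over all
  states.\<close>

definition pres :: mc_pres where
  "pres = (replicate sz (replicate sz (1 / of_nat sz)),
     map (\<lambda>p. [p]) [0..<sz] @ map (\<lambda>p. filter (\<lambda>s. s \<noteq> p) [0..<sz]) [0..<sz], 0)"

definition M :: "(nat, nat) mchain" where "M = chain_of pres"

lemma sz_pos: "0 < sz" and sz_ge_2: "2 \<le> sz"
  using N_pos by (auto simp: sz_def)

lemma states_M [simp]: "states M = S"
  by (simp add: M_def pres_def)

lemma prob_M: "i < sz \<Longrightarrow> j < sz \<Longrightarrow> prob M i j = 1 / real sz"
  by (simp add: M_def pres_def of_rat_divide)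

lemma label_M: "p < sz \<Longrightarrow> label M p = {p}"
  by (simp add: M_def pres_def nth_append)

lemma label_M_compl: "p < sz \<Longrightarrow> label M (sz + p) = S - {p}"
  by (auto simp: M_def pres_def nth_append)

lemma init_M [simp]: "init M = 0"
  by (simp add: M_def pres_def)

lemma AP_of_pres: "AP_of pres = {..<2 * sz}"
  by (simp add: pres_def mult_2)

lemma pres_ok: "mc_pres_ok pres"
proof -
  have "\<exists>q\<in>{..<2 * sz}. label M q = S - label M p" "label M p \<subseteq> S" if "p < 2 * sz" for p
  proof -
    have *: "S - (S - {r}) = {r}" if "r < sz" for r using that by auto
    have "p < sz \<or> (\<exists>r. p = sz + r \<and> r < sz)"
      using that by presburger
    then consider "p < sz" | r where "p = sz + r" "r < sz" by blast
    then have "(\<exists>q\<in>{..<2 * sz}. label M q = S - label M p) \<and> label M p \<subseteq> S"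
    proof cases
      case 1
      then show ?thesis
        by (intro conjI bexI[of _ "sz + p"]) (auto simp: label_M label_M_compl)
    next
      case 2
      then show ?thesis
        by (intro conjI bexI[of _ r]) (auto simp: label_M label_M_compl *)
    qed
    then show "\<exists>q\<in>{..<2 * sz}. label M q = S - label M p" "label M p \<subseteq> S" by auto
  qed
  then have "markov_chain {..<2 * sz} M"
    unfolding markov_chain_def using sz_pos by (auto simp: prob_M)
  moreover obtain rows labs s0 where p: "pres = (rows, labs, s0)" by (cases pres)
  moreover from p have "\<forall>row\<in>set rows. length row = length rows"
    by (auto simp: pres_def)
  ultimately show ?thesis using AP_of_pres by (simp add: M_def)
qed

lemma sem_Nxt: "sem M (Nxt \<phi>) \<rho> = Base (\<lambda>s\<in>S. (\<Sum>s'<sz. base (sem M \<phi> \<rho>) s') / real sz)"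
  by (auto simp: prob_M sum_divide_distrib intro!: restrict_ext sum.cong)

lemma sem_Dia: "sem M (Dia \<phi>) \<rho> = Base (\<lambda>s\<in>S. Max (base (sem M \<phi> \<rho>) ` S))"
proof -
  have "{s' \<in> S. prob M s s' > 0} = S" if "s \<in> S" for s
    using that sz_pos by (auto simp: prob_M)
  then show ?thesis by (auto intro!: restrict_ext)
qed

section \<open>Well-typed formulas with monotone semantics\<close>

declare sem.simps(7,8) [simp del]

text \<open>Variable 0 holds a predicate; the variables in \<open>J\<close> hold predicate transformers.\<close>

definition wf_ctx :: "nat set \<Rightarrow> (nat \<rightharpoonup> ty) \<Rightarrow> bool" where
  "wf_ctx J \<Gamma> \<longleftrightarrow> \<Gamma> 0 = Some Prp \<and> (\<forall>j\<in>J. \<Gamma> j = Some fn_ty)"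

definition wf_env :: "nat set \<Rightarrow> (nat \<Rightarrow> nat val) \<Rightarrow> bool" where
  "wf_env J \<rho> \<longleftrightarrow> \<rho> 0 \<in> dom_ty S Prp \<and> (\<forall>j\<in>J. \<rho> j \<in> dom_ty S fn_ty)"

definition le_env :: "nat set \<Rightarrow> (nat \<Rightarrow> nat val) \<Rightarrow> (nat \<Rightarrow> nat val) \<Rightarrow> bool" where
  "le_env J \<rho> \<rho>' \<longleftrightarrow> le_val S Prp (\<rho> 0) (\<rho>' 0) \<and> (\<forall>j\<in>J. le_val S fn_ty (\<rho> j) (\<rho>' j))"

text \<open>Typing and meaning are bundled because the fixpoint descriptions are known to denote
  only when the body maps the domain monotonically into itself. Variable 0 stays outside
  \<open>J\<close>, so binding the argument never captures a transformer.\<close>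

definition ok :: "ty \<Rightarrow> nat set \<Rightarrow> nat phfl \<Rightarrow> bool" where
  "ok \<tau> J \<psi> \<longleftrightarrow> 0 \<notin> J \<and> props \<psi> \<subseteq> {..<2 * sz}
     \<and> (\<forall>\<Gamma>. wf_ctx J \<Gamma> \<longrightarrow> (\<exists>k\<le>1. typing \<Gamma> \<psi> \<tau> k))
     \<and> (\<forall>\<rho>. wf_env J \<rho> \<longrightarrow> sem M \<psi> \<rho> \<in> dom_ty S \<tau>)
     \<and> (\<forall>\<rho> \<rho>'. wf_env J \<rho> \<longrightarrow> wf_env J \<rho>' \<longrightarrow> le_env J \<rho> \<rho>' \<longrightarrow> le_val S \<tau> (sem M \<psi> \<rho>) (sem M \<psi> \<rho>'))"

lemma okI:
  assumes "0 \<notin> J" "props \<psi> \<subseteq> {..<2 * sz}"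
    and "\<And>\<Gamma>. wf_ctx J \<Gamma> \<Longrightarrow> \<exists>k\<le>1. typing \<Gamma> \<psi> \<tau> k"
    and "\<And>\<rho>. wf_env J \<rho> \<Longrightarrow> sem M \<psi> \<rho> \<in> dom_ty S \<tau>"
    and "\<And>\<rho> \<rho>'. wf_env J \<rho> \<Longrightarrow> wf_env J \<rho>' \<Longrightarrow> le_env J \<rho> \<rho>'
           \<Longrightarrow> le_val S \<tau> (sem M \<psi> \<rho>) (sem M \<psi> \<rho>')"
  shows "ok \<tau> J \<psi>"
  using assms unfolding ok_def by blast

lemma
  assumes "ok \<tau> J \<psi>"
  shows ok_0: "0 \<notin> J" and ok_props: "props \<psi> \<subseteq> {..<2 * sz}"
    and ok_typing: "wf_ctx J \<Gamma> \<Longrightarrow> \<exists>k\<le>1. typing \<Gamma> \<psi> \<tau> k"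
    and ok_dom: "wf_env J \<rho> \<Longrightarrow> sem M \<psi> \<rho> \<in> dom_ty S \<tau>"
    and ok_mono: "wf_env J \<rho> \<Longrightarrow> wf_env J \<rho>' \<Longrightarrow> le_env J \<rho> \<rho>'
           \<Longrightarrow> le_val S \<tau> (sem M \<psi> \<rho>) (sem M \<psi> \<rho>')"
  using assms unfolding ok_def by blast+

lemma wf_env_mono: "wf_env J' \<rho> \<Longrightarrow> J \<subseteq> J' \<Longrightarrow> wf_env J \<rho>"
  unfolding wf_env_def by blast

lemma wf_ctx_mono: "wf_ctx J' \<Gamma> \<Longrightarrow> J \<subseteq> J' \<Longrightarrow> wf_ctx J \<Gamma>"
  unfolding wf_ctx_def by blast

lemma le_env_mono: "le_env J' \<rho> \<rho>' \<Longrightarrow> J \<subseteq> J' \<Longrightarrow> le_env J \<rho> \<rho>'"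
  unfolding le_env_def by blast

lemma ok_weaken: "ok \<tau> J \<psi> \<Longrightarrow> J \<subseteq> J' \<Longrightarrow> 0 \<notin> J' \<Longrightarrow> ok \<tau> J' \<psi>"
  by (rule okI) (blast dest: ok_props intro: ok_typing ok_dom ok_mono wf_ctx_mono wf_env_mono le_env_mono)+

lemma ok_PrpI:
  assumes "0 \<notin> J" "props \<psi> \<subseteq> {..<2 * sz}"
    and "\<And>\<Gamma>. wf_ctx J \<Gamma> \<Longrightarrow> \<exists>k\<le>1. typing \<Gamma> \<psi> Prp k"
    and sem: "\<And>\<rho>. sem M \<psi> \<rho> = Base (\<lambda>s\<in>S. f \<rho> s)"
    and bnd: "\<And>\<rho> s. wf_env J \<rho> \<Longrightarrow> s \<in> S \<Longrightarrow> 0 \<le> f \<rho> s \<and> f \<rho> s \<le> 1"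
    and mono: "\<And>\<rho> \<rho>' s. wf_env J \<rho> \<Longrightarrow> wf_env J \<rho>' \<Longrightarrow> le_env J \<rho> \<rho>' \<Longrightarrow> s \<in> S \<Longrightarrow> f \<rho> s \<le> f \<rho>' s"
  shows "ok Prp J \<psi>"
proof (rule okI)
  show "sem M \<psi> \<rho> \<in> dom_ty S Prp" if "wf_env J \<rho>" for \<rho>
    unfolding sem dom_ty.simps by (rule imageI, rule restrict_in_preds, rule bnd[OF that])
  show "le_val S Prp (sem M \<psi> \<rho>) (sem M \<psi> \<rho>')"
    if "wf_env J \<rho>" "wf_env J \<rho>'" "le_env J \<rho> \<rho>'" for \<rho> \<rho>'
    unfolding sem using mono[OF that] by (simp add: le_pred_def)
qed (use assms in blast)+

lemma ok_bounds:
  assumes "ok Prp J \<psi>" "wf_env J \<rho>" "s \<in> S"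
  shows "0 \<le> base (sem M \<psi> \<rho>) s \<and> base (sem M \<psi> \<rho>) s \<le> 1"
  using ok_dom[OF assms(1,2)] assms(3) by (auto dest: preds_bounds)

lemma ok_mono_Prp:
  assumes "ok Prp J \<psi>" "wf_env J \<rho>" "wf_env J \<rho>'" "le_env J \<rho> \<rho>'" "s \<in> S"
  shows "base (sem M \<psi> \<rho>) s \<le> base (sem M \<psi> \<rho>') s"
  using ok_mono[OF assms(1-4)] assms(5) by (simp add: le_pred_def)

lemma ok_Var0: "0 \<notin> J \<Longrightarrow> ok Prp J (Var 0)"
proof (rule okI)
  fix \<Gamma> :: "nat \<rightharpoonup> ty" assume "wf_ctx J \<Gamma>"
  then have "typing \<Gamma> (Var 0) Prp (ord_ty Prp)" by (intro typing.intros) (simp add: wf_ctx_def)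
  then show "\<exists>k\<le>1. typing \<Gamma> (Var 0) Prp k" by auto
qed (auto simp: wf_env_def le_env_def)

lemma ok_Var: "0 \<notin> J \<Longrightarrow> j \<in> J \<Longrightarrow> ok fn_ty J (Var j)"
proof (rule okI)
  fix \<Gamma> :: "nat \<rightharpoonup> ty" assume "j \<in> J" "wf_ctx J \<Gamma>"
  then have "typing \<Gamma> (Var j) fn_ty (ord_ty fn_ty)" by (intro typing.intros) (simp add: wf_ctx_def)
  then show "\<exists>k\<le>1. typing \<Gamma> (Var j) fn_ty k" by auto
qed (unfold wf_env_def le_env_def sem.simps, auto)

lemma ok_Atom: "0 \<notin> J \<Longrightarrow> p < 2 * sz \<Longrightarrow> ok Prp J (Atom p)"
  by (rule ok_PrpI[where f = "\<lambda>\<rho> s. if s \<in> label M p then 1 else 0"])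
    (auto intro: typing.intros)

lemma ok_Or: "ok Prp J \<phi> \<Longrightarrow> ok Prp J \<psi> \<Longrightarrow> ok Prp J (Or \<phi> \<psi>)"
proof (rule ok_PrpI[where f = "\<lambda>\<rho> s. max (base (sem M \<phi> \<rho>) s) (base (sem M \<psi> \<rho>) s)"])
  fix \<Gamma> assume *: "ok Prp J \<phi>" "ok Prp J \<psi>" "wf_ctx J \<Gamma>"
  obtain k l where "k \<le> 1" "l \<le> 1" "typing \<Gamma> \<phi> Prp k" "typing \<Gamma> \<psi> Prp l"
    using ok_typing[OF *(1,3)] ok_typing[OF *(2,3)] by blast
  then show "\<exists>k\<le>1. typing \<Gamma> (Or \<phi> \<psi>) Prp k"
    by (intro exI[of _ "max k l"]) (auto intro: typing.intros)
next
  fix \<rho> s assume *: "ok Prp J \<phi>" "ok Prp J \<psi>" "wf_env J \<rho>" "s \<in> S"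
  show "0 \<le> max (base (sem M \<phi> \<rho>) s) (base (sem M \<psi> \<rho>) s)
      \<and> max (base (sem M \<phi> \<rho>) s) (base (sem M \<psi> \<rho>) s) \<le> 1"
    using ok_bounds[OF *(1,3,4)] ok_bounds[OF *(2,3,4)] by auto
next
  fix \<rho> \<rho>' s assume *: "ok Prp J \<phi>" "ok Prp J \<psi>" and w: "wf_env J \<rho>" "wf_env J \<rho>'" "le_env J \<rho> \<rho>'" "s \<in> S"
  show "max (base (sem M \<phi> \<rho>) s) (base (sem M \<psi> \<rho>) s)
      \<le> max (base (sem M \<phi> \<rho>') s) (base (sem M \<psi> \<rho>') s)"
    using ok_mono_Prp[OF *(1) w] ok_mono_Prp[OF *(2) w] by (rule max.mono)
qed (auto dest: ok_0 ok_props)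

lemma ok_And: "ok Prp J \<phi> \<Longrightarrow> ok Prp J \<psi> \<Longrightarrow> ok Prp J (And \<phi> \<psi>)"
proof (rule ok_PrpI[where f = "\<lambda>\<rho> s. min (base (sem M \<phi> \<rho>) s) (base (sem M \<psi> \<rho>) s)"])
  fix \<Gamma> assume *: "ok Prp J \<phi>" "ok Prp J \<psi>" "wf_ctx J \<Gamma>"
  obtain k l where "k \<le> 1" "l \<le> 1" "typing \<Gamma> \<phi> Prp k" "typing \<Gamma> \<psi> Prp l"
    using ok_typing[OF *(1,3)] ok_typing[OF *(2,3)] by blast
  then show "\<exists>k\<le>1. typing \<Gamma> (And \<phi> \<psi>) Prp k"
    by (intro exI[of _ "max k l"]) (auto intro: typing.intros)
next
  fix \<rho> s assume *: "ok Prp J \<phi>" "ok Prp J \<psi>" "wf_env J \<rho>" "s \<in> S"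
  show "0 \<le> min (base (sem M \<phi> \<rho>) s) (base (sem M \<psi> \<rho>) s)
      \<and> min (base (sem M \<phi> \<rho>) s) (base (sem M \<psi> \<rho>) s) \<le> 1"
    using ok_bounds[OF *(1,3,4)] ok_bounds[OF *(2,3,4)] by auto
next
  fix \<rho> \<rho>' s assume *: "ok Prp J \<phi>" "ok Prp J \<psi>" and w: "wf_env J \<rho>" "wf_env J \<rho>'" "le_env J \<rho> \<rho>'" "s \<in> S"
  show "min (base (sem M \<phi> \<rho>) s) (base (sem M \<psi> \<rho>) s)
      \<le> min (base (sem M \<phi> \<rho>') s) (base (sem M \<psi> \<rho>') s)"
    using ok_mono_Prp[OF *(1) w] ok_mono_Prp[OF *(2) w] by (rule min.mono)
qed (auto dest: ok_0 ok_props)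

lemma in_threshold_mono: "in_threshold x T \<Longrightarrow> x \<le> y \<Longrightarrow> in_threshold y T"
  by (cases T) auto

lemma ok_Thr: "ok Prp J \<phi> \<Longrightarrow> threshold_ok T \<Longrightarrow> ok Prp J (Thr T \<phi>)"
proof (rule ok_PrpI[where f = "\<lambda>\<rho> s. if in_threshold (base (sem M \<phi> \<rho>) s) T then 1 else 0"])
  fix \<Gamma> assume *: "ok Prp J \<phi>" "threshold_ok T" "wf_ctx J \<Gamma>"
  then show "\<exists>k\<le>1. typing \<Gamma> (Thr T \<phi>) Prp k"
    using ok_typing[OF *(1,3)] by (auto intro: typing.intros)
next
  fix \<rho> \<rho>' s assume "ok Prp J \<phi>" "wf_env J \<rho>" "wf_env J \<rho>'" "le_env J \<rho> \<rho>'" "s \<in> S"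
  then show "(if in_threshold (base (sem M \<phi> \<rho>) s) T then 1 else 0)
      \<le> (if in_threshold (base (sem M \<phi> \<rho>') s) T then 1 else 0 :: real)"
    by (auto dest: in_threshold_mono ok_mono_Prp)
qed (auto dest: ok_0 ok_props)

lemma ok_Dia: "ok Prp J \<phi> \<Longrightarrow> ok Prp J (Dia \<phi>)"
proof (rule ok_PrpI[where f = "\<lambda>\<rho> s. Max (base (sem M \<phi> \<rho>) ` S)"])
  fix \<Gamma> assume *: "ok Prp J \<phi>" "wf_ctx J \<Gamma>"
  then show "\<exists>k\<le>1. typing \<Gamma> (Dia \<phi>) Prp k"
    using ok_typing[OF *] by (auto intro: typing.intros)
next
  fix \<rho> s assume *: "ok Prp J \<phi>" "wf_env J \<rho>" "s \<in> S"
  then show "0 \<le> Max (base (sem M \<phi> \<rho>) ` S) \<and> Max (base (sem M \<phi> \<rho>) ` S) \<le> 1"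
    using ok_bounds[OF *(1,2)] by (subst Max_ge_iff, simp, blast, subst Max_le_iff) auto
next
  fix \<rho> \<rho>' s assume *: "ok Prp J \<phi>" "wf_env J \<rho>" "wf_env J \<rho>'" "le_env J \<rho> \<rho>'" "s \<in> S"
  show "Max (base (sem M \<phi> \<rho>) ` S) \<le> Max (base (sem M \<phi> \<rho>') ` S)"
  proof (subst Max_le_iff; (intro ballI)?)
    fix a assume "a \<in> base (sem M \<phi> \<rho>) ` S"
    then obtain s where s: "s \<in> S" "a = base (sem M \<phi> \<rho>) s" by blast
    then have "a \<le> base (sem M \<phi> \<rho>') s" using ok_mono_Prp[OF *(1-4)] by simp
    also have "\<dots> \<le> Max (base (sem M \<phi> \<rho>') ` S)" using s by (intro Max_ge) auto
    finally show "a \<le> Max (base (sem M \<phi> \<rho>') ` S)" .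
  qed (use *(5) in auto)
qed (auto dest: ok_0 ok_props simp: sem_Dia)

lemma ok_Nxt: "ok Prp J \<phi> \<Longrightarrow> ok Prp J (Nxt \<phi>)"
proof (rule ok_PrpI[where f = "\<lambda>\<rho> s. (\<Sum>s'<sz. base (sem M \<phi> \<rho>) s') / real sz"])
  fix \<Gamma> assume *: "ok Prp J \<phi>" "wf_ctx J \<Gamma>"
  then show "\<exists>k\<le>1. typing \<Gamma> (Nxt \<phi>) Prp k"
    using ok_typing[OF *] by (auto intro: typing.intros)
next
  fix \<rho> s assume *: "ok Prp J \<phi>" "wf_env J \<rho>"
  have "(\<Sum>s'<sz. base (sem M \<phi> \<rho>) s') \<le> (\<Sum>s'<sz. 1)"
    using ok_bounds[OF *] by (intro sum_mono) auto
  then show "0 \<le> (\<Sum>s'<sz. base (sem M \<phi> \<rho>) s') / real sz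
      \<and> (\<Sum>s'<sz. base (sem M \<phi> \<rho>) s') / real sz \<le> 1"
    using ok_bounds[OF *] sz_pos by (auto intro!: divide_nonneg_nonneg sum_nonneg simp: field_simps)
next
  fix \<rho> \<rho>' s assume *: "ok Prp J \<phi>" "wf_env J \<rho>" "wf_env J \<rho>'" "le_env J \<rho> \<rho>'"
  show "(\<Sum>s'<sz. base (sem M \<phi> \<rho>) s') / real sz \<le> (\<Sum>s'<sz. base (sem M \<phi> \<rho>') s') / real sz"
    using ok_mono_Prp[OF *] by (intro divide_right_mono sum_mono) auto
qed (auto dest: ok_0 ok_props simp: sem_Nxt)

lemma ok_App:
  assumes f: "ok fn_ty J \<phi>" and x: "ok Prp J \<psi>"
  shows "ok Prp J (App \<phi> \<psi>)"
proof (rule okI)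
  fix \<Gamma> assume *: "wf_ctx J \<Gamma>"
  obtain k l where "k \<le> 1" "l \<le> 1" "typing \<Gamma> \<phi> fn_ty k" "typing \<Gamma> \<psi> Prp l"
    using ok_typing[OF f *] ok_typing[OF x *] by blast
  then show "\<exists>k\<le>1. typing \<Gamma> (App \<phi> \<psi>) Prp k"
    by (intro exI[of _ "max k l"]) (auto intro: typing.intros)
next
  fix \<rho> assume w: "wf_env J \<rho>"
  show "sem M (App \<phi> \<psi>) \<rho> \<in> dom_ty S Prp"
    using fn_dom_app[OF ok_dom[OF f w]] ok_dom[OF x w] by fastforce
next
  fix \<rho> \<rho>' assume w: "wf_env J \<rho>" "wf_env J \<rho>'" "le_env J \<rho> \<rho>'"
  have "base (sem M \<psi> \<rho>) \<in> preds S" "base (sem M \<psi> \<rho>') \<in> preds S"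
    using ok_dom[OF x w(1)] ok_dom[OF x w(2)] by auto
  then show "le_val S Prp (sem M (App \<phi> \<psi>) \<rho>) (sem M (App \<phi> \<psi>) \<rho>')"
    using fn_dom_mono[OF ok_dom[OF f w(2)], of "base (sem M \<psi> \<rho>)" "base (sem M \<psi> \<rho>')"]
      ok_mono[OF f w] ok_mono[OF x w] by (auto simp: le_pred_def intro: order_trans)
qed (use ok_0[OF f] ok_props[OF f] ok_props[OF x] in auto)

lemma ok_Lam:
  assumes f: "ok Prp J \<psi>"
  shows "ok fn_ty J (Lam 0 Prp \<psi>)"
proof (rule okI)
  have 0: "j \<noteq> 0" if "j \<in> J" for j using ok_0[OF f] that by metis
  fix \<Gamma> :: "nat \<rightharpoonup> ty" assume *: "wf_ctx J \<Gamma>"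
  then obtain k where "k \<le> 1" "typing (\<Gamma>(0 \<mapsto> Prp)) \<psi> Prp k"
    using ok_typing[OF f, of "\<Gamma>(0 \<mapsto> Prp)"] 0 by (auto simp: wf_ctx_def)
  then show "\<exists>k\<le>1. typing \<Gamma> (Lam 0 Prp \<psi>) fn_ty k"
    by (intro exI[of _ "max k (ord_ty fn_ty)"] conjI typing.intros) auto
next
  have 0: "j \<noteq> 0" if "j \<in> J" for j using ok_0[OF f] that by metis
  have wf: "wf_env J (\<rho>(0 := Base x))" if "wf_env J \<rho>" "x \<in> preds S" for \<rho> x
    using that 0 unfolding wf_env_def by (metis dom_ty.simps(1) fun_upd_apply imageI)
  have dom: "sem M \<psi> (\<rho>(0 := Base x)) \<in> Base ` preds S" if "wf_env J \<rho>" "x \<in> preds S" for \<rho> x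
    using ok_dom[OF f wf[OF that]] by simp
  have mono: "le_pred S (base (sem M \<psi> (\<rho>(0 := Base x)))) (base (sem M \<psi> (\<rho>'(0 := Base y))))"
    if "wf_env J \<rho>" "wf_env J \<rho>'" "le_env J \<rho> \<rho>'" "x \<in> preds S" "y \<in> preds S" "le_pred S x y" for \<rho> \<rho>' x y
  proof -
    have "le_env J (\<rho>(0 := Base x)) (\<rho>'(0 := Base y))"
      using that(3,6) 0 unfolding le_env_def by (metis fun_upd_apply le_val.simps(1) val.sel(1))
    then show ?thesis using ok_mono[OF f wf wf, of \<rho> x \<rho>' y] that by simp
  qed
  fix \<rho> assume w: "wf_env J \<rho>"
  \<comment> \<open>Reflexivity turns joint monotonicity into monotonicity in the argument
    alone.\<close>
  have "le_env J \<rho> \<rho>" by (simp add: le_env_def le_val_refl del: le_val.simps)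
  then show "sem M (Lam 0 Prp \<psi>) \<rho> \<in> dom_ty S fn_ty"
    unfolding fn_dom_iff using dom[OF w] mono[OF w w] by auto
  fix \<rho>' assume w': "wf_env J \<rho>'" "le_env J \<rho> \<rho>'"
  show "le_val S fn_ty (sem M (Lam 0 Prp \<psi>) \<rho>) (sem M (Lam 0 Prp \<psi>) \<rho>')"
    using mono[OF w w'] by (auto simp: le_pred_def)
qed (use ok_0[OF f] ok_props[OF f] in auto)

lemma wf_env_upd: "wf_env J \<rho> \<Longrightarrow> j \<noteq> 0 \<Longrightarrow> v \<in> dom_ty S fn_ty \<Longrightarrow> wf_env (insert j J) (\<rho>(j := v))"
  unfolding wf_env_def by (simp del: dom_ty.simps)

lemma le_env_upd: "le_env J \<rho> \<rho>' \<Longrightarrow> j \<noteq> 0 \<Longrightarrow> le_val S fn_ty v v'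
    \<Longrightarrow> le_env (insert j J) (\<rho>(j := v)) (\<rho>'(j := v'))"
  unfolding le_env_def by (simp del: le_val.simps)

lemma le_env_refl: "le_env J \<rho> \<rho>"
  by (simp add: le_env_def le_val_refl del: le_val.simps)

lemma
  assumes f: "ok fn_ty (insert j J) \<psi>" and w: "wf_env J \<rho>"
  defines "G \<equiv> \<lambda>v. sem M \<psi> (\<rho>(j := v))"
  shows body_dom: "v \<in> dom_ty S fn_ty \<Longrightarrow> G v \<in> dom_ty S fn_ty"
    and body_mono: "v \<in> dom_ty S fn_ty \<Longrightarrow> v' \<in> dom_ty S fn_ty \<Longrightarrow> le_val S fn_ty v v'
       \<Longrightarrow> le_val S fn_ty (G v) (G v')"
proof -
  have "j \<noteq> 0" using ok_0[OF f] by auto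
  then show "v \<in> dom_ty S fn_ty \<Longrightarrow> G v \<in> dom_ty S fn_ty"
    "v \<in> dom_ty S fn_ty \<Longrightarrow> v' \<in> dom_ty S fn_ty \<Longrightarrow> le_val S fn_ty v v'
       \<Longrightarrow> le_val S fn_ty (G v) (G v')"
    unfolding G_def
    by - (intro ok_dom[OF f] ok_mono[OF f] wf_env_upd le_env_upd le_env_refl w; assumption)+
qed

lemma ok_Mu:
  assumes f: "ok fn_ty (insert j J) \<psi>"
  shows "ok fn_ty J (Mu j fn_ty \<psi>)"
proof (rule okI)
  have j: "j \<noteq> 0" using ok_0[OF f] by auto
  fix \<Gamma> :: "nat \<rightharpoonup> ty" assume *: "wf_ctx J \<Gamma>"
  then have "wf_ctx (insert j J) (\<Gamma>(j \<mapsto> fn_ty))" using j by (auto simp: wf_ctx_def)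
  then show "\<exists>k\<le>1. typing \<Gamma> (Mu j fn_ty \<psi>) fn_ty k"
    using ok_typing[OF f] by (blast intro: typing.intros)
next
  have j: "j \<noteq> 0" using ok_0[OF f] by auto
  fix \<rho> assume w: "wf_env J \<rho>"
  note fp = least_fixpoint_fn[of S "\<lambda>v. sem M \<psi> (\<rho>(j := v))", OF body_dom[OF f w] body_mono[OF f w]]
  show "sem M (Mu j fn_ty \<psi>) \<rho> \<in> dom_ty S fn_ty"
    unfolding sem.simps states_M using fp by blast
  fix \<rho>' assume w': "wf_env J \<rho>'" and le: "le_env J \<rho> \<rho>'"
  note fp' = least_fixpoint_fn[of S "\<lambda>v. sem M \<psi> (\<rho>'(j := v))", OF body_dom[OF f w'] body_mono[OF f w']]
  let ?v = "least_fixpoint S fn_ty (\<lambda>v. sem M \<psi> (\<rho>'(j := v)))"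
  have v: "?v \<in> dom_ty S fn_ty" "sem M \<psi> (\<rho>'(j := ?v)) = ?v" using fp' by blast+
  \<comment> \<open>The fixpoint for the larger environment is a pre-fixpoint of the body in the
    smaller one.\<close>
  have "le_val S fn_ty (sem M \<psi> (\<rho>(j := ?v))) (sem M \<psi> (\<rho>'(j := ?v)))"
    by (intro ok_mono[OF f] wf_env_upd le_env_upd w w' le j le_val_refl v(1))
  then show "le_val S fn_ty (sem M (Mu j fn_ty \<psi>) \<rho>) (sem M (Mu j fn_ty \<psi>) \<rho>')"
    unfolding sem.simps states_M v(2) using fp v(1) by blast
qed (use ok_0[OF f] ok_props[OF f] in auto)

lemma ok_Nu:
  assumes f: "ok fn_ty (insert j J) \<psi>"
  shows "ok fn_ty J (Nu j fn_ty \<psi>)"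
proof (rule okI)
  have j: "j \<noteq> 0" using ok_0[OF f] by auto
  fix \<Gamma> :: "nat \<rightharpoonup> ty" assume *: "wf_ctx J \<Gamma>"
  then have "wf_ctx (insert j J) (\<Gamma>(j \<mapsto> fn_ty))" using j by (auto simp: wf_ctx_def)
  then show "\<exists>k\<le>1. typing \<Gamma> (Nu j fn_ty \<psi>) fn_ty k"
    using ok_typing[OF f] by (blast intro: typing.intros)
next
  have j: "j \<noteq> 0" using ok_0[OF f] by auto
  fix \<rho> \<rho>' assume w: "wf_env J \<rho>" and w': "wf_env J \<rho>'" and le: "le_env J \<rho> \<rho>'"
  note fp = greatest_fixpoint_fn[of S "\<lambda>v. sem M \<psi> (\<rho>(j := v))", OF body_dom[OF f w] body_mono[OF f w]]
  note fp' = greatest_fixpoint_fn[of S "\<lambda>v. sem M \<psi> (\<rho>'(j := v))", OF body_dom[OF f w'] body_mono[OF f w']]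
  let ?v = "greatest_fixpoint S fn_ty (\<lambda>v. sem M \<psi> (\<rho>(j := v)))"
  have v: "?v \<in> dom_ty S fn_ty" "sem M \<psi> (\<rho>(j := ?v)) = ?v" using fp by blast+
  have "le_val S fn_ty (sem M \<psi> (\<rho>(j := ?v))) (sem M \<psi> (\<rho>'(j := ?v)))"
    by (intro ok_mono[OF f] wf_env_upd le_env_upd w w' le j le_val_refl v(1))
  then show "le_val S fn_ty (sem M (Nu j fn_ty \<psi>) \<rho>) (sem M (Nu j fn_ty \<psi>) \<rho>')"
    unfolding sem.simps states_M v(2) using fp' v(1) by blast
next
  fix \<rho> assume w: "wf_env J \<rho>"
  show "sem M (Nu j fn_ty \<psi>) \<rho> \<in> dom_ty S fn_ty"
    unfolding sem.simps states_M
    using greatest_fixpoint_fn[of S "\<lambda>v. sem M \<psi> (\<rho>(j := v))", OF body_dom[OF f w] body_mono[OF f w]]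
    by blast
qed (use ok_0[OF f] ok_props[OF f] in auto)

section \<open>Relations on number assignments\<close>

text \<open>Storing both \<open>q ^ n\<close> and \<open>1 - q ^ n\<close> makes the codes pairwise incomparable.\<close>

definition enc :: "(nat \<Rightarrow> nat) \<Rightarrow> nat \<Rightarrow> real" where
  "enc e = (\<lambda>s\<in>S. if even s then (1 / real sz) ^ e (s div 2) else 1 - (1 / real sz) ^ e (s div 2))"

definition truth :: "bool \<Rightarrow> nat \<Rightarrow> real" where
  "truth b = (\<lambda>s\<in>S. if b then 1 else 0)"

text \<open>Values at predicates that code nothing are left open, so many transformers represent the
  same relation.\<close>

definition reps :: "nat val \<Rightarrow> ((nat \<Rightarrow> nat) \<Rightarrow> bool) \<Rightarrow> bool" where
  "reps F R \<longleftrightarrow> (\<forall>e. funv F (enc e) = Base (truth (R e)))"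

lemma enc_preds [simp]: "enc e \<in> preds S"
  unfolding enc_def using sz_pos
  by (intro restrict_in_preds) (auto simp: field_simps power_le_one intro!: one_le_power)

lemma truth_preds [simp]: "truth b \<in> preds S"
  unfolding truth_def by (intro restrict_in_preds) auto

lemma le_pred_truth [simp]: "le_pred S (truth a) (truth b) \<longleftrightarrow> (a \<longrightarrow> b)"
  using sz_pos by (auto simp: le_pred_def truth_def)

lemma le_pred_refl: "le_pred S' x x"
  unfolding le_pred_def by blast

lemma truth_inject [simp]: "truth a = truth b \<longleftrightarrow> a = b"
  using sz_pos by (auto simp: truth_def dest: fun_cong[of _ _ 0] split: if_splits)

lemma le_pred_truth_True: "x \<in> preds S \<Longrightarrow> le_pred S x (truth True)"
  by (auto simp: le_pred_def truth_def dest: preds_bounds)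

lemma le_pred_truth_False: "x \<in> preds S \<Longrightarrow> le_pred S (truth False) x"
  by (auto simp: le_pred_def truth_def dest: preds_bounds)

lemma le_pred_trans: "le_pred S' x y \<Longrightarrow> le_pred S' y z \<Longrightarrow> le_pred S' x z"
  unfolding le_pred_def by (blast intro: order_trans)

text \<open>The even states give one inequality between powers and the odd states its reverse. Only
  the codes coincide: entries from \<open>N\<close> on are not stored.\<close>

lemma enc_antichain:
  assumes "le_pred S (enc e) (enc e')"
  shows "enc e = enc e'"
proof (rule preds_ext)
  fix s assume s: "s \<in> S"
  define i where "i = s div 2"
  have "s < 2 * N" using s by (simp add: sz_def)
  then have "2 * i < sz" "2 * i + 1 < sz" unfolding i_def sz_def by presburger+
  then have "enc e (2 * i) \<le> enc e' (2 * i)" "enc e (2 * i + 1) \<le> enc e' (2 * i + 1)"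
    using assms unfolding le_pred_def by blast+
  then have "(1 / real sz) ^ e i = (1 / real sz) ^ e' i"
    using \<open>2 * i < sz\<close> \<open>2 * i + 1 < sz\<close> by (simp add: enc_def)
  then show "enc e s = enc e' s" using s by (simp add: enc_def i_def)
qed simp_all

text \<open>The least and the greatest monotone transformer representing a given relation.\<close>

definition up :: "((nat \<Rightarrow> nat) \<Rightarrow> bool) \<Rightarrow> nat val" where
  "up R = Fun (\<lambda>x\<in>preds S. Base (truth (\<exists>e. R e \<and> le_pred S (enc e) x)))"

definition down :: "((nat \<Rightarrow> nat) \<Rightarrow> bool) \<Rightarrow> nat val" where
  "down R = Fun (\<lambda>x\<in>preds S. Base (truth (\<forall>e. le_pred S x (enc e) \<longrightarrow> R e)))"

lemma up_dom: "up R \<in> dom_ty S fn_ty"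
  unfolding up_def by (rule fn_domI) (auto intro: le_pred_trans)

lemma down_dom: "down R \<in> dom_ty S fn_ty"
  unfolding down_def by (rule fn_domI) (auto intro: le_pred_trans)

text \<open>Since entries from \<open>N\<close> on are invisible in a code, exactly the relations
  that depend on the code alone can be represented.\<close>

definition resp :: "((nat \<Rightarrow> nat) \<Rightarrow> bool) \<Rightarrow> bool" where
  "resp R \<longleftrightarrow> (\<forall>e e'. enc e = enc e' \<longrightarrow> R e = R e')"

text \<open>The only code below \<open>enc e\<close> is \<open>enc e\<close> itself, so closing
  upwards makes no further code true.\<close>

lemma reps_up:
  assumes "resp R"
  shows "reps (up R) R"
proof -
  have "(\<exists>e'. R e' \<and> le_pred S (enc e') (enc e)) = R e" for e
    using assms le_pred_refl enc_antichain unfolding resp_def by metis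
  then show ?thesis by (simp add: reps_def up_def)
qed

lemma reps_down:
  assumes "resp R"
  shows "reps (down R) R"
proof -
  have "(\<forall>e'. le_pred S (enc e) (enc e') \<longrightarrow> R e') = R e" for e
    using assms le_pred_refl enc_antichain unfolding resp_def by metis
  then show ?thesis by (simp add: reps_def down_def)
qed

text \<open>Truth at a code propagates to every predicate above it, and away from these
  \<open>up R\<close> takes the least value.\<close>

lemma up_le:
  assumes "v \<in> dom_ty S fn_ty" "\<And>e. R e \<Longrightarrow> funv v (enc e) = Base (truth True)"
  shows "le_val S fn_ty (up R) v"
  unfolding le_val.simps
proof
  fix x assume x: "x \<in> preds S"
  obtain y where y: "funv v x = Base y" "y \<in> preds S" using fn_dom_app[OF assms(1) x] by blast
  show "le_pred S (base (funv (up R) x)) (base (funv v x))"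
  proof (cases "\<exists>e. R e \<and> le_pred S (enc e) x")
    case True
    then obtain e where "R e" "le_pred S (enc e) x" by blast
    then have "le_pred S (truth True) (base (funv v x))"
      using fn_dom_mono[OF assms(1) enc_preds x, of e] assms(2)[of e] by simp
    then show ?thesis using True x by (simp add: up_def)
  next
    case False
    then have c: "(\<exists>e. R e \<and> le_pred S (enc e) x) = False" by blast
    show ?thesis using x y le_pred_truth_False by (simp add: up_def c)
  qed
qed

text \<open>Dually, falsity at a code propagates to every predicate below it.\<close>

lemma le_down:
  assumes "v \<in> dom_ty S fn_ty" "\<And>e. \<not> R e \<Longrightarrow> funv v (enc e) = Base (truth False)"
  shows "le_val S fn_ty v (down R)"
  unfolding le_val.simps
proof
  fix x assume x: "x \<in> preds S"
  obtain y where y: "funv v x = Base y" "y \<in> preds S" using fn_dom_app[OF assms(1) x] by blast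
  show "le_pred S (base (funv v x)) (base (funv (down R) x))"
  proof (cases "\<forall>e. le_pred S x (enc e) \<longrightarrow> R e")
    case False
    then obtain e where "\<not> R e" "le_pred S x (enc e)" by blast
    then have "le_pred S (base (funv v x)) (truth False)"
      using fn_dom_mono[OF assms(1) x enc_preds, of e] assms(2)[of e] by simp
    moreover from False have c: "(\<forall>e. le_pred S x (enc e) \<longrightarrow> R e) = False" by blast
    ultimately show ?thesis using x by (simp add: down_def c)
  next
    case True
    then show ?thesis using x y le_pred_truth_True by (simp add: down_def)
  qed
qed

section \<open>Fixpoint formulas compute fixpoints of operators on relations\<close>

lemma resp_body:
  assumes body: "\<And>F e. F \<in> dom_ty S fn_ty \<Longrightarrow> reps F R
          \<Longrightarrow> sem M \<psi> (\<rho>(j := F, 0 := Base (enc e))) = Base (truth (\<Phi> R e))"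
    and "resp R"
  shows "resp (\<Phi> R)"
  using body[OF up_dom reps_up[OF \<open>resp R\<close>]] unfolding resp_def by (metis truth_inject val.inject(1))

text \<open>The fixpoint \<open>v\<close> is not known in advance to be 0 or 1 at codes, so it is
  bounded from both sides. \<open>down (lfp \<Phi>)\<close> is a pre-fixpoint, which makes
  \<open>v\<close> false outside \<open>lfp \<Phi>\<close>. Conversely, if \<open>R\<close> holds
  where \<open>v\<close> is fully true, then \<open>up R\<close> lies below \<open>v\<close>;
  applying the body once shows that \<open>R\<close> is closed under \<open>\<Phi>\<close> and so
  contains \<open>lfp \<Phi>\<close>.\<close>

lemma reps_mu:
  assumes ok: "ok Prp (insert j J) \<psi>" and w: "wf_env J \<rho>"
    and body: "\<And>F R e. F \<in> dom_ty S fn_ty \<Longrightarrow> reps F R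
          \<Longrightarrow> sem M \<psi> (\<rho>(j := F, 0 := Base (enc e))) = Base (truth (\<Phi> R e))"
    and mono: "mono \<Phi>"
  shows "reps (sem M (Mu j fn_ty (Lam 0 Prp \<psi>)) \<rho>) (lfp \<Phi>)"
proof -
  note f = ok_Lam[OF ok]
  define G where "G v = sem M (Lam 0 Prp \<psi>) (\<rho>(j := v))" for v
  note fp = least_fixpoint_fn[of S G, unfolded G_def, OF body_dom[OF f w] body_mono[OF f w], folded G_def]
  define v where "v = least_fixpoint S fn_ty G"
  have v: "v \<in> dom_ty S fn_ty" "G v = v"
    and v_least: "\<And>w. w \<in> dom_ty S fn_ty \<Longrightarrow> le_val S fn_ty (G w) w \<Longrightarrow> le_val S fn_ty v w"
    unfolding v_def using fp by blast+
  have G_dom: "F \<in> dom_ty S fn_ty \<Longrightarrow> G F \<in> dom_ty S fn_ty" for F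
    unfolding G_def by (rule body_dom[OF f w])
  have G_mono: "F \<in> dom_ty S fn_ty \<Longrightarrow> F' \<in> dom_ty S fn_ty \<Longrightarrow> le_val S fn_ty F F'
      \<Longrightarrow> le_val S fn_ty (G F) (G F')" for F F'
    unfolding G_def by (rule body_mono[OF f w])
  have G_reps: "funv (G F) (enc e) = Base (truth (\<Phi> R e))" if "F \<in> dom_ty S fn_ty" "reps F R" for F R e
    using body[OF that] by (simp add: G_def)
  \<comment> \<open>The fixpoint equation alone would be circular, as representing
    \<open>lfp \<Phi>\<close> already requires \<open>resp\<close>. The property is carried through
    the transfinite approximations from below: the body preserves it, and so do unions.\<close>
  have resp: "resp (lfp \<Phi>)"
  proof (induction rule: lfp_ordinal_induct[OF mono])
    case (1 R)
    show ?case by (rule resp_body[of R \<psi> \<rho> j \<Phi>]) (rule body, assumption+, rule 1)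
  next
    case (2 A)
    show ?case unfolding resp_def
    proof (intro allI impI)
      fix e e' assume "enc e = enc e'"
      then have "\<forall>R\<in>A. R e = R e'" using 2 unfolding resp_def by blast
      then show "Sup A e = Sup A e'" by auto
    qed
  qed
  have fix_eq: "\<Phi> (lfp \<Phi>) = lfp \<Phi>" using lfp_unfold[OF mono] by simp
  have "le_val S fn_ty (G (down (lfp \<Phi>))) (down (lfp \<Phi>))"
    by (rule le_down) (simp_all add: G_dom down_dom G_reps[OF down_dom reps_down[OF resp]] fix_eq del: dom_ty.simps)
  then have *: "le_val S fn_ty v (down (lfp \<Phi>))" by (intro v_least down_dom)
  \<comment> \<open>Fractional values count as false.\<close>
  define R where "R e \<longleftrightarrow> funv v (enc e) = Base (truth True)" for e
  have respR: "resp R" by (simp add: resp_def R_def)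
  have "le_val S fn_ty (G (up R)) v"
    using G_mono[OF up_dom v(1) up_le, of R] v by (simp add: R_def del: dom_ty.simps le_val.simps)
  then have "le_pred S (base (funv (G (up R)) (enc e))) (base (funv v (enc e)))" for e by simp
  then have le: "le_pred S (truth (\<Phi> R e)) (base (funv v (enc e)))" for e
    by (metis G_reps[OF up_dom reps_up[OF respR]] val.sel(1))
  have top: "R e" if "le_pred S (truth True) (base (funv v (enc e)))" for e
  proof -
    obtain y where "funv v (enc e) = Base y" "y \<in> preds S"
      using fn_dom_app[OF v(1) enc_preds] by blast
    then show ?thesis using that le_pred_antisym[OF _ truth_preds, of y True] le_pred_truth_True
      by (simp add: R_def)
  qed
  have "lfp \<Phi> \<le> R"
  proof (rule lfp_lowerbound, rule le_funI, rule le_boolI, rule top)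
    show "le_pred S (truth True) (base (funv v (enc e)))" if "\<Phi> R e" for e
      using le[of e] that by simp
  qed
  have "funv v (enc e) = Base (truth (lfp \<Phi> e))" for e
  proof (cases "lfp \<Phi> e")
    case True
    then show ?thesis using \<open>lfp \<Phi> \<le> R\<close> by (auto simp: le_fun_def R_def)
  next
    case False
    obtain y where y: "funv v (enc e) = Base y" "y \<in> preds S"
      using fn_dom_app[OF v(1) enc_preds] by blast
    have "le_pred S (base (funv v (enc e))) (base (funv (down (lfp \<Phi>)) (enc e)))"
      using * enc_preds by auto
    then have "le_pred S y (truth False)"
      using reps_down[OF resp] False y by (simp add: reps_def)
    then show ?thesis using le_pred_antisym[OF y(2) truth_preds] le_pred_truth_False y False by simp
  qed
  moreover have "sem M (Mu j fn_ty (Lam 0 Prp \<psi>)) \<rho> = v"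
    unfolding v_def sem.simps(9) states_M G_def[abs_def] ..
  ultimately show ?thesis by (simp add: reps_def)
qed

text \<open>The mirror image: \<open>up (gfp \<Phi>)\<close> is a post-fixpoint and bounds the
  fixpoint from below, while \<open>down\<close> of the codes not mapped to false bounds it from
  above.\<close>

lemma reps_nu:
  assumes ok: "ok Prp (insert j J) \<psi>" and w: "wf_env J \<rho>"
    and body: "\<And>F R e. F \<in> dom_ty S fn_ty \<Longrightarrow> reps F R
          \<Longrightarrow> sem M \<psi> (\<rho>(j := F, 0 := Base (enc e))) = Base (truth (\<Phi> R e))"
    and mono: "mono \<Phi>"
  shows "reps (sem M (Nu j fn_ty (Lam 0 Prp \<psi>)) \<rho>) (gfp \<Phi>)"
proof -
  note f = ok_Lam[OF ok]
  define G where "G v = sem M (Lam 0 Prp \<psi>) (\<rho>(j := v))" for v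
  note fp = greatest_fixpoint_fn[of S G, unfolded G_def, OF body_dom[OF f w] body_mono[OF f w], folded G_def]
  define v where "v = greatest_fixpoint S fn_ty G"
  have v: "v \<in> dom_ty S fn_ty" "G v = v"
    and v_greatest: "\<And>w. w \<in> dom_ty S fn_ty \<Longrightarrow> le_val S fn_ty w (G w) \<Longrightarrow> le_val S fn_ty w v"
    unfolding v_def using fp by blast+
  have G_dom: "F \<in> dom_ty S fn_ty \<Longrightarrow> G F \<in> dom_ty S fn_ty" for F
    unfolding G_def by (rule body_dom[OF f w])
  have G_mono: "F \<in> dom_ty S fn_ty \<Longrightarrow> F' \<in> dom_ty S fn_ty \<Longrightarrow> le_val S fn_ty F F'
      \<Longrightarrow> le_val S fn_ty (G F) (G F')" for F F'
    unfolding G_def by (rule body_mono[OF f w])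
  have G_reps: "funv (G F) (enc e) = Base (truth (\<Phi> R e))" if "F \<in> dom_ty S fn_ty" "reps F R" for F R e
    using body[OF that] by (simp add: G_def)
  have resp: "resp (gfp \<Phi>)"
  proof (induction rule: gfp_ordinal_induct[OF mono])
    case (1 R)
    show ?case by (rule resp_body[of R \<psi> \<rho> j \<Phi>]) (rule body, assumption+, rule 1)
  next
    case (2 A)
    show ?case unfolding resp_def
    proof (intro allI impI)
      fix e e' assume "enc e = enc e'"
      then have "\<forall>R\<in>A. R e = R e'" using 2 unfolding resp_def by blast
      then show "Inf A e = Inf A e'" by auto
    qed
  qed
  have fix_eq: "\<Phi> (gfp \<Phi>) = gfp \<Phi>" using gfp_unfold[OF mono] by simp
  have "le_val S fn_ty (up (gfp \<Phi>)) (G (up (gfp \<Phi>)))"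
    by (rule up_le) (simp_all add: G_dom up_dom G_reps[OF up_dom reps_up[OF resp]] fix_eq del: dom_ty.simps)
  then have *: "le_val S fn_ty (up (gfp \<Phi>)) v" by (intro v_greatest up_dom)
  \<comment> \<open>Fractional values count as true here, opposite to the least fixpoint, so that
    \<open>R\<close> is a post-fixpoint of \<open>\<Phi>\<close>.\<close>
  define R where "R e \<longleftrightarrow> funv v (enc e) \<noteq> Base (truth False)" for e
  have respR: "resp R" by (simp add: resp_def R_def)
  have "le_val S fn_ty v (G (down R))"
    using G_mono[OF v(1) down_dom le_down, of R] v by (simp add: R_def del: dom_ty.simps le_val.simps)
  then have "le_pred S (base (funv v (enc e))) (base (funv (G (down R)) (enc e)))" for e by simp
  then have le: "le_pred S (base (funv v (enc e))) (truth (\<Phi> R e))" for e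
    by (metis G_reps[OF down_dom reps_down[OF respR]] val.sel(1))
  have bot: "\<not> R e" if "le_pred S (base (funv v (enc e))) (truth False)" for e
  proof -
    obtain y where "funv v (enc e) = Base y" "y \<in> preds S"
      using fn_dom_app[OF v(1) enc_preds] by blast
    then show ?thesis using that le_pred_antisym[OF _ truth_preds, of y False] le_pred_truth_False
      by (simp add: R_def)
  qed
  have "R \<le> gfp \<Phi>"
  proof (rule gfp_upperbound, rule le_funI, rule le_boolI, rule ccontr)
    show False if "R e" "\<not> \<Phi> R e" for e
      using le[of e] that bot[of e] by simp
  qed
  have "funv v (enc e) = Base (truth (gfp \<Phi> e))" for e
  proof (cases "gfp \<Phi> e")
    case False
    then show ?thesis using \<open>R \<le> gfp \<Phi>\<close> by (auto simp: le_fun_def R_def)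
  next
    case True
    obtain y where y: "funv v (enc e) = Base y" "y \<in> preds S"
      using fn_dom_app[OF v(1) enc_preds] by blast
    have "le_pred S (base (funv (up (gfp \<Phi>)) (enc e))) (base (funv v (enc e)))"
      using * enc_preds by auto
    then have "le_pred S (truth True) y"
      using reps_up[OF resp] True y by (simp add: reps_def)
    then show ?thesis using le_pred_antisym[OF y(2) truth_preds] le_pred_truth_True y True by simp
  qed
  moreover have "sem M (Nu j fn_ty (Lam 0 Prp \<psi>)) \<rho> = v"
    unfolding v_def sem.simps(10) states_M G_def[abs_def] ..
  ultimately show ?thesis by (simp add: reps_def)
qed

end

section \<open>Definable relations\<close>

text \<open>Recursion along the orbit of \<open>g\<close> is unbounded search. With \<open>g\<close>
  an increment it becomes a number quantifier, with simultaneous counters an arithmetic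
  operation.\<close>

lemma lfp_iterate: "lfp (\<lambda>Q e. P e \<or> Q (g e)) e \<longleftrightarrow> (\<exists>n. P ((g ^^ n) e))"
  (is "lfp ?\<Phi> e \<longleftrightarrow> _")
proof
  have mono: "mono ?\<Phi>" by (rule monoI) (auto simp: le_fun_def)
  have "lfp ?\<Phi> \<le> (\<lambda>e. \<exists>n. P ((g ^^ n) e))"
    by (rule lfp_lowerbound) (auto simp: le_fun_def funpow_swap1 intro: exI[of _ 0] exI[of _ "Suc n" for n])
  then show "lfp ?\<Phi> e \<Longrightarrow> \<exists>n. P ((g ^^ n) e)" by (auto simp: le_fun_def)
  show "lfp ?\<Phi> e" if "\<exists>n. P ((g ^^ n) e)"
  proof -
    have "P ((g ^^ n) e) \<Longrightarrow> lfp ?\<Phi> e" for n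
    proof (induction n arbitrary: e)
      case 0
      then show ?case by (subst lfp_unfold[OF mono]) simp
    next
      case (Suc n)
      then have "lfp ?\<Phi> (g e)" by (simp add: funpow_swap1)
      then show ?case by (subst lfp_unfold[OF mono]) simp
    qed
    then show ?thesis using that by blast
  qed
qed

lemma gfp_iterate: "gfp (\<lambda>Q e. P e \<and> Q (g e)) e \<longleftrightarrow> (\<forall>n. P ((g ^^ n) e))"
  (is "gfp ?\<Phi> e \<longleftrightarrow> _")
proof
  have mono: "mono ?\<Phi>" by (rule monoI) (auto simp: le_fun_def)
  have "(\<lambda>e. \<forall>n. P ((g ^^ n) e)) \<le> gfp ?\<Phi>"
  proof (rule gfp_upperbound, rule le_funI, rule le_boolI)
    fix e assume *: "\<forall>n. P ((g ^^ n) e)"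
    then have "\<forall>n. P ((g ^^ n) (g e))" by (metis funpow_simps_right(2) o_apply)
    then show "P e \<and> (\<forall>n. P ((g ^^ n) (g e)))" using spec[OF *, of 0] by simp
  qed
  then show "\<forall>n. P ((g ^^ n) e) \<Longrightarrow> gfp ?\<Phi> e" by (auto simp: le_fun_def)
  have "gfp ?\<Phi> e \<Longrightarrow> P ((g ^^ n) e)" for n
  proof (induction n arbitrary: e)
    case 0
    then show ?case by (subst (asm) gfp_unfold[OF mono]) simp
  next
    case (Suc n)
    then have "gfp ?\<Phi> (g e)" by (subst (asm) gfp_unfold[OF mono]) simp
    then show ?case using Suc.IH by (simp add: funpow_swap1)
  qed
  then show "gfp ?\<Phi> e \<Longrightarrow> \<forall>n. P ((g ^^ n) e)" by blast
qed

lemma fun_upd_iterate: "((\<lambda>e. e(i := Suc (e i))) ^^ n) (e(i := m)) = e(i := m + n)"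
  for e :: "'a \<Rightarrow> nat"
  by (induction n) auto

section \<open>Operators on relations and maps on assignments realized by formulas\<close>

context uniform_chain begin

text \<open>The variables in \<open>J\<close> stand for the relation argument. In use
  \<open>J\<close> is empty, and the operator is constant, or it is \<open>{1}\<close>, the
  recursion variable of an enclosing fixpoint.\<close>

definition realizes ::
  "nat set \<Rightarrow> nat phfl \<Rightarrow> (((nat \<Rightarrow> nat) \<Rightarrow> bool) \<Rightarrow> (nat \<Rightarrow> nat) \<Rightarrow> bool) \<Rightarrow> bool" where
  "realizes J \<psi> \<Phi> \<longleftrightarrow> ok Prp J \<psi> \<and> (\<forall>\<rho> R e. wf_env J \<rho> \<longrightarrow> (\<forall>j\<in>J. reps (\<rho> j) R) \<longrightarrow>
     \<rho> 0 = Base (enc e) \<longrightarrow> sem M \<psi> \<rho> = Base (truth (\<Phi> R e)))"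

definition realizes_tr :: "nat phfl \<Rightarrow> ((nat \<Rightarrow> nat) \<Rightarrow> nat \<Rightarrow> nat) \<Rightarrow> bool" where
  "realizes_tr u g \<longleftrightarrow> ok Prp {} u \<and> (\<forall>\<rho> e. \<rho> 0 = Base (enc e) \<longrightarrow> sem M u \<rho> = Base (enc (g e)))"

definition definable :: "nat set \<Rightarrow> (((nat \<Rightarrow> nat) \<Rightarrow> bool) \<Rightarrow> (nat \<Rightarrow> nat) \<Rightarrow> bool) \<Rightarrow> bool" where
  "definable J \<Phi> \<longleftrightarrow> (\<exists>\<psi>. realizes J \<psi> \<Phi>)"

definition definable_map :: "((nat \<Rightarrow> nat) \<Rightarrow> nat \<Rightarrow> nat) \<Rightarrow> bool" where
  "definable_map g \<longleftrightarrow> (\<exists>u. realizes_tr u g)"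

lemma realizesI:
  assumes "ok Prp J \<psi>" "\<And>\<rho> R e. wf_env J \<rho> \<Longrightarrow> \<forall>j\<in>J. reps (\<rho> j) R \<Longrightarrow> \<rho> 0 = Base (enc e)
     \<Longrightarrow> sem M \<psi> \<rho> = Base (truth (\<Phi> R e))"
  shows "realizes J \<psi> \<Phi>"
  using assms unfolding realizes_def by blast

lemma
  assumes "realizes J \<psi> \<Phi>"
  shows realizes_ok: "ok Prp J \<psi>" and realizes_0: "0 \<notin> J"
    and realizes_sem: "wf_env J \<rho> \<Longrightarrow> \<forall>j\<in>J. reps (\<rho> j) R \<Longrightarrow> \<rho> 0 = Base (enc e)
       \<Longrightarrow> sem M \<psi> \<rho> = Base (truth (\<Phi> R e))"
  using assms ok_0 unfolding realizes_def by blast+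

lemma
  assumes "realizes_tr u g"
  shows realizes_tr_ok: "ok Prp {} u"
    and realizes_tr_sem: "\<rho> 0 = Base (enc e) \<Longrightarrow> sem M u \<rho> = Base (enc (g e))"
  using assms unfolding realizes_tr_def by blast+

lemma definableI: "realizes J \<psi> \<Phi> \<Longrightarrow> definable J \<Phi>"
  unfolding definable_def by blast

lemma definable_mapI:
  assumes "ok Prp {} u" "\<And>\<rho> e. \<rho> 0 = Base (enc e) \<Longrightarrow> sem M u \<rho> = Base (enc (g e))"
  shows "definable_map g"
  using assms unfolding definable_map_def realizes_tr_def by blast

lemma realizes_weaken:
  assumes "realizes {} \<psi> (\<lambda>_. P)" "0 \<notin> J"
  shows "realizes J \<psi> (\<lambda>_. P)"
proof (rule realizesI)
  show "ok Prp J \<psi>" using ok_weaken[OF realizes_ok[OF assms(1)]] assms(2) by simp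
  show "sem M \<psi> \<rho> = Base (truth (P e))" if "wf_env J \<rho>" "\<rho> 0 = Base (enc e)" for \<rho> e
    by (rule realizes_sem[OF assms(1)]) (use that wf_env_mono in auto)
qed

lemma definable_weaken: "definable {} (\<lambda>_. P) \<Longrightarrow> 0 \<notin> J \<Longrightarrow> definable J (\<lambda>_. P)"
  unfolding definable_def using realizes_weaken by blast

lemma definable_conj:
  assumes "definable J \<Phi>" "definable J \<Psi>"
  shows "definable J (\<lambda>R e. \<Phi> R e \<and> \<Psi> R e)"
proof -
  obtain \<phi> \<psi> where *: "realizes J \<phi> \<Phi>" "realizes J \<psi> \<Psi>"
    using assms unfolding definable_def by blast
  have "realizes J (And \<phi> \<psi>) (\<lambda>R e. \<Phi> R e \<and> \<Psi> R e)"
  proof (rule realizesI)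
    show "ok Prp J (And \<phi> \<psi>)" using * realizes_ok by (intro ok_And)
    fix \<rho> R e assume "wf_env J \<rho>" "\<forall>j\<in>J. reps (\<rho> j) R" "\<rho> 0 = Base (enc e)"
    note this = realizes_sem[OF *(1) this] realizes_sem[OF *(2) this]
    then show "sem M (And \<phi> \<psi>) \<rho> = Base (truth (\<Phi> R e \<and> \<Psi> R e))"
      by (auto simp: truth_def intro!: restrict_ext)
  qed
  then show ?thesis by (rule definableI)
qed

lemma definable_disj:
  assumes "definable J \<Phi>" "definable J \<Psi>"
  shows "definable J (\<lambda>R e. \<Phi> R e \<or> \<Psi> R e)"
proof -
  obtain \<phi> \<psi> where *: "realizes J \<phi> \<Phi>" "realizes J \<psi> \<Psi>"
    using assms unfolding definable_def by blast
  have "realizes J (Or \<phi> \<psi>) (\<lambda>R e. \<Phi> R e \<or> \<Psi> R e)"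
  proof (rule realizesI)
    show "ok Prp J (Or \<phi> \<psi>)" using * realizes_ok by (intro ok_Or)
    fix \<rho> R e assume "wf_env J \<rho>" "\<forall>j\<in>J. reps (\<rho> j) R" "\<rho> 0 = Base (enc e)"
    note this = realizes_sem[OF *(1) this] realizes_sem[OF *(2) this]
    then show "sem M (Or \<phi> \<psi>) \<rho> = Base (truth (\<Phi> R e \<or> \<Psi> R e))"
      by (auto simp: truth_def intro!: restrict_ext)
  qed
  then show ?thesis by (rule definableI)
qed

lemma wf_env_upd0: "wf_env J \<rho> \<Longrightarrow> 0 \<notin> J \<Longrightarrow> x \<in> preds S \<Longrightarrow> wf_env J (\<rho>(0 := Base x))"
  by (auto simp: wf_env_def simp del: dom_ty.simps(2))

lemma ok_subst: "ok Prp J \<psi> \<Longrightarrow> ok Prp {} u \<Longrightarrow> ok Prp J (App (Lam 0 Prp \<psi>) u)"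
  using ok_0 by (blast intro: ok_App ok_Lam ok_weaken)

lemma sem_subst: "sem M u \<rho> = Base x \<Longrightarrow> x \<in> preds S
    \<Longrightarrow> sem M (App (Lam 0 Prp \<psi>) u) \<rho> = sem M \<psi> (\<rho>(0 := Base x))"
  by simp

text \<open>A beta-redex replaces the current code, held by variable 0, by its image under
  \<open>g\<close>. Transformers are untouched, because 0 is not in \<open>J\<close>.\<close>

lemma definable_subst:
  assumes "definable J \<Phi>" "definable_map g"
  shows "definable J (\<lambda>R e. \<Phi> R (g e))"
proof -
  obtain \<psi> u where \<psi>: "realizes J \<psi> \<Phi>" and u: "realizes_tr u g"
    using assms unfolding definable_def definable_map_def by blast
  have "realizes J (App (Lam 0 Prp \<psi>) u) (\<lambda>R e. \<Phi> R (g e))"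
  proof (rule realizesI)
    show "ok Prp J (App (Lam 0 Prp \<psi>) u)"
      using ok_subst realizes_ok[OF \<psi>] realizes_tr_ok[OF u] by blast
    fix \<rho> R e assume *: "wf_env J \<rho>" "\<forall>j\<in>J. reps (\<rho> j) R" "\<rho> 0 = Base (enc e)"
    have **: "\<forall>j\<in>J. reps ((\<rho>(0 := Base (enc (g e)))) j) R"
      using * realizes_0[OF \<psi>] by (metis fun_upd_other)
    show "sem M (App (Lam 0 Prp \<psi>) u) \<rho> = Base (truth (\<Phi> R (g e)))"
      unfolding sem_subst[where \<rho> = \<rho>, OF realizes_tr_sem[where \<rho> = \<rho> and e = e, OF u *(3)] enc_preds]
      by (rule realizes_sem[OF \<psi> wf_env_upd0[OF *(1) realizes_0[OF \<psi>] enc_preds] **]) simp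
  qed
  then show ?thesis by (rule definableI)
qed

lemma definable_map_comp:
  assumes "definable_map g" "definable_map h"
  shows "definable_map (\<lambda>e. g (h e))"
proof -
  obtain u v where u: "realizes_tr u g" and v: "realizes_tr v h"
    using assms unfolding definable_map_def by blast
  show ?thesis
  proof (rule definable_mapI)
    show "ok Prp {} (App (Lam 0 Prp u) v)"
      using ok_subst realizes_tr_ok[OF u] realizes_tr_ok[OF v] by blast
    fix \<rho> :: "nat \<Rightarrow> nat val" and e assume *: "\<rho> 0 = Base (enc e)"
    show "sem M (App (Lam 0 Prp u) v) \<rho> = Base (enc (g (h e)))"
      unfolding sem_subst[where \<rho> = \<rho>, OF realizes_tr_sem[where \<rho> = \<rho> and e = e, OF v *] enc_preds]
      by (rule realizes_tr_sem[OF u]) simp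
  qed
qed

lemma definable_rel: "definable {1} (\<lambda>R. R)"
  by (rule definableI[of _ "App (Var 1) (Var 0)"], rule realizesI)
    (auto simp: reps_def intro: ok_App ok_Var ok_Var0)

lemma reps_body_env:
  assumes "wf_env J \<rho>" "0 \<notin> J" "F \<in> dom_ty S fn_ty" "j \<noteq> 0"
  shows "wf_env (insert j J) (\<rho>(j := F, 0 := Base (enc e)))"
  using assms by (intro wf_env_upd0 wf_env_upd) auto

lemma definable_lfp:
  assumes "definable {1} \<Phi>" "mono \<Phi>"
  shows "definable {} (\<lambda>_. lfp \<Phi>)"
proof -
  obtain \<psi> where \<psi>: "realizes {1} \<psi> \<Phi>"
    using assms(1) unfolding definable_def by blast
  have "realizes {} (App (Mu 1 fn_ty (Lam 0 Prp \<psi>)) (Var 0)) (\<lambda>_. lfp \<Phi>)"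
  proof (rule realizesI)
    show "ok Prp {} (App (Mu 1 fn_ty (Lam 0 Prp \<psi>)) (Var 0))"
      by (intro ok_App ok_Mu ok_Lam realizes_ok[OF \<psi>] ok_Var0) simp
    fix \<rho> :: "nat \<Rightarrow> nat val" and e assume *: "wf_env {} \<rho>" "\<rho> 0 = Base (enc e)"
    have "reps (sem M (Mu 1 fn_ty (Lam 0 Prp \<psi>)) \<rho>) (lfp \<Phi>)"
    proof (rule reps_mu[OF realizes_ok[OF \<psi>] *(1) _ assms(2)])
      show "sem M \<psi> (\<rho>(1 := F, 0 := Base (enc e))) = Base (truth (\<Phi> R e))"
        if "F \<in> dom_ty S fn_ty" "reps F R" for F R e
        by (rule realizes_sem[OF \<psi> reps_body_env]) (use *(1) that in auto)
    qed
    then show "sem M (App (Mu 1 fn_ty (Lam 0 Prp \<psi>)) (Var 0)) \<rho> = Base (truth (lfp \<Phi> e))"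
      by (simp add: reps_def * del: sem.simps(9))
  qed
  then show ?thesis by (rule definableI)
qed

lemma definable_gfp:
  assumes "definable {1} \<Phi>" "mono \<Phi>"
  shows "definable {} (\<lambda>_. gfp \<Phi>)"
proof -
  obtain \<psi> where \<psi>: "realizes {1} \<psi> \<Phi>"
    using assms(1) unfolding definable_def by blast
  have "realizes {} (App (Nu 1 fn_ty (Lam 0 Prp \<psi>)) (Var 0)) (\<lambda>_. gfp \<Phi>)"
  proof (rule realizesI)
    show "ok Prp {} (App (Nu 1 fn_ty (Lam 0 Prp \<psi>)) (Var 0))"
      by (intro ok_App ok_Nu ok_Lam realizes_ok[OF \<psi>] ok_Var0) simp
    fix \<rho> :: "nat \<Rightarrow> nat val" and e assume *: "wf_env {} \<rho>" "\<rho> 0 = Base (enc e)"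
    have "reps (sem M (Nu 1 fn_ty (Lam 0 Prp \<psi>)) \<rho>) (gfp \<Phi>)"
    proof (rule reps_nu[OF realizes_ok[OF \<psi>] *(1) _ assms(2)])
      show "sem M \<psi> (\<rho>(1 := F, 0 := Base (enc e))) = Base (truth (\<Phi> R e))"
        if "F \<in> dom_ty S fn_ty" "reps F R" for F R e
        by (rule realizes_sem[OF \<psi> reps_body_env]) (use *(1) that in auto)
    qed
    then show "sem M (App (Nu 1 fn_ty (Lam 0 Prp \<psi>)) (Var 0)) \<rho> = Base (truth (gfp \<Phi> e))"
      by (simp add: reps_def * del: sem.simps(10))
  qed
  then show ?thesis by (rule definableI)
qed

subsection \<open>Updating and comparing slots\<close>

lemma enc_upd:
  assumes "i < N"
  shows "enc (e(i := k)) = (\<lambda>s\<in>S. if s = 2 * i then (1 / real sz) ^ k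
     else if s = 2 * i + 1 then 1 - (1 / real sz) ^ k else enc e s)"
proof -
  have "s div 2 = i \<longleftrightarrow> s = 2 * i \<or> s = 2 * i + 1" for s by presburger
  then show ?thesis by (auto simp: enc_def)
qed

text \<open>Masking leaves 0 everywhere except at \<open>s\<close>, and the maximum over all
  successors then broadcasts the value at \<open>s\<close> to every state.\<close>

definition read_at :: "nat phfl \<Rightarrow> nat \<Rightarrow> nat phfl" where
  "read_at t s = Dia (And t (Atom s))"

text \<open>Minimum and maximum with complementary 0/1 masks act as a case distinction on the state:
  \<open>u\<close> at \<open>s\<close>, \<open>t\<close> elsewhere.\<close>

definition write_at :: "nat phfl \<Rightarrow> nat \<Rightarrow> nat phfl \<Rightarrow> nat phfl" where
  "write_at t s u = Or (And u (Atom s)) (And t (Atom (sz + s)))"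

lemma sem_read_at:
  assumes "sem M t \<rho> = Base x" "x \<in> preds S" "s < sz"
  shows "sem M (read_at t s) \<rho> = Base (\<lambda>_\<in>S. x s)"
proof -
  have "Max (base (sem M (And t (Atom s)) \<rho>) ` S) = x s"
  proof (rule Max_eqI)
    fix y assume "y \<in> base (sem M (And t (Atom s)) \<rho>) ` S"
    then show "y \<le> x s"
      using assms preds_bounds[OF assms(2)] by (auto simp: label_M)
  next
    have "x s = base (sem M (And t (Atom s)) \<rho>) s"
      using assms preds_bounds[OF assms(2), of s] by (simp add: label_M)
    then show "x s \<in> base (sem M (And t (Atom s)) \<rho>) ` S" using assms(3) by blast
  qed simp
  then show ?thesis unfolding read_at_def sem_Dia by simp
qed

lemma sem_write_at:
  assumes "sem M t \<rho> = Base x" "x \<in> preds S" "sem M u \<rho> = Base y" "y \<in> preds S" "s < sz"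
  shows "sem M (write_at t s u) \<rho> = Base (\<lambda>r\<in>S. if r = s then y s else x r)"
  using assms preds_bounds[OF assms(2)] preds_bounds[OF assms(4)]
  by (auto simp: write_at_def label_M label_M_compl intro!: restrict_ext)

text \<open>Averaging a predicate supported on one state multiplies by \<open>1 / sz\<close>, which
  raises the exponent by one.\<close>

lemma sem_Nxt_And:
  assumes "sem M t \<rho> = Base x" "x \<in> preds S" "s < sz"
  shows "sem M (Nxt (And t (Atom s))) \<rho> = Base (\<lambda>_\<in>S. x s / real sz)"
proof -
  have "(\<Sum>s'<sz. base (sem M (And t (Atom s)) \<rho>) s') = (\<Sum>s'<sz. if s' = s then x s else 0)"
    using assms preds_bounds[OF assms(2)] by (intro sum.cong) (auto simp: label_M)
  then show ?thesis unfolding sem_Nxt using assms(3) by (simp add: sum.delta)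
qed

text \<open>With 1 at all other states it is the distance to 1 that shrinks by this factor, so
  \<open>1 - q ^ n\<close> becomes \<open>1 - q ^ (n + 1)\<close> without any subtraction in the
  formula.\<close>

lemma sem_Nxt_Or:
  assumes "sem M t \<rho> = Base x" "x \<in> preds S" "s < sz"
  shows "sem M (Nxt (Or t (Atom (sz + s)))) \<rho> = Base (\<lambda>_\<in>S. 1 - (1 - x s) / real sz)"
proof -
  have "(\<Sum>s'<sz. base (sem M (Or t (Atom (sz + s))) \<rho>) s') = (\<Sum>s'<sz. 1 - (if s' = s then 1 - x s else 0))"
    using assms preds_bounds[OF assms(2)] by (intro sum.cong) (auto simp: label_M_compl)
  also have "\<dots> = real sz - (1 - x s)"
    using assms(3) by (simp add: sum_subtractf sum.delta)
  finally have "(\<Sum>s'<sz. base (sem M (Or t (Atom (sz + s))) \<rho>) s') / real sz = 1 - (1 - x s) / real sz"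
    using sz_pos by (simp add: diff_divide_distrib)
  then show ?thesis unfolding sem_Nxt by simp
qed

lemma slot_lt: "i < N \<Longrightarrow> 2 * i < sz" "i < N \<Longrightarrow> Suc (2 * i) < sz"
  by (auto simp: sz_def)

lemma ok_read_at: "ok Prp J t \<Longrightarrow> s < sz \<Longrightarrow> ok Prp J (read_at t s)"
  unfolding read_at_def using ok_0 by (intro ok_Dia ok_And ok_Atom) auto

lemma ok_write_at: "ok Prp J t \<Longrightarrow> ok Prp J u \<Longrightarrow> s < sz \<Longrightarrow> ok Prp J (write_at t s u)"
  unfolding write_at_def using ok_0 by (intro ok_Or ok_And ok_Atom) auto

lemma definable_map_write:
  assumes i: "i < N" and u: "ok Prp {} u" "\<And>\<rho> e. \<rho> (0::nat) = Base (enc e) \<Longrightarrow> sem M u \<rho> = Base (\<lambda>_\<in>S. (1 / real sz) ^ k e)"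
    and v: "ok Prp {} v" "\<And>\<rho> e. \<rho> (0::nat) = Base (enc e) \<Longrightarrow> sem M v \<rho> = Base (\<lambda>_\<in>S. 1 - (1 / real sz) ^ k e)"
  shows "definable_map (\<lambda>e. e(i := k e))"
proof -
  \<comment> \<open>Neither \<open>u\<close> nor \<open>v\<close> is evaluated after a write: both
    read the original predicate, so \<open>k e\<close> refers to the old assignment in both
    cells.\<close>
  let ?t = "write_at (write_at (Var 0) (2 * i) u) (Suc (2 * i)) v"
  have "ok Prp {} ?t"
    using i by (intro ok_write_at ok_Var0 u(1) v(1) slot_lt) auto
  moreover have "sem M ?t \<rho> = Base (enc (e(i := k e)))" if \<rho>: "\<rho> 0 = Base (enc e)" for \<rho> e
  proof -
    have q: "0 \<le> (1 / real sz) ^ n" "(1 / real sz) ^ n \<le> 1" for n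
      using sz_pos by (auto intro!: power_le_one)
    note w = sem_write_at[OF _ enc_preds u(2)[of \<rho> e, OF \<rho>] restrict_in_preds slot_lt(1)[OF i], of "Var 0" e]
    have x: "sem M (write_at (Var 0) (2 * i) u) \<rho> = Base (\<lambda>r\<in>S. if r = 2 * i then (1 / real sz) ^ k e else enc e r)"
      by (subst w) (use \<rho> q slot_lt(1)[OF i] in \<open>auto intro!: restrict_ext\<close>)
    have xp: "(\<lambda>r\<in>S. if r = 2 * i then (1 / real sz) ^ k e else enc e r) \<in> preds S"
      using q preds_bounds[OF enc_preds] by (intro restrict_in_preds) auto
    have vp: "(\<lambda>_\<in>S. 1 - (1 / real sz) ^ k e) \<in> preds S"
      using q by (intro restrict_in_preds) auto
    show ?thesis
      unfolding sem_write_at[OF x xp v(2)[of \<rho> e, OF \<rho>] vp slot_lt(2)[OF i]] enc_upd[OF i]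
      using slot_lt[OF i] by (auto intro!: restrict_ext)
  qed
  ultimately show ?thesis by (rule definable_mapI)
qed

lemma definable_map_zero:
  assumes "i < N" shows "definable_map (\<lambda>e. e(i := 0))"
\<comment> \<open>Complementary propositions have the constant disjunction 1, that is
  \<open>q ^ 0\<close>, and the constant conjunction 0, that is \<open>1 - q ^ 0\<close>.\<close>
proof (rule definable_map_write[OF assms, where u = "Or (Atom 0) (Atom (sz + 0))" and v = "And (Atom 0) (Atom (sz + 0))"])
  show "ok Prp {} (Or (Atom 0) (Atom (sz + 0)))" "ok Prp {} (And (Atom 0) (Atom (sz + 0)))"
    using sz_pos by (intro ok_Or ok_And ok_Atom; simp)+
qed (use sz_pos in \<open>auto simp: label_M label_M_compl[of 0, simplified] intro!: restrict_ext\<close>)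

lemma definable_map_copy:
  assumes "i < N" "j < N" shows "definable_map (\<lambda>e. e(i := e j))"
proof (rule definable_map_write[OF assms(1), where u = "read_at (Var 0) (2 * j)" and v = "read_at (Var 0) (Suc (2 * j))"])
  show "ok Prp {} (read_at (Var 0) (2 * j))" "ok Prp {} (read_at (Var 0) (Suc (2 * j)))"
    using assms(2) by (intro ok_read_at ok_Var0 slot_lt; simp)+
  fix \<rho> :: "nat \<Rightarrow> nat val" and e assume "\<rho> 0 = Base (enc e)"
  then have *: "sem M (Var 0) \<rho> = Base (enc e)" by simp
  show "sem M (read_at (Var 0) (2 * j)) \<rho> = Base (\<lambda>_\<in>S. (1 / real sz) ^ e j)"
    "sem M (read_at (Var 0) (Suc (2 * j))) \<rho> = Base (\<lambda>_\<in>S. 1 - (1 / real sz) ^ e j)"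
    using slot_lt[OF assms(2)] by (simp_all add: sem_read_at[OF * enc_preds]) (simp_all add: enc_def)
qed

lemma definable_map_suc:
  assumes "i < N" shows "definable_map (\<lambda>e. e(i := Suc (e i)))"
proof (rule definable_map_write[OF assms(1), where u = "Nxt (And (Var 0) (Atom (2 * i)))"
      and v = "Nxt (Or (Var 0) (Atom (sz + Suc (2 * i))))"])
  show "ok Prp {} (Nxt (And (Var 0) (Atom (2 * i))))" "ok Prp {} (Nxt (Or (Var 0) (Atom (sz + Suc (2 * i)))))"
    using slot_lt[OF assms] by (intro ok_Nxt ok_And ok_Or ok_Atom ok_Var0; simp)+
  fix \<rho> :: "nat \<Rightarrow> nat val" and e assume "\<rho> 0 = Base (enc e)"
  then have *: "sem M (Var 0) \<rho> = Base (enc e)" by simp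
  show "sem M (Nxt (And (Var 0) (Atom (2 * i)))) \<rho> = Base (\<lambda>_\<in>S. (1 / real sz) ^ Suc (e i))"
    "sem M (Nxt (Or (Var 0) (Atom (sz + Suc (2 * i))))) \<rho> = Base (\<lambda>_\<in>S. 1 - (1 / real sz) ^ Suc (e i))"
    unfolding sem_Nxt_And[OF * enc_preds slot_lt(1)[OF assms]] sem_Nxt_Or[OF * enc_preds slot_lt(2)[OF assms]]
    using slot_lt[OF assms] by (simp_all add: enc_def)
qed

text \<open>The average of \<open>q ^ m\<close> and \<open>1 - q ^ n\<close> lies above that of 0 and 1 iff \<open>m < n\<close>.\<close>

definition cmp :: "nat \<Rightarrow> nat \<Rightarrow> nat phfl" where
  "cmp i j = Nxt (Or (And (read_at (Var 0) (2 * i)) (Atom 0)) (And (read_at (Var 0) (Suc (2 * j))) (Atom 1)))"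

lemma ok_cmp: "i < N \<Longrightarrow> j < N \<Longrightarrow> ok Prp {} (cmp i j)"
  unfolding cmp_def using sz_ge_2
  by (intro ok_Nxt ok_And ok_Or ok_Atom ok_read_at ok_Var0 slot_lt) auto

lemma sem_cmp:
  assumes "i < N" "j < N" and \<rho>: "\<rho> 0 = Base (enc e)"
  shows "sem M (cmp i j) \<rho> = Base (\<lambda>_\<in>S. ((1 / real sz) ^ e i + (1 - (1 / real sz) ^ e j)) / real sz)"
proof -
  have *: "sem M (Var 0) \<rho> = Base (enc e)" using \<rho> by simp
  define a where "a = enc e (2 * i)"
  define b where "b = enc e (Suc (2 * j))"
  have ab: "0 \<le> a" "a \<le> 1" "0 \<le> b" "b \<le> 1"
    using preds_bounds[OF enc_preds] slot_lt[OF assms(1)] slot_lt[OF assms(2)] by (simp_all add: a_def b_def)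
  have "(\<Sum>s<sz. base (sem M (Or (And (read_at (Var 0) (2 * i)) (Atom 0)) (And (read_at (Var 0) (Suc (2 * j))) (Atom 1))) \<rho>) s)
      = (\<Sum>s<sz. (if s = 0 then a else 0) + (if s = 1 then b else 0))"
    using ab sz_ge_2 slot_lt[OF assms(1)] slot_lt[OF assms(2)]
    by (intro sum.cong) (auto simp: sem_read_at[OF * enc_preds] label_M a_def b_def)
  also have "\<dots> = a + b"
    using sz_ge_2 by (simp add: sum.distrib sum.delta)
  finally show ?thesis unfolding cmp_def sem_Nxt
    using slot_lt[OF assms(1)] slot_lt[OF assms(2)] by (simp add: a_def b_def enc_def)
qed

lemma q_power_less: "(1 / real sz) ^ m < (1 / real sz) ^ n \<longleftrightarrow> n < m"
  using sz_ge_2 by (intro power_strict_decreasing_iff) auto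

lemma q_power_le: "(1 / real sz) ^ m \<le> (1 / real sz) ^ n \<longleftrightarrow> n \<le> m"
  using q_power_less[of n m] by linarith

text \<open>The strict threshold yields \<open><\<close>, the non-strict one \<open>\<le>\<close>.
  Together they express equality, inequality and the complement of every comparison, all by positive
  formulas.\<close>

lemma definable_less:
  assumes "i < N" "j < N" shows "definable {} (\<lambda>_ e. e i < e j)"
proof (rule definableI, rule realizesI[of _ "Thr (Gt (1 / of_nat sz)) (cmp i j)"])
  show "ok Prp {} (Thr (Gt (1 / of_nat sz)) (cmp i j))"
    using sz_ge_2 by (intro ok_Thr ok_cmp assms) (auto simp: field_simps)
  fix \<rho> :: "nat \<Rightarrow> nat val" and e assume \<rho>: "\<rho> 0 = Base (enc e)"
  have "((1 / real sz) ^ e i + (1 - (1 / real sz) ^ e j)) / real sz > 1 / real sz \<longleftrightarrow> e i < e j"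
    using sz_pos q_power_less[of "e j" "e i"] by (subst divide_less_cancel) auto
  then show "sem M (Thr (Gt (1 / of_nat sz)) (cmp i j)) \<rho> = Base (truth (e i < e j))"
    by (simp add: sem_cmp[where \<rho> = \<rho> and e = e, OF assms \<rho>] truth_def of_rat_divide cong: restrict_cong)
qed

lemma definable_le:
  assumes "i < N" "j < N" shows "definable {} (\<lambda>_ e. e i \<le> e j)"
proof (rule definableI, rule realizesI[of _ "Thr (Ge (1 / of_nat sz)) (cmp i j)"])
  show "ok Prp {} (Thr (Ge (1 / of_nat sz)) (cmp i j))"
    using sz_ge_2 by (intro ok_Thr ok_cmp assms) (auto simp: field_simps)
  fix \<rho> :: "nat \<Rightarrow> nat val" and e assume \<rho>: "\<rho> 0 = Base (enc e)"
  have "((1 / real sz) ^ e i + (1 - (1 / real sz) ^ e j)) / real sz \<ge> 1 / real sz \<longleftrightarrow> e i \<le> e j"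
    using sz_pos q_power_le[of "e j" "e i"] by (subst divide_le_cancel) auto
  then show "sem M (Thr (Ge (1 / of_nat sz)) (cmp i j)) \<rho> = Base (truth (e i \<le> e j))"
    by (simp add: sem_cmp[where \<rho> = \<rho> and e = e, OF assms \<rho>] truth_def of_rat_divide cong: restrict_cong)
qed

lemma definable_eq: "i < N \<Longrightarrow> j < N \<Longrightarrow> definable {} (\<lambda>_ e. e i = e j)"
  using definable_conj[OF definable_le[of i j] definable_le[of j i]] by (simp add: order_eq_iff)

lemma definable_neq: "i < N \<Longrightarrow> j < N \<Longrightarrow> definable {} (\<lambda>_ e. e i \<noteq> e j)"
  using definable_disj[OF definable_less[of i j] definable_less[of j i]] by (simp add: neq_iff)

section \<open>Number quantifiers\<close>

lemma quantifier_body: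
  assumes \<psi>: "realizes J \<psi> \<Phi>" and u: "realizes_tr u g" and "2 \<notin> J"
    and w: "wf_env J \<rho>" "\<forall>j\<in>J. reps (\<rho> j) R" and F: "F \<in> dom_ty S fn_ty" "reps F Q"
  shows "sem M \<psi> (\<rho>(2 := F, 0 := Base (enc e))) = Base (truth (\<Phi> R e))"
    and "sem M (App (Var 2) u) (\<rho>(2 := F, 0 := Base (enc e))) = Base (truth (Q (g e)))"
proof -
  let ?\<rho> = "\<rho>(2 := F, 0 := Base (enc e))"
  have "wf_env J ?\<rho>"
    by (rule wf_env_mono[OF reps_body_env[OF w(1) realizes_0[OF \<psi>] F(1)]]) auto
  moreover have "\<forall>j\<in>J. reps (?\<rho> j) R"
    using w(2) realizes_0[OF \<psi>] \<open>2 \<notin> J\<close> by (metis fun_upd_other)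
  ultimately show "sem M \<psi> ?\<rho> = Base (truth (\<Phi> R e))"
    by (rule realizes_sem[OF \<psi>]) simp
  have "sem M u ?\<rho> = Base (enc (g e))" by (rule realizes_tr_sem[OF u]) simp
  then show "sem M (App (Var 2) u) ?\<rho> = Base (truth (Q (g e)))"
    using F(2) by (simp add: reps_def)
qed

text \<open>Search through the values of entry \<open>i\<close>, restarted at 0. The relation
  \<open>R\<close> remains a parameter, so quantifiers may occur inside the body of an outer
  recursion; since each quantifier binds variable 2 itself, nested ones can share it.\<close>

lemma definable_ex:
  assumes "definable J \<Phi>" "2 \<notin> J" "i < N"
  shows "definable J (\<lambda>R e. \<exists>k. \<Phi> R (e(i := k)))"
proof -
  define g where "g e = e(i := Suc (e i))" for e :: "nat \<Rightarrow> nat"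
  obtain \<psi> u z where \<psi>: "realizes J \<psi> \<Phi>" and u: "realizes_tr u g" and z: "realizes_tr z (\<lambda>e. e(i := 0))"
    using assms(1) definable_map_suc[OF assms(3)] definable_map_zero[OF assms(3)] unfolding definable_def definable_map_def g_def[abs_def] by blast
  let ?\<chi> = "Or \<psi> (App (Var 2) u)"
  have 0: "0 \<notin> insert 2 J" using realizes_0[OF \<psi>] by simp
  have ok: "ok Prp (insert 2 J) ?\<chi>"
    using realizes_ok[OF \<psi>] realizes_tr_ok[OF u] 0 by (blast intro: ok_Or ok_App ok_Var ok_weaken)
  have "realizes J (App (Mu 2 fn_ty (Lam 0 Prp ?\<chi>)) z) (\<lambda>R e. \<exists>k. \<Phi> R (e(i := k)))"
  proof (rule realizesI)
    show "ok Prp J (App (Mu 2 fn_ty (Lam 0 Prp ?\<chi>)) z)"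
      using ok realizes_tr_ok[OF z] 0 by (blast intro: ok_App ok_Mu ok_Lam ok_weaken)
    fix \<rho> :: "nat \<Rightarrow> nat val" and R e
    assume *: "wf_env J \<rho>" "\<forall>j\<in>J. reps (\<rho> j) R" "\<rho> 0 = Base (enc e)"
    have "reps (sem M (Mu 2 fn_ty (Lam 0 Prp ?\<chi>)) \<rho>) (lfp (\<lambda>Q e. \<Phi> R e \<or> Q (g e)))"
    proof (rule reps_mu[OF ok *(1)])
      fix F Q e assume "F \<in> dom_ty S fn_ty" "reps F Q"
      note quantifier_body[OF \<psi> u assms(2) *(1,2) this, of e]
      then show "sem M ?\<chi> (\<rho>(2 := F, 0 := Base (enc e))) = Base (truth (\<Phi> R e \<or> Q (g e)))"
        unfolding sem.simps(3) by (auto simp: truth_def intro!: restrict_ext)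
    qed (auto intro!: monoI simp: le_fun_def)
    moreover have "sem M z \<rho> = Base (enc (e(i := 0)))"
      using *(3) by (rule realizes_tr_sem[OF z])
    ultimately show "sem M (App (Mu 2 fn_ty (Lam 0 Prp ?\<chi>)) z) \<rho> = Base (truth (\<exists>k. \<Phi> R (e(i := k))))"
      by (simp add: reps_def lfp_iterate g_def[abs_def] fun_upd_iterate del: sem.simps(9))
  qed
  then show ?thesis by (rule definableI)
qed

lemma definable_all:
  assumes "definable J \<Phi>" "2 \<notin> J" "i < N"
  shows "definable J (\<lambda>R e. \<forall>k. \<Phi> R (e(i := k)))"
proof -
  define g where "g e = e(i := Suc (e i))" for e :: "nat \<Rightarrow> nat"
  obtain \<psi> u z where \<psi>: "realizes J \<psi> \<Phi>" and u: "realizes_tr u g" and z: "realizes_tr z (\<lambda>e. e(i := 0))"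
    using assms(1) definable_map_suc[OF assms(3)] definable_map_zero[OF assms(3)] unfolding definable_def definable_map_def g_def[abs_def] by blast
  let ?\<chi> = "And \<psi> (App (Var 2) u)"
  have 0: "0 \<notin> insert 2 J" using realizes_0[OF \<psi>] by simp
  have ok: "ok Prp (insert 2 J) ?\<chi>"
    using realizes_ok[OF \<psi>] realizes_tr_ok[OF u] 0 by (blast intro: ok_And ok_App ok_Var ok_weaken)
  have "realizes J (App (Nu 2 fn_ty (Lam 0 Prp ?\<chi>)) z) (\<lambda>R e. \<forall>k. \<Phi> R (e(i := k)))"
  proof (rule realizesI)
    show "ok Prp J (App (Nu 2 fn_ty (Lam 0 Prp ?\<chi>)) z)"
      using ok realizes_tr_ok[OF z] 0 by (blast intro: ok_App ok_Nu ok_Lam ok_weaken)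
    fix \<rho> :: "nat \<Rightarrow> nat val" and R e
    assume *: "wf_env J \<rho>" "\<forall>j\<in>J. reps (\<rho> j) R" "\<rho> 0 = Base (enc e)"
    have "reps (sem M (Nu 2 fn_ty (Lam 0 Prp ?\<chi>)) \<rho>) (gfp (\<lambda>Q e. \<Phi> R e \<and> Q (g e)))"
    proof (rule reps_nu[OF ok *(1)])
      fix F Q e assume "F \<in> dom_ty S fn_ty" "reps F Q"
      note quantifier_body[OF \<psi> u assms(2) *(1,2) this, of e]
      then show "sem M ?\<chi> (\<rho>(2 := F, 0 := Base (enc e))) = Base (truth (\<Phi> R e \<and> Q (g e)))"
        unfolding sem.simps(4) by (auto simp: truth_def intro!: restrict_ext)
    qed (auto intro!: monoI simp: le_fun_def)
    moreover have "sem M z \<rho> = Base (enc (e(i := 0)))"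
      using *(3) by (rule realizes_tr_sem[OF z])
    ultimately show "sem M (App (Nu 2 fn_ty (Lam 0 Prp ?\<chi>)) z) \<rho> = Base (truth (\<forall>k. \<Phi> R (e(i := k))))"
      by (simp add: reps_def gfp_iterate g_def[abs_def] fun_upd_iterate del: sem.simps(10))
  qed
  then show ?thesis by (rule definableI)
qed

section \<open>Addition and multiplication\<close>

lemma definable_const: "definable {} (\<lambda>_. P) \<Longrightarrow> definable {1} (\<lambda>_. P)"
  by (rule definable_weaken) simp_all

lemma definable_iterate:
  assumes "definable {} (\<lambda>_. P)" "definable {1} (\<lambda>R e. R (g e))"
  shows "definable {} (\<lambda>_ e. \<exists>n. P ((g ^^ n) e))"
proof -
  have "definable {1} (\<lambda>Q e. P e \<or> Q (g e))"
    by (intro definable_disj definable_const assms)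
  moreover have "mono (\<lambda>Q e. P e \<or> Q (g e))" by (auto intro!: monoI simp: le_fun_def)
  ultimately have "definable {} (\<lambda>_. lfp (\<lambda>Q e. P e \<or> Q (g e)))" by (rule definable_lfp)
  then show ?thesis unfolding lfp_iterate[abs_def] .
qed

lemma fresh_slot:
  assumes "finite A" "card A < N"
  obtains u where "u < N" "u \<notin> A"
proof -
  have "\<not> {..<N} \<subseteq> A" using card_mono[OF assms(1), of "{..<N}"] assms(2) by auto
  then show ?thesis using that by blast
qed

text \<open>Two counters start at 0 and at the first summand and advance together; when the first
  shows the second summand, the other shows the sum. The bound 6 leaves room for three arguments
  and, in multiplication, three scratch entries.\<close>

lemma definable_add:
  assumes "x < N" "y < N" "z < N" and N: "6 \<le> N"
  shows "definable {} (\<lambda>_ e. e x + e y = e z)"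
proof -
  obtain u where u: "u < N" "u \<notin> {x, y, z}"
    by (rule fresh_slot[of "{x, y, z}"]) (use N in \<open>auto simp: card_insert_if\<close>)
  obtain v where v: "v < N" "v \<notin> {u, x, y, z}"
    by (rule fresh_slot[of "{u, x, y, z}"]) (use N in \<open>auto simp: card_insert_if\<close>)
  define g where "g e = (e(u := Suc (e u)))(v := Suc ((e(u := Suc (e u))) v))" for e :: "nat \<Rightarrow> nat"
  have "definable_map g" unfolding g_def[abs_def] by (rule definable_map_comp[OF definable_map_suc[OF v(1)] definable_map_suc[OF u(1)]])
  then have "definable {1} (\<lambda>R e. R (g e))" by (rule definable_subst[OF definable_rel])
  then have "definable {} (\<lambda>_ e. \<exists>n. (\<lambda>e. e u = e y \<and> e v = e z) ((g ^^ n) e))"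
    by (intro definable_iterate definable_conj definable_eq assms u v)
  then have "definable {} (\<lambda>_ e. \<exists>n. (\<lambda>e. e u = e y \<and> e v = e z) ((g ^^ n) ((e(u := 0))(v := (e(u := 0)) x))))"
    by (rule definable_subst[OF _ definable_map_comp[OF definable_map_copy[OF v(1) assms(1)] definable_map_zero[OF u(1)]]])
  moreover have "(g ^^ n) (e(u := 0, v := e x)) = e(u := n, v := e x + n)" for n and e :: "nat \<Rightarrow> nat"
  proof (induction n)
    case (Suc n)
    then have "(g ^^ Suc n) (e(u := 0, v := e x)) = g (e(u := n, v := e x + n))" by (simp only: funpow.simps o_apply)
    also have "\<dots> = e(u := Suc n, v := e x + Suc n)" using v by (auto simp: g_def)
    finally show ?case .
  qed simp
  moreover have "x \<noteq> u" "y \<noteq> u" "z \<noteq> u" "y \<noteq> v" "z \<noteq> v" "u \<noteq> v" using u v by auto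
  ultimately show ?thesis by simp
qed

text \<open>Repeated addition, counted by \<open>u\<close> and accumulated in \<open>v\<close>.
  Addition is available as a relation, not as a map, so every round guesses the new total in
  \<open>w\<close> by a quantifier, checks it, and copies it into \<open>v\<close> for the next
  round.\<close>

lemma definable_mul:
  assumes "x < N" "y < N" "z < N" and N: "6 \<le> N"
  shows "definable {} (\<lambda>_ e. e x * e y = e z)"
proof -
  obtain u where u: "u < N" "u \<notin> {x, y, z}"
    by (rule fresh_slot[of "{x, y, z}"]) (use N in \<open>auto simp: card_insert_if\<close>)
  obtain v where v: "v < N" "v \<notin> {u, x, y, z}"
    by (rule fresh_slot[of "{u, x, y, z}"]) (use N in \<open>auto simp: card_insert_if\<close>)
  obtain w where w: "w < N" "w \<notin> {u, v, x, y, z}"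
    by (rule fresh_slot[of "{u, v, x, y, z}"]) (use N in \<open>auto simp: card_insert_if\<close>)
  have neq: "x \<noteq> u" "y \<noteq> u" "z \<noteq> u" "x \<noteq> v" "y \<noteq> v" "z \<noteq> v" "u \<noteq> v"
    "x \<noteq> w" "y \<noteq> w" "z \<noteq> w" "u \<noteq> w" "v \<noteq> w" using u v w by auto
  define h where "h e = (\<lambda>e. e(u := Suc (e u))) (e(v := e w))" for e :: "nat \<Rightarrow> nat"
  have "definable_map h" unfolding h_def[abs_def] by (rule definable_map_comp[OF definable_map_suc[OF u(1)] definable_map_copy[OF v(1) w(1)]])
  then have "definable {1} (\<lambda>R e. R (h e))" by (rule definable_subst[OF definable_rel])
  then have "definable {1} (\<lambda>R e. \<exists>k. (e(w := k)) v + (e(w := k)) x = (e(w := k)) w \<and> R (h (e(w := k))))"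
    by (intro definable_ex[where \<Phi> = "\<lambda>R e. e v + e x = e w \<and> R (h e)"] definable_conj definable_const definable_add v w assms) auto
  moreover define g where "g e = h (e(w := e v + e x))" for e
  ultimately have "definable {1} (\<lambda>R e. R (g e))" using neq by simp
  then have "definable {} (\<lambda>_ e. \<exists>n. (\<lambda>e. e u = e y \<and> e v = e z) ((g ^^ n) e))"
    by (intro definable_iterate definable_conj definable_eq assms u v)
  then have "definable {} (\<lambda>_ e. \<exists>n. (\<lambda>e. e u = e y \<and> e v = e z) ((g ^^ n) ((\<lambda>e. e(u := 0)) (e(v := 0)))))"
    by (rule definable_subst[OF _ definable_map_comp[OF definable_map_zero[OF u(1)] definable_map_zero[OF v(1)]]])
  moreover have "((g ^^ n) (e(v := 0, u := 0))) u = n \<and> ((g ^^ n) (e(v := 0, u := 0))) v = e x * n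
    \<and> (\<forall>i. i \<notin> {u, v, w} \<longrightarrow> ((g ^^ n) (e(v := 0, u := 0))) i = e i)" for n and e :: "nat \<Rightarrow> nat"
    by (induction n) (use neq in \<open>auto simp: g_def h_def\<close>)
  ultimately show ?thesis using neq by simp
qed

end

section \<open>Terms and first-order formulas of arithmetic\<close>

primrec tvars :: "aterm \<Rightarrow> nat set" where
  "tvars (TVar x) = {x}"
| "tvars TZero = {}"
| "tvars (TSuc t) = tvars t"
| "tvars (TAdd t u) = tvars t \<union> tvars u"
| "tvars (TMul t u) = tvars t \<union> tvars u"

text \<open>Membership is excluded: sets never reach the formulas over the chain, as their
  characteristic values are looked up in the coded truth assignment. Entries from \<open>K\<close>
  on remain free as scratch.\<close>

primrec fo_below :: "nat \<Rightarrow> so_formula \<Rightarrow> bool" where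
  "fo_below K (SEq t u) \<longleftrightarrow> tvars t \<union> tvars u \<subseteq> {..<K}"
| "fo_below K (SLess t u) \<longleftrightarrow> tvars t \<union> tvars u \<subseteq> {..<K}"
| "fo_below K (SMem t X) \<longleftrightarrow> False"
| "fo_below K (SNot \<phi>) \<longleftrightarrow> fo_below K \<phi>"
| "fo_below K (SAnd \<phi> \<psi>) \<longleftrightarrow> fo_below K \<phi> \<and> fo_below K \<psi>"
| "fo_below K (SOr \<phi> \<psi>) \<longleftrightarrow> fo_below K \<phi> \<and> fo_below K \<psi>"
| "fo_below K (SExNum x \<phi>) \<longleftrightarrow> x < K \<and> fo_below K \<phi>"
| "fo_below K (SAllNum x \<phi>) \<longleftrightarrow> x < K \<and> fo_below K \<phi>"
| "fo_below K (SExSet X \<phi>) \<longleftrightarrow> False"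
| "fo_below K (SAllSet X \<phi>) \<longleftrightarrow> False"

lemma tval_cong: "(\<And>x. x \<in> tvars t \<Longrightarrow> e x = e' x) \<Longrightarrow> tval t e = tval t e'"
  by (induction t) auto

lemma tval_upd: "x \<notin> tvars t \<Longrightarrow> tval t (e(x := n)) = tval t e"
  by (rule tval_cong) auto

context uniform_chain begin

lemma fresh_slot_above:
  assumes "K + 3 \<le> N" "finite A" "card A < 3"
  obtains a where "a < N" "K \<le> a" "a \<notin> A"
proof -
  have "\<not> {K..<N} \<subseteq> A" using card_mono[OF assms(2), of "{K..<N}"] assms(1,3) by auto
  then show ?thesis using that by force
qed

text \<open>The values of subterms are guessed in scratch entries from \<open>K\<close> on and
  verified recursively; since these entries do not occur in the term, quantifying over them leaves
  its value unchanged.\<close>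

lemma definable_term:
  assumes N: "K + 6 \<le> N" and "tvars t \<subseteq> {..<K}" "z < N"
  shows "definable {} (\<lambda>_ e. tval t e = e z)"
  using assms(2,3)
proof (induction t arbitrary: z)
  case (TVar x)
  then show ?case using N by (auto intro!: definable_eq)
next
  case TZero
  obtain a where a: "a < N" "K \<le> a" "a \<notin> {z}" by (rule fresh_slot_above[of K "{z}"]) (use N in auto)
  have "definable {} (\<lambda>_ e. (\<lambda>e. e a = e z) (e(a := 0)))"
    by (rule definable_subst[where \<Phi> = "\<lambda>_ e. e a = e z"]) (intro definable_eq definable_map_zero a TZero)+
  then show ?case using a by simp
next
  case (TSuc t)
  obtain a where a: "a < N" "K \<le> a" "a \<notin> {z}" by (rule fresh_slot_above[of K "{z}"]) (use N in auto)
  have "definable {} (\<lambda>_ e. (\<lambda>e. e a = e z) (e(a := Suc (e a))))"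
    by (rule definable_subst[where \<Phi> = "\<lambda>_ e. e a = e z"]) (intro definable_eq definable_map_suc a TSuc)+
  then have "definable {} (\<lambda>_ e. \<exists>k. (\<lambda>_ e. tval t e = e a \<and> (\<lambda>e. e a = e z) (e(a := Suc (e a)))) R (e(a := k)))" for R :: "(nat \<Rightarrow> nat) \<Rightarrow> bool"
    using TSuc a by (intro definable_ex definable_conj) auto
  moreover have "a \<notin> tvars t" using a TSuc by auto
  ultimately show ?case using a by (simp add: tval_upd)
next
  case (TAdd t u)
  obtain a where a: "a < N" "K \<le> a" "a \<notin> {z}" by (rule fresh_slot_above[of K "{z}"]) (use N in auto)
  obtain b where b: "b < N" "K \<le> b" "b \<notin> {a, z}" by (rule fresh_slot_above[of K "{a, z}"]) (use N in \<open>auto simp: card_insert_if\<close>)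
  have "definable {} (\<lambda>_ e. \<exists>k l. (\<lambda>_ e. tval t e = e a \<and> tval u e = e b \<and> e a + e b = e z) () (e(a := k, b := l)))"
    using TAdd a b N
    by (intro definable_ex[where \<Phi> = "\<lambda>_ e. \<exists>l. (\<lambda>_ e. tval t e = e a \<and> tval u e = e b \<and> e a + e b = e z) () (e(b := l))"]
        definable_ex[where \<Phi> = "\<lambda>_ e. tval t e = e a \<and> tval u e = e b \<and> e a + e b = e z"] definable_conj definable_add) auto
  moreover have "a \<notin> tvars t" "b \<notin> tvars t" "a \<notin> tvars u" "b \<notin> tvars u" using a b TAdd by auto
  ultimately show ?case using a b by (simp add: tval_upd)
next
  case (TMul t u)
  obtain a where a: "a < N" "K \<le> a" "a \<notin> {z}" by (rule fresh_slot_above[of K "{z}"]) (use N in auto)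
  obtain b where b: "b < N" "K \<le> b" "b \<notin> {a, z}" by (rule fresh_slot_above[of K "{a, z}"]) (use N in \<open>auto simp: card_insert_if\<close>)
  have "definable {} (\<lambda>_ e. \<exists>k l. (\<lambda>_ e. tval t e = e a \<and> tval u e = e b \<and> e a * e b = e z) () (e(a := k, b := l)))"
    using TMul a b N
    by (intro definable_ex[where \<Phi> = "\<lambda>_ e. \<exists>l. (\<lambda>_ e. tval t e = e a \<and> tval u e = e b \<and> e a * e b = e z) () (e(b := l))"]
        definable_ex[where \<Phi> = "\<lambda>_ e. tval t e = e a \<and> tval u e = e b \<and> e a * e b = e z"] definable_conj definable_mul) auto
  moreover have "a \<notin> tvars t" "b \<notin> tvars t" "a \<notin> tvars u" "b \<notin> tvars u" using a b TMul by auto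
  ultimately show ?case using a b by (simp add: tval_upd)
qed

lemma definable_terms:
  assumes N: "K + 6 \<le> N" and t: "tvars t \<subseteq> {..<K}" and u: "tvars u \<subseteq> {..<K}"
    and rel: "\<And>a b. a < N \<Longrightarrow> b < N \<Longrightarrow> definable {} (\<lambda>_ e. r (e a) (e b))"
  shows "definable {} (\<lambda>_ e. r (tval t e) (tval u e))"
proof -
  have ab: "K < N" "Suc K < N" using N by auto
  have "definable {} (\<lambda>_ e. \<exists>k l. (\<lambda>_ e. tval t e = e K \<and> tval u e = e (Suc K) \<and> r (e K) (e (Suc K))) () (e(K := k, Suc K := l)))"
    by (intro definable_ex[where \<Phi> = "\<lambda>_ e. \<exists>l. (\<lambda>_ e. tval t e = e K \<and> tval u e = e (Suc K) \<and> r (e K) (e (Suc K))) () (e(Suc K := l))"]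
        definable_ex[where \<Phi> = "\<lambda>_ e. tval t e = e K \<and> tval u e = e (Suc K) \<and> r (e K) (e (Suc K))"] definable_conj definable_term[OF N] rel ab t u) auto
  moreover have "K \<notin> tvars t" "Suc K \<notin> tvars t" "K \<notin> tvars u" "Suc K \<notin> tvars u" using t u by auto
  ultimately show ?thesis by (simp add: tval_upd)
qed

text \<open>With no negation among the formulas, a relation and its complement go through the
  induction as a pair: \<open>SNot\<close> swaps them, and each number quantifier uses a least
  fixpoint for one and a greatest fixpoint for the other.\<close>

lemma definable_arithmetic:
  assumes N: "K + 6 \<le> N" and "fo_below K \<phi>"
  shows "definable {} (\<lambda>_ e. so_sat \<phi> e V) \<and> definable {} (\<lambda>_ e. \<not> so_sat \<phi> e V)"
  using assms(2)
proof (induction \<phi>)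
  case (SEq t u)
  then show ?case
    using definable_terms[OF N, of t u "(=)", OF _ _ definable_eq] definable_terms[OF N, of t u "(\<noteq>)", OF _ _ definable_neq] by simp
next
  case (SLess t u)
  then show ?case
    using definable_terms[OF N, of t u "(<)", OF _ _ definable_less]
      definable_terms[OF N, of u t "(\<le>)", OF _ _ definable_le] by (simp add: not_less)
next
  case (SAnd \<phi> \<psi>)
  then have "definable {} (\<lambda>_ e. \<not> so_sat \<phi> e V \<or> \<not> so_sat \<psi> e V)" by (intro definable_disj) auto
  then have "definable {} (\<lambda>_ e. \<not> so_sat (SAnd \<phi> \<psi>) e V)" by (simp only: so_sat.simps de_Morgan_conj)
  then show ?case using SAnd by (auto intro!: definable_conj)
next
  case (SOr \<phi> \<psi>)
  then show ?case by (auto intro!: definable_conj definable_disj)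
next
  case (SExNum x \<phi>)
  have "definable {} (\<lambda>_ e. \<exists>k. (\<lambda>_ e. so_sat \<phi> e V) () (e(x := k)))"
    "definable {} (\<lambda>_ e. \<forall>k. (\<lambda>_ e. \<not> so_sat \<phi> e V) () (e(x := k)))"
    using SExNum N by (intro definable_ex[where \<Phi> = "\<lambda>_ e. so_sat \<phi> e V"] definable_all[where \<Phi> = "\<lambda>_ e. \<not> so_sat \<phi> e V"]; simp)+
  then show ?case by simp
next
  case (SAllNum x \<phi>)
  have "definable {} (\<lambda>_ e. \<forall>k. (\<lambda>_ e. so_sat \<phi> e V) () (e(x := k)))"
    "definable {} (\<lambda>_ e. \<exists>k. (\<lambda>_ e. \<not> so_sat \<phi> e V) () (e(x := k)))"
    using SAllNum N by (intro definable_all[where \<Phi> = "\<lambda>_ e. so_sat \<phi> e V"] definable_ex[where \<Phi> = "\<lambda>_ e. \<not> so_sat \<phi> e V"]; simp)+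
  then show ?case by simp
qed auto

end

section \<open>Locally consistent truth assignments\<close>

instance aterm :: countable by countable_datatype
instance so_formula :: countable by countable_datatype

text \<open>A polynomial with natural coefficients and hence a term of arithmetic, unlike
  \<open>prod_encode\<close>, which involves halving.\<close>

definition pcode :: "nat \<Rightarrow> nat \<Rightarrow> nat" where
  "pcode x y = (x + y) * (x + y) + x"

text \<open>The code lies between the squares of \<open>x + y\<close> and of
  \<open>x + y + 1\<close>, so it determines the sum, and then \<open>x\<close>.\<close>

lemma pcode_inject [simp]: "pcode x y = pcode x' y' \<longleftrightarrow> x = x' \<and> y = y'"
proof
  assume eq: "pcode x y = pcode x' y'"
  have less: "pcode a b < pcode c d" if "a + b < c + d" for a b c d
  proof -
    have "pcode a b < (a + b + 1) * (a + b + 1)" by (simp add: pcode_def)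
    also have "\<dots> \<le> (c + d) * (c + d)" using that by (intro mult_le_mono) auto
    also have "\<dots> \<le> pcode c d" by (simp add: pcode_def)
    finally show ?thesis .
  qed
  have "x + y = x' + y'" using eq less[of x y x' y'] less[of x' y' x y] by linarith
  then show "x = x' \<and> y = y'" using eq by (simp add: pcode_def)
qed simp

definition tuple_code :: "nat list \<Rightarrow> nat" where
  "tuple_code xs = foldr pcode xs 0"

lemma tuple_code_inject: "length xs = length ys \<Longrightarrow> tuple_code xs = tuple_code ys \<longleftrightarrow> xs = ys"
  unfolding tuple_code_def by (induction xs ys rule: list_induct2) auto

text \<open>The parity of the tag separates instances of subformulas from instances \<open>v \<in> X\<close> of
  membership.\<close>

definition inst_code :: "nat \<Rightarrow> so_formula \<Rightarrow> (nat \<Rightarrow> nat) \<Rightarrow> nat" where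
  "inst_code m \<psi> e = pcode (2 * to_nat \<psi>) (tuple_code (map e [0..<m]))"

definition mem_code :: "nat \<Rightarrow> nat \<Rightarrow> nat" where
  "mem_code X v = pcode (Suc (2 * X)) v"

lemma inst_code_inject: "inst_code m \<psi> e = inst_code m \<psi>' e' \<longleftrightarrow> \<psi> = \<psi>' \<and> (\<forall>i<m. e i = e' i)"
  by (auto simp: inst_code_def tuple_code_inject)

lemma inst_code_neq_mem_code: "inst_code m \<psi> e \<noteq> mem_code X v"
proof
  assume "inst_code m \<psi> e = mem_code X v"
  then have "2 * to_nat \<psi> = Suc (2 * X)" by (simp add: inst_code_def mem_code_def)
  then show False by presburger
qed

lemma mem_code_inject: "mem_code X v = mem_code X' v' \<longleftrightarrow> X = X' \<and> v = v'"
  by (auto simp: mem_code_def)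

section \<open>Normal form of the arithmetical matrix\<close>

primrec nf :: "so_formula \<Rightarrow> so_formula" where
  "nf (SEq t u) = SEq t u"
| "nf (SLess t u) = SLess t u"
| "nf (SMem t X) = SMem t X"
| "nf (SNot \<phi>) = SNot (nf \<phi>)"
| "nf (SAnd \<phi> \<psi>) = SAnd (nf \<phi>) (nf \<psi>)"
| "nf (SOr \<phi> \<psi>) = SNot (SAnd (SNot (nf \<phi>)) (SNot (nf \<psi>)))"
| "nf (SExNum x \<phi>) = SExNum x (nf \<phi>)"
| "nf (SAllNum x \<phi>) = SNot (SExNum x (SNot (nf \<phi>)))"
| "nf (SExSet X \<phi>) = SExSet X \<phi>"
| "nf (SAllSet X \<phi>) = SAllSet X \<phi>"

text \<open>With only three logical constructors left, local consistency needs few clauses. The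
  bound \<open>m\<close> on variables lets \<open>m\<close> numbers determine an instance.\<close>

primrec core :: "nat \<Rightarrow> so_formula \<Rightarrow> bool" where
  "core m (SEq t u) \<longleftrightarrow> tvars t \<union> tvars u \<subseteq> {..<m}"
| "core m (SLess t u) \<longleftrightarrow> tvars t \<union> tvars u \<subseteq> {..<m}"
| "core m (SMem t X) \<longleftrightarrow> tvars t \<subseteq> {..<m}"
| "core m (SNot \<phi>) \<longleftrightarrow> core m \<phi>"
| "core m (SAnd \<phi> \<psi>) \<longleftrightarrow> core m \<phi> \<and> core m \<psi>"
| "core m (SOr \<phi> \<psi>) \<longleftrightarrow> False"
| "core m (SExNum x \<phi>) \<longleftrightarrow> x < m \<and> core m \<phi>"
| "core m (SAllNum x \<phi>) \<longleftrightarrow> False"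
| "core m (SExSet X \<phi>) \<longleftrightarrow> False"
| "core m (SAllSet X \<phi>) \<longleftrightarrow> False"

lemma so_sat_nf: "arithmetical \<phi> \<Longrightarrow> so_sat (nf \<phi>) e V = so_sat \<phi> e V"
  by (induction \<phi> arbitrary: e) auto

lemma finite_tvars: "finite (tvars t)"
  by (induction t) auto

lemma core_mono: "core m \<phi> \<Longrightarrow> m \<le> m' \<Longrightarrow> core m' \<phi>"
  by (induction \<phi>) (auto 0 3)

lemma tvars_bounded: "\<exists>m. tvars t \<subseteq> {..<m} \<and> tvars u \<subseteq> {..<m}"
proof -
  have "finite (tvars t \<union> tvars u)" by (simp add: finite_tvars)
  then show ?thesis unfolding finite_nat_set_iff_bounded by auto
qed

lemma ex_core_nf: "arithmetical \<phi> \<Longrightarrow> \<exists>m. core m (nf \<phi>)"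
proof (induction \<phi>)
  case (SEq t u)
  then show ?case using tvars_bounded[of t u] by simp
next
  case (SLess t u)
  then show ?case using tvars_bounded[of t u] by simp
next
  case (SMem t X)
  then show ?case using tvars_bounded[of t t] by simp
next
  case (SAnd \<phi> \<psi>)
  then obtain m m' where "core m (nf \<phi>)" "core m' (nf \<psi>)" by auto
  then have "core (max m m') (nf (SAnd \<phi> \<psi>))" by (auto intro: core_mono)
  then show ?case by blast
next
  case (SOr \<phi> \<psi>)
  then obtain m m' where "core m (nf \<phi>)" "core m' (nf \<psi>)" by auto
  then have "core (max m m') (nf (SOr \<phi> \<psi>))" by (auto intro: core_mono)
  then show ?case by blast
next
  case (SExNum x \<phi>)
  then obtain m where "core m (nf \<phi>)" by auto
  then have "core (max m (Suc x)) (nf (SExNum x \<phi>))" by (auto intro: core_mono)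
  then show ?case by blast
next
  case (SAllNum x \<phi>)
  then obtain m where "core m (nf \<phi>)" by auto
  then have "core (max m (Suc x)) (nf (SAllNum x \<phi>))" by (auto intro: core_mono)
  then show ?case by blast
qed auto

lemma so_sat_cong: "core m \<psi> \<Longrightarrow> (\<And>i. i < m \<Longrightarrow> e i = e' i) \<Longrightarrow> so_sat \<psi> e V = so_sat \<psi> e' V"
proof (induction \<psi> arbitrary: e e')
  case (SEq t u)
  then have "tval t e = tval t e'" "tval u e = tval u e'" by (auto intro!: tval_cong)
  then show ?case by simp
next
  case (SLess t u)
  then have "tval t e = tval t e'" "tval u e = tval u e'" by (auto intro!: tval_cong)
  then show ?case by simp
next
  case (SMem t X)
  then have "tval t e = tval t e'" by (auto intro!: tval_cong)
  then show ?case by simp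
next
  case (SNot \<psi>)
  have "so_sat \<psi> e V = so_sat \<psi> e' V" by (rule SNot.IH) (use SNot.prems in auto)
  then show ?case by simp
next
  case (SAnd \<phi> \<psi>)
  have "so_sat \<phi> e V = so_sat \<phi> e' V" by (rule SAnd.IH(1)) (use SAnd.prems in auto)
  moreover have "so_sat \<psi> e V = so_sat \<psi> e' V" by (rule SAnd.IH(2)) (use SAnd.prems in auto)
  ultimately show ?case by simp
next
  case (SExNum x \<psi>)
  have "so_sat \<psi> (e(x := n)) V = so_sat \<psi> (e'(x := n)) V" for n
    by (rule SExNum.IH) (use SExNum.prems in auto)
  then show ?case by simp
qed simp_all

text \<open>A function \<open>f\<close> on codes is read as a truth assignment to instances (0 is false), which at a
  true existential instance also records a witness plus 1.  The predicate \<open>consistent\<close> says that the partial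
  function with graph \<open>F\<close> contains no local inconsistency.\<close>

abbreviation holds :: "(nat \<Rightarrow> nat \<Rightarrow> bool) \<Rightarrow> nat \<Rightarrow> bool" where
  "holds F i \<equiv> \<exists>v. F i (Suc v)"

primrec consistent :: "nat \<Rightarrow> nat set \<Rightarrow> (nat \<Rightarrow> nat \<Rightarrow> bool) \<Rightarrow> so_formula \<Rightarrow> (nat \<Rightarrow> nat) \<Rightarrow> nat \<Rightarrow> bool" where
  "consistent m B F (SEq t u) e y \<longleftrightarrow>
     \<not> (holds F (inst_code m (SEq t u) e) \<and> tval t e \<noteq> tval u e) \<and>
     \<not> (F (inst_code m (SEq t u) e) 0 \<and> tval t e = tval u e)"
| "consistent m B F (SLess t u) e y \<longleftrightarrow>
     \<not> (holds F (inst_code m (SLess t u) e) \<and> \<not> tval t e < tval u e) \<and>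
     \<not> (F (inst_code m (SLess t u) e) 0 \<and> tval t e < tval u e)"
| "consistent m B F (SMem t X) e y \<longleftrightarrow>
     (if X \<in> B
      then \<not> (holds F (inst_code m (SMem t X) e) \<and> F (mem_code X (tval t e)) 0) \<and>
           \<not> (F (inst_code m (SMem t X) e) 0 \<and> holds F (mem_code X (tval t e)))
      else \<not> holds F (inst_code m (SMem t X) e))"
| "consistent m B F (SNot \<psi>) e y \<longleftrightarrow> consistent m B F \<psi> e y \<and>
     \<not> (holds F (inst_code m (SNot \<psi>) e) \<and> holds F (inst_code m \<psi> e)) \<and>
     \<not> (F (inst_code m (SNot \<psi>) e) 0 \<and> F (inst_code m \<psi> e) 0)"
| "consistent m B F (SAnd \<phi> \<psi>) e y \<longleftrightarrow> (consistent m B F \<phi> e y \<and> consistent m B F \<psi> e y) \<and>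
     \<not> (holds F (inst_code m (SAnd \<phi> \<psi>) e) \<and> F (inst_code m \<phi> e) 0) \<and>
     \<not> (holds F (inst_code m (SAnd \<phi> \<psi>) e) \<and> F (inst_code m \<psi> e) 0) \<and>
     \<not> (F (inst_code m (SAnd \<phi> \<psi>) e) 0 \<and> (holds F (inst_code m \<phi> e) \<and> holds F (inst_code m \<psi> e)))"
| "consistent m B F (SExNum x \<psi>) e y \<longleftrightarrow> consistent m B F \<psi> e y \<and>
     \<not> (F (inst_code m (SExNum x \<psi>) e) 0 \<and> holds F (inst_code m \<psi> (e(x := y)))) \<and>
     \<not> (F (inst_code m (SExNum x \<psi>) e) (Suc y) \<and> F (inst_code m \<psi> (e(x := y))) 0)"
| "consistent m B F (SOr \<phi> \<psi>) e y \<longleftrightarrow> True"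
| "consistent m B F (SAllNum x \<psi>) e y \<longleftrightarrow> True"
| "consistent m B F (SExSet X \<psi>) e y \<longleftrightarrow> True"
| "consistent m B F (SAllSet X \<psi>) e y \<longleftrightarrow> True"

section \<open>Consistent assignments and satisfaction\<close>

lemma ex_Suc_eq: "(\<exists>v. n = Suc v) \<longleftrightarrow> n \<noteq> 0"
  using not0_implies_Suc by blast

text \<open>For a total function the clauses are the truth conditions of a satisfaction relation,
  and the sets are read off the membership codes.\<close>

lemma consistent_sound:
  assumes "core m \<psi>" "\<And>e y. consistent m B (\<lambda>i v. f i = v) \<psi> e y"
  shows "f (inst_code m \<psi> e) \<noteq> 0 \<longleftrightarrow> so_sat \<psi> e (\<lambda>X. if X \<in> B then {v. f (mem_code X v) \<noteq> 0} else {})"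
  using assms
proof (induction \<psi> arbitrary: e)
  case (SEq t u)
  show ?case using SEq(2)[of e] by (auto simp: ex_Suc_eq)
next
  case (SLess t u)
  show ?case using SLess(2)[of e] by (auto simp: ex_Suc_eq)
next
  case (SMem t X)
  show ?case using SMem(2)[of e] by (auto simp: ex_Suc_eq split: if_splits)
next
  case (SNot \<psi>)
  have "f (inst_code m \<psi> e) \<noteq> 0 \<longleftrightarrow> so_sat \<psi> e (\<lambda>X. if X \<in> B then {v. f (mem_code X v) \<noteq> 0} else {})"
    using SNot.prems by (intro SNot.IH) auto
  then show ?case using SNot.prems(2)[of e] by (auto simp: ex_Suc_eq)
next
  case (SAnd \<phi> \<psi>)
  have "f (inst_code m \<phi> e) \<noteq> 0 \<longleftrightarrow> so_sat \<phi> e (\<lambda>X. if X \<in> B then {v. f (mem_code X v) \<noteq> 0} else {})"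
    "f (inst_code m \<psi> e) \<noteq> 0 \<longleftrightarrow> so_sat \<psi> e (\<lambda>X. if X \<in> B then {v. f (mem_code X v) \<noteq> 0} else {})"
    using SAnd.prems by (intro SAnd.IH; auto)+
  then show ?case using SAnd.prems(2)[of e] by (auto simp: ex_Suc_eq)
next
  case (SExNum x \<psi>)
  let ?V = "\<lambda>X. if X \<in> B then {v. f (mem_code X v) \<noteq> 0} else {}"
  have IH: "f (inst_code m \<psi> e) \<noteq> 0 \<longleftrightarrow> so_sat \<psi> e ?V" for e
    using SExNum.prems by (intro SExNum.IH) auto
  \<comment> \<open>Value 0 excludes every witness, while \<open>Suc y\<close> commits to
    \<open>y\<close>; these clauses give the two directions of the existential case.\<close>
  have c: "f (inst_code m (SExNum x \<psi>) e) = 0 \<Longrightarrow> f (inst_code m \<psi> (e(x := y))) = 0"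
    "f (inst_code m (SExNum x \<psi>) e) = Suc y \<Longrightarrow> f (inst_code m \<psi> (e(x := y))) \<noteq> 0" for y
    using SExNum.prems(2)[of e y] by (auto simp: ex_Suc_eq)
  have "f (inst_code m (SExNum x \<psi>) e) \<noteq> 0 \<longleftrightarrow> (\<exists>y. f (inst_code m \<psi> (e(x := y))) \<noteq> 0)"
    using c by (metis not0_implies_Suc)
  then show ?case using IH by simp
qed simp_all

lemma consistent_complete:
  assumes V: "V = (\<lambda>X. if X \<in> B then W X else {})"
  obtains f where "\<And>\<psi> e y. core m \<psi> \<Longrightarrow> consistent m B (\<lambda>i v. f i = v) \<psi> e y"
    "\<And>\<psi> e. core m \<psi> \<Longrightarrow> so_sat \<psi> e V \<Longrightarrow> f (inst_code m \<psi> e) \<noteq> 0"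
proof -
  \<comment> \<open>A code records only the entries below \<open>m\<close>. Cutting off the rest
    makes the chosen witness depend on the code alone, so \<open>f\<close> is well defined.\<close>
  define cut where "cut e = (\<lambda>i. if i < m then e i else 0)" for e :: "nat \<Rightarrow> nat"
  define wit where "wit \<psi> e = (case \<psi> of SExNum x \<chi> \<Rightarrow> (SOME w. so_sat \<chi> (e(x := w)) V) | _ \<Rightarrow> 0)"
    for \<psi> and e :: "nat \<Rightarrow> nat"
  define val where "val \<psi> e = (if so_sat \<psi> e V then Suc (wit \<psi> e) else 0)" for \<psi> e
  define f where "f i = (if \<exists>\<psi> e. i = inst_code m \<psi> e
      then (THE v. \<exists>\<psi> e. i = inst_code m \<psi> e \<and> v = val \<psi> (cut e))
      else if \<exists>X v. i = mem_code X v \<and> v \<in> W X then 1 else 0)" for i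
  have cut_cong: "cut e = cut e'" if "\<forall>i<m. e i = e' i" for e e'
    using that by (auto simp: cut_def)
  have f_inst: "f (inst_code m \<psi> e) = val \<psi> (cut e)" for \<psi> e
  proof -
    have "(THE v. \<exists>\<psi>' e'. inst_code m \<psi> e = inst_code m \<psi>' e' \<and> v = val \<psi>' (cut e')) = val \<psi> (cut e)"
    proof (rule the_equality)
      fix v assume "\<exists>\<psi>' e'. inst_code m \<psi> e = inst_code m \<psi>' e' \<and> v = val \<psi>' (cut e')"
      then show "v = val \<psi> (cut e)" using cut_cong by (auto simp: inst_code_inject) metis
    qed blast
    then show ?thesis unfolding f_def by auto
  qed
  have f_mem: "f (mem_code X v) \<noteq> 0 \<longleftrightarrow> v \<in> W X" for X v
    unfolding f_def using inst_code_neq_mem_code by (auto simp: mem_code_inject) metis+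
  have sat_cut: "so_sat \<psi> (cut e) V = so_sat \<psi> e V" if "core m \<psi>" for \<psi> e
    using that by (rule so_sat_cong) (simp add: cut_def)
  have truth_iff: "f (inst_code m \<psi> e) \<noteq> 0 \<longleftrightarrow> so_sat \<psi> e V" if "core m \<psi>" for \<psi> e
    using sat_cut[OF that, of e] by (simp add: f_inst val_def)
  have witness: "so_sat \<psi> (e(x := w)) V"
    if c: "core m (SExNum x \<psi>)" and w: "f (inst_code m (SExNum x \<psi>) e) = Suc w" for x \<psi> e w
  proof -
    have "\<exists>w. so_sat \<psi> ((cut e)(x := w)) V" and eq: "w = (SOME w. so_sat \<psi> ((cut e)(x := w)) V)"
      using w by (auto simp: f_inst val_def wit_def split: if_splits)
    then have "so_sat \<psi> ((cut e)(x := w)) V" using someI_ex by metis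
    moreover have "so_sat \<psi> ((cut e)(x := w)) V = so_sat \<psi> (e(x := w)) V"
      using c by (intro so_sat_cong[of m]) (auto simp: cut_def)
    ultimately show ?thesis by simp
  qed
  have "consistent m B (\<lambda>i v. f i = v) \<psi> e y" if "core m \<psi>" for \<psi> e y
    using that
  proof (induction \<psi>)
    case (SEq t u)
    then show ?case using truth_iff[OF SEq, of e] by (simp add: ex_Suc_eq)
  next
    case (SLess t u)
    then show ?case using truth_iff[OF SLess, of e] by (simp add: ex_Suc_eq)
  next
    case (SMem t X)
    then show ?case using truth_iff[OF SMem, of e] f_mem by (auto simp: ex_Suc_eq V)
  next
    case (SNot \<psi>)
    then show ?case using truth_iff[OF SNot.prems, of e] truth_iff[of \<psi> e] by (auto simp: ex_Suc_eq)
  next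
    case (SAnd \<phi> \<psi>)
    then show ?case using truth_iff[OF SAnd.prems, of e] truth_iff[of \<phi> e] truth_iff[of \<psi> e] by (auto simp: ex_Suc_eq)
  next
    case (SExNum x \<psi>)
    then show ?case
      using truth_iff[OF SExNum.prems, of e] truth_iff[of \<psi> "e(x := y)"] witness[OF SExNum.prems, of e y]
      by (auto simp: ex_Suc_eq)
  qed simp_all
  then show ?thesis using truth_iff by (intro that[of f]) auto
qed

text \<open>Each occurrence of \<open>F\<close> in a clause is under a negation.\<close>

lemma consistent_antimono: "consistent m B F \<psi> e y \<Longrightarrow> (\<And>i v. F' i v \<Longrightarrow> F i v) \<Longrightarrow> consistent m B F' \<psi> e y"
  by (induction \<psi>) (auto split: if_splits, blast+)

text \<open>For fixed \<open>e\<close> and \<open>y\<close> finitely many codes are inspected, so a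
  bound \<open>k\<close> above all of them decides the matter.\<close>

lemma consistent_limit:
  assumes "\<And>k. consistent m B (\<lambda>i v. i < k \<and> f i = v) \<psi> e y"
  shows "consistent m B (\<lambda>i v. f i = v) \<psi> e y"
  using assms
proof (induction \<psi>)
  case (SEq t u)
  then show ?case using SEq[of "Suc (inst_code m (SEq t u) e)"] by auto
next
  case (SLess t u)
  then show ?case using SLess[of "Suc (inst_code m (SLess t u) e)"] by auto
next
  case (SMem t X)
  then show ?case
    using SMem[of "Suc (inst_code m (SMem t X) e + mem_code X (tval t e))"] by (auto split: if_splits)
next
  case (SNot \<psi>)
  then have "consistent m B (\<lambda>i v. f i = v) \<psi> e y" by auto
  then show ?case
    using SNot.prems[of "Suc (inst_code m (SNot \<psi>) e + inst_code m \<psi> e)"] by auto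
next
  case (SAnd \<phi> \<psi>)
  then have "consistent m B (\<lambda>i v. f i = v) \<phi> e y" "consistent m B (\<lambda>i v. f i = v) \<psi> e y" by auto
  then show ?case
    using SAnd.prems[of "Suc (inst_code m (SAnd \<phi> \<psi>) e + inst_code m \<phi> e + inst_code m \<psi> e)"] by auto
next
  case (SExNum x \<psi>)
  then have "consistent m B (\<lambda>i v. f i = v) \<psi> e y" by auto
  then show ?case
    using SExNum.prems[of "Suc (inst_code m (SExNum x \<psi>) e + inst_code m \<psi> (e(x := y)))"] by auto
qed simp_all

definition good :: "nat \<Rightarrow> nat set \<Rightarrow> so_formula \<Rightarrow> nat \<Rightarrow> (nat \<Rightarrow> nat \<Rightarrow> bool) \<Rightarrow> bool" where
  "good m B \<chi> n F \<longleftrightarrow> (\<forall>e y. consistent m B F \<chi> e y) \<and> \<not> F (inst_code m \<chi> ((\<lambda>_. 0)(0 := n))) 0"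

lemma good_iff_sat:
  assumes "core m \<chi>"
  shows "(\<exists>f. \<forall>k. good m B \<chi> n (\<lambda>i v. i < k \<and> f i = v)) \<longleftrightarrow>
    (\<exists>W. so_sat \<chi> ((\<lambda>_. 0)(0 := n)) (\<lambda>X. if X \<in> B then W X else {}))"
proof
  let ?e = "(\<lambda>_. 0)(0 := n)"
  assume "\<exists>f. \<forall>k. good m B \<chi> n (\<lambda>i v. i < k \<and> f i = v)"
  then obtain f where f: "\<And>k. good m B \<chi> n (\<lambda>i v. i < k \<and> f i = v)" by blast
  have "f (inst_code m \<chi> ?e) \<noteq> 0"
    using f[of "Suc (inst_code m \<chi> ?e)"] by (auto simp: good_def)
  moreover have "consistent m B (\<lambda>i v. f i = v) \<chi> e y" for e y
    by (rule consistent_limit) (use f in \<open>auto simp: good_def\<close>)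
  ultimately show "\<exists>W. so_sat \<chi> ?e (\<lambda>X. if X \<in> B then W X else {})"
    using consistent_sound[OF assms, of B f ?e] by (intro exI[of _ "\<lambda>X. {v. f (mem_code X v) \<noteq> 0}"]) simp
next
  let ?e = "(\<lambda>_. 0)(0 := n)"
  assume "\<exists>W. so_sat \<chi> ?e (\<lambda>X. if X \<in> B then W X else {})"
  then obtain W where W: "so_sat \<chi> ?e (\<lambda>X. if X \<in> B then W X else {})" by blast
  obtain f where f: "\<And>e y. consistent m B (\<lambda>i v. f i = v) \<chi> e y" "f (inst_code m \<chi> ?e) \<noteq> 0"
    by (rule consistent_complete[OF refl, of m B W]) (use assms W in blast)
  have "good m B \<chi> n (\<lambda>i v. i < k \<and> f i = v)" for k
    unfolding good_def using f(2) by (auto intro: consistent_antimono[OF f(1)])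
  then show "\<exists>f. \<forall>k. good m B \<chi> n (\<lambda>i v. i < k \<and> f i = v)" by blast
qed

subsection \<open>Coding finite sequences\<close>

text \<open>Goedel's beta function, which turns a quantifier over finite sequences into quantifiers
  over two numbers.\<close>

definition beta :: "nat \<Rightarrow> nat \<Rightarrow> nat \<Rightarrow> nat" where
  "beta a b i = a mod Suc (Suc i * b)"

lemma beta_exists: "\<exists>a b. \<forall>i<k. beta a b i = f i"
proof -
  \<comment> \<open>\<open>s\<close> bounds the indices as well as the values: differences of
    indices then divide \<open>fact s\<close>, and every value is smaller than its modulus.\<close>
  define s where "s = k + (\<Sum>i<k. f i)"
  define b :: nat where "b = fact s"
  let ?m = "\<lambda>i. Suc (Suc i * b)"
  have "coprime (?m i) (?m j)" if "i < j" "j < k" for i j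
  proof -
    have "coprime (?m i) (Suc i * b)" by (rule coprime_Suc_left_nat)
    then have cb: "coprime (?m i) b" by (metis coprime_mult_right_iff)
    \<comment> \<open>The moduli differ by \<open>(j - i) * b\<close>. As \<open>j - i\<close>
      divides \<open>b\<close>, coprimality to \<open>b\<close> suffices for both factors.\<close>
    have "coprime (?m i) (j - i)"
    proof -
      have "j - i dvd b" unfolding b_def using that by (intro dvd_fact) (auto simp: s_def)
      then show ?thesis using cb by (metis coprime_mult_right_iff dvdE)
    qed
    then have "coprime (?m i) ((j - i) * b)" using cb by simp
    moreover have "?m j = ?m i + (j - i) * b"
      using that by (simp add: algebra_simps flip: distrib_right)
    ultimately show ?thesis by (metis coprime_iff_gcd_eq_1 gcd_add2)
  qed
  then have "\<forall>i\<in>{..<k}. \<forall>j\<in>{..<k}. i \<noteq> j \<longrightarrow> coprime (?m i) (?m j)"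
    by (metis coprime_commute lessThan_iff linorder_neqE_nat)
  then obtain a where a: "\<forall>i\<in>{..<k}. [a = f i] (mod ?m i)"
    using chinese_remainder_nat[of "{..<k}" ?m f] by auto
  have "beta a b i = f i" if "i < k" for i
  proof -
    have "f i \<le> (\<Sum>i<k. f i)" using that by (intro member_le_sum) auto
    then have "f i \<le> s" by (simp add: s_def)
    also have "s \<le> b" unfolding b_def by (rule fact_ge_self)
    also have "b < ?m i" by simp
    finally show ?thesis using a that by (simp add: beta_def cong_def)
  qed
  then show ?thesis by blast
qed

section \<open>Existence of a truth assignment as a greatest fixpoint\<close>

primrec numeral_term :: "nat \<Rightarrow> aterm" where
  "numeral_term 0 = TZero"
| "numeral_term (Suc n) = TSuc (numeral_term n)"

definition pcode_term :: "aterm \<Rightarrow> aterm \<Rightarrow> aterm" where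
  "pcode_term t u = TAdd (TMul (TAdd t u) (TAdd t u)) t"

definition inst_term :: "so_formula \<Rightarrow> aterm list \<Rightarrow> aterm" where
  "inst_term \<psi> ts = pcode_term (numeral_term (2 * to_nat \<psi>)) (foldr pcode_term ts TZero)"

definition mem_term :: "nat \<Rightarrow> aterm \<Rightarrow> aterm" where
  "mem_term X t = pcode_term (numeral_term (Suc (2 * X))) t"

lemma tval_numeral [simp]: "tval (numeral_term n) e = n"
  and tvars_numeral [simp]: "tvars (numeral_term n) = {}"
  by (induction n) auto

lemma tval_pcode [simp]: "tval (pcode_term t u) e = pcode (tval t e) (tval u e)"
  and tvars_pcode [simp]: "tvars (pcode_term t u) = tvars t \<union> tvars u"
  by (auto simp: pcode_term_def pcode_def)

lemma tval_tuple: "tval (foldr pcode_term ts TZero) e = tuple_code (map (\<lambda>t. tval t e) ts)"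
  by (induction ts) (auto simp: tuple_code_def)

lemma tvars_tuple: "tvars (foldr pcode_term ts TZero) = (\<Union>t\<in>set ts. tvars t)"
  by (induction ts) auto

lemma tvars_inst: "tvars (inst_term \<psi> ts) = (\<Union>t\<in>set ts. tvars t)"
  by (simp add: inst_term_def tvars_tuple)

lemma tval_inst: "tval (inst_term \<psi> (map TVar [0..<m])) e = inst_code m \<psi> e"
  by (simp add: inst_term_def inst_code_def tval_tuple o_def del: mult_Suc_right)

text \<open>Entry \<open>m\<close> carries the candidate witness, so the code of an updated instance
  arises by replacing one component of the tuple.\<close>

lemma tval_inst_upd:
  assumes "x < m"
  shows "tval (inst_term \<psi> ((map TVar [0..<m])[x := TVar m])) e = inst_code m \<psi> (e(x := e m))"
proof -
  have "map (\<lambda>t. tval t e) ((map TVar [0..<m])[x := TVar m]) = map (e(x := e m)) [0..<m]"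
    using assms by (intro nth_equalityI) (auto simp: map_update nth_list_update)
  then show ?thesis by (simp add: inst_term_def inst_code_def tval_tuple)
qed

lemma tval_inst_start:
  assumes "0 < m"
  shows "tval (inst_term \<psi> (TVar i # replicate (m - 1) TZero)) e = inst_code m \<psi> ((\<lambda>_. 0)(0 := e i))"
proof -
  have "map (\<lambda>t. tval t e) (TVar i # replicate (m - 1) TZero) = map ((\<lambda>_. 0)(0 := e i)) [0..<m]"
    using assms by (intro nth_equalityI) (auto simp: nth_Cons split: nat.split)
  then show ?thesis by (simp only: inst_term_def inst_code_def tval_tuple tval_pcode tval_numeral)
qed

lemma tval_mem: "tval (mem_term X t) e = mem_code X (tval t e)"
  by (simp add: mem_term_def mem_code_def)

lemma tvars_mem: "tvars (mem_term X t) = tvars t"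
  by (simp add: mem_term_def)

text \<open>The variables of the input formula lie below \<open>m\<close>.  Slot \<open>m + 3\<close> holds the number of
  values of \<open>f\<close> chosen so far and slots \<open>m + 4\<close>, \<open>m + 5\<close> their \<open>beta\<close>-code; \<open>m + 6\<close>, \<open>m + 7\<close> hold
  the code of the next sequence, and \<open>m + 10\<close> the input number.  Slots \<open>m\<close>, \<open>m + 8\<close> and \<open>m + 9\<close>
  serve as bound variables.\<close>

definition entry :: "nat \<Rightarrow> nat \<Rightarrow> nat \<Rightarrow> nat \<Rightarrow> aterm \<Rightarrow> aterm \<Rightarrow> so_formula" where
  "entry k a b q s t = SAnd (SLess s (TVar k))
     (SAnd (SExNum q (SEq (TVar a) (TAdd (TMul (TVar q) (TSuc (TMul (TSuc s) (TVar b)))) t)))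
           (SLess t (TSuc (TMul (TSuc s) (TVar b)))))"

text \<open>The remainder is expressed by division: entry \<open>q\<close> is bound to the quotient,
  and the strict bound by the modulus makes the remainder unique.\<close>

lemma sat_entry:
  assumes "q \<notin> tvars s" "q \<notin> tvars t" "q \<noteq> k" "q \<noteq> a" "q \<noteq> b"
  shows "so_sat (entry k a b q s t) e V \<longleftrightarrow> tval s e < e k \<and> beta (e a) (e b) (tval s e) = tval t e"
proof -
  let ?d = "Suc (Suc (tval s e) * e b)"
  have "(\<exists>n. e a = n * ?d + tval t e) \<and> tval t e < ?d \<longleftrightarrow> e a mod ?d = tval t e"
    by (metis div_mult_mod_eq mod_less mod_less_divisor mod_mult_self3 zero_less_Suc)
  then show ?thesis
    using assms by (simp add: entry_def beta_def tval_upd)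
qed

definition chosen :: "nat \<Rightarrow> aterm \<Rightarrow> aterm \<Rightarrow> so_formula" where
  "chosen m s t = entry (m + 3) (m + 4) (m + 5) (m + 8) s t"

definition chosen_pos :: "nat \<Rightarrow> aterm \<Rightarrow> so_formula" where
  "chosen_pos m s = SExNum (m + 9) (chosen m s (TSuc (TVar (m + 9))))"

definition partial :: "nat \<Rightarrow> (nat \<Rightarrow> nat) \<Rightarrow> nat \<Rightarrow> nat \<Rightarrow> bool" where
  "partial m e = (\<lambda>i v. i < e (m + 3) \<and> beta (e (m + 4)) (e (m + 5)) i = v)"

lemma sat_chosen:
  assumes "tvars s \<subseteq> {..m}" "tvars t \<subseteq> {..m}"
  shows "so_sat (chosen m s t) e V \<longleftrightarrow> partial m e (tval s e) (tval t e)"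
proof -
  have "m + 8 \<notin> tvars s" "m + 8 \<notin> tvars t" using assms by auto
  then show ?thesis by (simp add: chosen_def sat_entry partial_def)
qed

lemma sat_chosen_pos:
  assumes "tvars s \<subseteq> {..m}"
  shows "so_sat (chosen_pos m s) e V \<longleftrightarrow> holds (partial m e) (tval s e)"
proof -
  have "m + 8 \<notin> tvars s" "m + 9 \<notin> tvars s" using assms by auto
  then show ?thesis by (simp add: chosen_pos_def chosen_def sat_entry partial_def tval_upd)
qed

text \<open>The clauses of \<open>consistent\<close> with the coded prefix as \<open>F\<close> and
  entry \<open>m\<close> as \<open>y\<close>. Membership atoms disappear, because they are replaced
  by lookups of their codes.\<close>

primrec consistent_fm :: "nat \<Rightarrow> nat set \<Rightarrow> so_formula \<Rightarrow> so_formula" where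
  "consistent_fm m B (SEq t u) =
     SAnd (SNot (SAnd (chosen_pos m (inst_term (SEq t u) (map TVar [0..<m]))) (SNot (SEq t u))))
          (SNot (SAnd (chosen m (inst_term (SEq t u) (map TVar [0..<m])) TZero) (SEq t u)))"
| "consistent_fm m B (SLess t u) =
     SAnd (SNot (SAnd (chosen_pos m (inst_term (SLess t u) (map TVar [0..<m]))) (SNot (SLess t u))))
          (SNot (SAnd (chosen m (inst_term (SLess t u) (map TVar [0..<m])) TZero) (SLess t u)))"
| "consistent_fm m B (SMem t X) =
     (if X \<in> B
      then SAnd (SNot (SAnd (chosen_pos m (inst_term (SMem t X) (map TVar [0..<m]))) (chosen m (mem_term X t) TZero)))
                (SNot (SAnd (chosen m (inst_term (SMem t X) (map TVar [0..<m])) TZero) (chosen_pos m (mem_term X t))))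
      else SNot (chosen_pos m (inst_term (SMem t X) (map TVar [0..<m]))))"
| "consistent_fm m B (SNot \<psi>) = SAnd (consistent_fm m B \<psi>)
     (SAnd (SNot (SAnd (chosen_pos m (inst_term (SNot \<psi>) (map TVar [0..<m])))
                       (chosen_pos m (inst_term \<psi> (map TVar [0..<m])))))
           (SNot (SAnd (chosen m (inst_term (SNot \<psi>) (map TVar [0..<m])) TZero)
                       (chosen m (inst_term \<psi> (map TVar [0..<m])) TZero))))"
| "consistent_fm m B (SAnd \<phi> \<psi>) = SAnd (SAnd (consistent_fm m B \<phi>) (consistent_fm m B \<psi>))
     (SAnd (SNot (SAnd (chosen_pos m (inst_term (SAnd \<phi> \<psi>) (map TVar [0..<m])))
                       (chosen m (inst_term \<phi> (map TVar [0..<m])) TZero)))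
     (SAnd (SNot (SAnd (chosen_pos m (inst_term (SAnd \<phi> \<psi>) (map TVar [0..<m])))
                       (chosen m (inst_term \<psi> (map TVar [0..<m])) TZero)))
           (SNot (SAnd (chosen m (inst_term (SAnd \<phi> \<psi>) (map TVar [0..<m])) TZero)
             (SAnd (chosen_pos m (inst_term \<phi> (map TVar [0..<m])))
                   (chosen_pos m (inst_term \<psi> (map TVar [0..<m]))))))))"
| "consistent_fm m B (SExNum x \<psi>) = SAnd (consistent_fm m B \<psi>)
     (SAnd (SNot (SAnd (chosen m (inst_term (SExNum x \<psi>) (map TVar [0..<m])) TZero)
                       (chosen_pos m (inst_term \<psi> ((map TVar [0..<m])[x := TVar m])))))
           (SNot (SAnd (chosen m (inst_term (SExNum x \<psi>) (map TVar [0..<m])) (TSuc (TVar m)))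
                       (chosen m (inst_term \<psi> ((map TVar [0..<m])[x := TVar m])) TZero))))"
| "consistent_fm m B (SOr \<phi> \<psi>) = SEq TZero TZero"
| "consistent_fm m B (SAllNum x \<psi>) = SEq TZero TZero"
| "consistent_fm m B (SExSet X \<psi>) = SEq TZero TZero"
| "consistent_fm m B (SAllSet X \<psi>) = SEq TZero TZero"

lemma tvars_inst_vars: "tvars (inst_term \<psi> (map TVar [0..<m])) \<subseteq> {..m}"
  by (auto simp: tvars_inst)

lemma tvars_inst_upd: "tvars (inst_term \<psi> ((map TVar [0..<m])[x := TVar m])) \<subseteq> {..m}"
  using set_update_subset_insert[of "map TVar [0..<m]" x "TVar m"] by (force simp: tvars_inst)

lemma sat_consistent_fm:
  assumes "core m \<psi>"
  shows "so_sat (consistent_fm m B \<psi>) e V \<longleftrightarrow> consistent m B (partial m e) \<psi> e (e m)"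
  using assms
proof (induction \<psi>)
  case (SMem t X)
  then have "tvars (mem_term X t) \<subseteq> {..m}" by (auto simp: tvars_mem)
  then show ?case
    by (simp add: sat_chosen sat_chosen_pos tvars_inst_vars tval_inst tval_mem del: upt_Suc)
qed (simp_all add: sat_chosen sat_chosen_pos tvars_inst_vars tvars_inst_upd tval_inst tval_inst_upd)

lemma fo_below_entry:
  "fo_below K (entry k a b q s t) \<longleftrightarrow> k < K \<and> a < K \<and> b < K \<and> q < K \<and> tvars s \<subseteq> {..<K} \<and> tvars t \<subseteq> {..<K}"
  by (auto simp: entry_def)

lemma fo_below_consistent_fm: "core m \<psi> \<Longrightarrow> fo_below (m + 11) (consistent_fm m B \<psi>)"
proof (induction \<psi>)
  case (SExNum x \<psi>)
  have "tvars (inst_term \<psi> ((map TVar [0..<m])[x := TVar m])) \<subseteq> {..<m + 11}"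
    using tvars_inst_upd[of \<psi> m x] by force
  then show ?case using SExNum by (auto simp: chosen_pos_def chosen_def fo_below_entry tvars_inst)
qed (auto simp: chosen_pos_def chosen_def fo_below_entry tvars_inst tvars_mem)

lemma consistent_cong:
  assumes "core m \<psi>" "\<And>i. i < m \<Longrightarrow> e i = e' i"
  shows "consistent m B F \<psi> e y \<longleftrightarrow> consistent m B F \<psi> e' y"
  using assms(1)
proof (induction \<psi>)
  have inst: "inst_code m \<psi> e = inst_code m \<psi> e'" for \<psi>
    using assms(2) by (simp add: inst_code_inject)
  {
    case (SEq t u)
    then have "tval t e = tval t e'" "tval u e = tval u e'"
      using assms(2) by (auto intro!: tval_cong)
    then show ?case by (simp add: inst)
  next
    case (SLess t u)
    then have "tval t e = tval t e'" "tval u e = tval u e'"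
      using assms(2) by (auto intro!: tval_cong)
    then show ?case by (simp add: inst)
  next
    case (SMem t X)
    then have "tval t e = tval t e'" using assms(2) by (auto intro!: tval_cong)
    then show ?case by (simp add: inst)
  next
    case (SExNum x \<psi>)
    have "inst_code m \<psi> (e(x := y)) = inst_code m \<psi> (e'(x := y))"
      using assms(2) by (simp add: inst_code_inject)
    then show ?case using SExNum by (simp add: inst)
  next
    case (SNot \<psi>)
    then show ?case by (simp add: inst)
  next
    case (SAnd \<phi> \<psi>)
    then show ?case by (simp add: inst)
  }
qed simp_all

lemma sat_foldr_all:
  "so_sat (foldr SAllNum xs \<phi>) e V \<longleftrightarrow> (\<forall>g. so_sat \<phi> (\<lambda>i. if i \<in> set xs then g i else e i) V)"
proof (induction xs arbitrary: e)
  case (Cons x xs)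
  have "(\<forall>n g. so_sat \<phi> (\<lambda>i. if i \<in> set xs then g i else (e(x := n)) i) V) \<longleftrightarrow>
    (\<forall>g. so_sat \<phi> (\<lambda>i. if i \<in> set (x # xs) then g i else e i) V)"
  proof safe
    fix g assume "\<forall>n g. so_sat \<phi> (\<lambda>i. if i \<in> set xs then g i else (e(x := n)) i) V"
    then have "so_sat \<phi> (\<lambda>i. if i \<in> set xs then g i else (e(x := g x)) i) V" by blast
    moreover have "(\<lambda>i. if i \<in> set xs then g i else (e(x := g x)) i) = (\<lambda>i. if i \<in> set (x # xs) then g i else e i)"
      by auto
    ultimately show "so_sat \<phi> (\<lambda>i. if i \<in> set (x # xs) then g i else e i) V" by simp
  next
    fix n g assume "\<forall>g. so_sat \<phi> (\<lambda>i. if i \<in> set (x # xs) then g i else e i) V"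
    \<comment> \<open>If \<open>x\<close> occurs again in \<open>xs\<close>, the inner quantifier
      overrides it; \<open>n\<close> counts only otherwise.\<close>
    then have "so_sat \<phi> (\<lambda>i. if i \<in> set (x # xs) then (if i \<in> set xs then g i else n) else e i) V"
      by (rule allE[of _ "\<lambda>i. if i \<in> set xs then g i else n"])
    moreover have "(\<lambda>i. if i \<in> set (x # xs) then (if i \<in> set xs then g i else n) else e i)
        = (\<lambda>i. if i \<in> set xs then g i else (e(x := n)) i)"
      by auto
    ultimately show "so_sat \<phi> (\<lambda>i. if i \<in> set xs then g i else (e(x := n)) i) V" by simp
  qed
  then show ?case using Cons by simp
qed simp

lemma fo_below_foldr_all: "fo_below K (foldr SAllNum xs \<phi>) \<longleftrightarrow> set xs \<subseteq> {..<K} \<and> fo_below K \<phi>"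
  by (induction xs) auto

definition good_fm :: "nat \<Rightarrow> nat set \<Rightarrow> so_formula \<Rightarrow> so_formula" where
  "good_fm m B \<chi> = SAnd (foldr SAllNum [0..<Suc m] (consistent_fm m B \<chi>))
     (SNot (chosen m (inst_term \<chi> (TVar (m + 10) # replicate (m - 1) TZero)) TZero))"

lemma sat_good_fm:
  assumes "core m \<chi>" "0 < m"
  shows "so_sat (good_fm m B \<chi>) e V \<longleftrightarrow> good m B \<chi> (e (m + 10)) (partial m e)"
proof -
  have p: "partial m (\<lambda>i. if i \<in> set [0..<Suc m] then g i else e i) = partial m e" for g
    by (auto simp: partial_def)
  have "so_sat (foldr SAllNum [0..<Suc m] (consistent_fm m B \<chi>)) e V \<longleftrightarrow>
    (\<forall>g. consistent m B (partial m e) \<chi> (\<lambda>i. if i \<in> set [0..<Suc m] then g i else e i) (g m))"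
    unfolding sat_foldr_all sat_consistent_fm[OF assms(1)] p by simp
  also have "\<dots> \<longleftrightarrow> (\<forall>e' y. consistent m B (partial m e) \<chi> e' y)"
  proof safe
    fix e' y assume *: "\<forall>g. consistent m B (partial m e) \<chi> (\<lambda>i. if i \<in> set [0..<Suc m] then g i else e i) (g m)"
    \<comment> \<open>Consistency depends on the first \<open>m\<close> entries and on
      \<open>y\<close>, so \<open>m + 1\<close> number quantifiers cover all assignments.\<close>
    let ?g = "\<lambda>i. if i < m then e' i else y :: nat"
    have "consistent m B (partial m e) \<chi> (\<lambda>i. if i \<in> set [0..<Suc m] then ?g i else e i) y"
      using spec[OF *, of ?g] by simp
    then show "consistent m B (partial m e) \<chi> e' y"
      by (rule iffD1[OF consistent_cong[OF assms(1)], rotated]) auto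
  qed blast
  finally have 1: "so_sat (foldr SAllNum [0..<Suc m] (consistent_fm m B \<chi>)) e V \<longleftrightarrow>
    (\<forall>e' y. consistent m B (partial m e) \<chi> e' y)" .
  have "m + 8 \<notin> tvars (inst_term \<chi> (TVar (m + 10) # replicate (m - 1) TZero))"
    by (auto simp: tvars_inst)
  then have "so_sat (chosen m (inst_term \<chi> (TVar (m + 10) # replicate (m - 1) TZero)) TZero) e V
     \<longleftrightarrow> partial m e (inst_code m \<chi> ((\<lambda>_. 0)(0 := e (m + 10)))) 0"
    by (simp add: chosen_def sat_entry partial_def tval_inst_start[OF assms(2), simplified])
  then show ?thesis by (simp add: good_fm_def good_def 1 del: upt_Suc)
qed

lemma fo_below_good_fm: "core m \<chi> \<Longrightarrow> fo_below (m + 11) (good_fm m B \<chi>)"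
  using fo_below_consistent_fm[of m \<chi> B]
  by (auto simp: good_fm_def fo_below_foldr_all chosen_def fo_below_entry tvars_inst simp del: upt_Suc)

section \<open>One-step extension of a coded prefix\<close>

definition agree_fm :: "nat \<Rightarrow> so_formula" where
  "agree_fm m = SAllNum m (SAllNum (m + 9) (SOr
     (SNot (chosen m (TVar m) (TVar (m + 9))))
     (entry (m + 3) (m + 6) (m + 7) (m + 8) (TVar m) (TVar (m + 9)))))"

lemma sat_agree_fm:
  "so_sat (agree_fm m) e V \<longleftrightarrow>
     (\<forall>i<e (m + 3). beta (e (m + 6)) (e (m + 7)) i = beta (e (m + 4)) (e (m + 5)) i)"
  by (auto simp: agree_fm_def chosen_def sat_entry)

lemma fo_below_agree_fm: "fo_below (m + 11) (agree_fm m)"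
  by (simp add: agree_fm_def chosen_def fo_below_entry)

definition advance :: "nat \<Rightarrow> (nat \<Rightarrow> nat) \<Rightarrow> nat \<Rightarrow> nat" where
  "advance m e = (\<lambda>e. e(m + 5 := e (m + 7))) ((\<lambda>e. e(m + 4 := e (m + 6))) (e(m + 3 := Suc (e (m + 3)))))"

text \<open>Sequences have many codes, so the next code must agree with the present one on the old
  indices instead of equalling it. The new value is whatever this code yields at the next index, as
  \<open>beta\<close> is total.\<close>

definition extend_op :: "nat \<Rightarrow> nat set \<Rightarrow> so_formula \<Rightarrow> ((nat \<Rightarrow> nat) \<Rightarrow> bool) \<Rightarrow> (nat \<Rightarrow> nat) \<Rightarrow> bool" where
  "extend_op m B \<chi> R e \<longleftrightarrow> so_sat (good_fm m B \<chi>) e (\<lambda>_. {}) \<and>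
     (\<exists>a b. so_sat (agree_fm m) (e(m + 6 := a, m + 7 := b)) (\<lambda>_. {}) \<and> R (advance m (e(m + 6 := a, m + 7 := b))))"

lemma mono_extend_op: "mono (extend_op m B \<chi>)"
  by (rule monoI) (auto simp: le_fun_def extend_op_def)

lemma advance_simps:
  "advance m (e(m + 6 := a, m + 7 := b)) (m + 3) = Suc (e (m + 3))"
  "advance m (e(m + 6 := a, m + 7 := b)) (m + 4) = a"
  "advance m (e(m + 6 := a, m + 7 := b)) (m + 5) = b"
  "advance m (e(m + 6 := a, m + 7 := b)) (m + 10) = e (m + 10)"
  by (simp_all add: advance_def)

lemma agree_simps:
  "so_sat (agree_fm m) (e(m + 6 := a, m + 7 := b)) V \<longleftrightarrow>
     (\<forall>i<e (m + 3). beta a b i = beta (e (m + 4)) (e (m + 5)) i)"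
  by (simp add: sat_agree_fm)

lemma gfp_extend_op:
  assumes "core m \<chi>" "0 < m" "e (m + 3) = 0"
  shows "gfp (extend_op m B \<chi>) e \<longleftrightarrow> (\<exists>f. \<forall>k. good m B \<chi> (e (m + 10)) (\<lambda>i v. i < k \<and> f i = v))"
proof
  let ?X = "gfp (extend_op m B \<chi>)"
  have unfold: "?X e \<longleftrightarrow> extend_op m B \<chi> ?X e" for e
    using gfp_unfold[OF mono_extend_op, of m B \<chi>] by simp
  assume "?X e"
  let ?P = "\<lambda>j x. ?X x \<and> x (m + 3) = j \<and> x (m + 10) = e (m + 10)"
  \<comment> \<open>Dependent choice follows one path through the greatest fixpoint;
    \<open>?Q\<close> ensures that values once chosen never change.\<close>
  let ?Q = "\<lambda>j x y. \<forall>i<j. beta (y (m + 4)) (y (m + 5)) i = beta (x (m + 4)) (x (m + 5)) i"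
  obtain E where E: "\<And>j. ?P j (E j)" "\<And>j. ?Q j (E j) (E (Suc j))"
  proof (rule exE[OF dependent_nat_choice[of ?P ?Q]])
    show "\<exists>x. ?P 0 x" using \<open>?X e\<close> assms(3) by blast
    fix x j assume x: "?P j x"
    then obtain a b where ab: "so_sat (agree_fm m) (x(m + 6 := a, m + 7 := b)) (\<lambda>_. {})"
      "?X (advance m (x(m + 6 := a, m + 7 := b)))"
      using unfold[of x] unfolding extend_op_def by blast
    show "\<exists>y. ?P (Suc j) y \<and> ?Q j x y"
      by (rule exI[of _ "advance m (x(m + 6 := a, m + 7 := b))"])
        (use ab x in \<open>simp add: advance_simps agree_simps\<close>)
  qed blast
  \<comment> \<open>Index \<open>i\<close> first counts at length \<open>i + 1\<close>, and its
    value is stable from there on.\<close>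
  define f where "f i = beta (E (Suc i) (m + 4)) (E (Suc i) (m + 5)) i" for i
  have f: "beta (E j (m + 4)) (E j (m + 5)) i = f i" if "i < j" for i j
    using that
  proof (induction j)
    case (Suc j)
    then show ?case using E(2)[of j] by (cases "i = j") (auto simp: f_def)
  qed simp
  have "good m B \<chi> (e (m + 10)) (\<lambda>i v. i < k \<and> f i = v)" for k
  proof -
    have "good m B \<chi> (E k (m + 10)) (partial m (E k))"
      using E(1)[of k] unfold[of "E k"] sat_good_fm[OF assms(1,2)] unfolding extend_op_def by blast
    moreover have "partial m (E k) = (\<lambda>i v. i < k \<and> f i = v)"
      using E(1)[of k] f[of _ k] by (auto simp: partial_def fun_eq_iff)
    ultimately show ?thesis using E(1)[of k] by simp
  qed
  then show "\<exists>f. \<forall>k. good m B \<chi> (e (m + 10)) (\<lambda>i v. i < k \<and> f i = v)" by blast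
next
  assume "\<exists>f. \<forall>k. good m B \<chi> (e (m + 10)) (\<lambda>i v. i < k \<and> f i = v)"
  then obtain f where f: "\<And>k. good m B \<chi> (e (m + 10)) (\<lambda>i v. i < k \<and> f i = v)" by blast
  \<comment> \<open>All assignments that carry the given input and code some prefix of
    \<open>f\<close> form a post-fixpoint; the remaining entries are arbitrary.\<close>
  let ?R = "\<lambda>x. x (m + 10) = e (m + 10) \<and> (\<forall>i<x (m + 3). beta (x (m + 4)) (x (m + 5)) i = f i)"
  have "?R \<le> gfp (extend_op m B \<chi>)"
  proof (rule gfp_upperbound, rule le_funI, rule le_boolI)
    fix x assume x: "?R x"
    obtain a b where ab: "\<forall>i<Suc (x (m + 3)). beta a b i = f i" using beta_exists by blast
    have "partial m x = (\<lambda>i v. i < x (m + 3) \<and> f i = v)"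
      using x by (auto simp: partial_def fun_eq_iff)
    then have "so_sat (good_fm m B \<chi>) x (\<lambda>_. {})"
      using f x sat_good_fm[OF assms(1,2)] by simp
    moreover have "so_sat (agree_fm m) (x(m + 6 := a, m + 7 := b)) (\<lambda>_. {})"
      using x ab by (simp add: agree_simps)
    moreover have "?R (advance m (x(m + 6 := a, m + 7 := b)))"
      using x ab by (simp add: advance_simps)
    ultimately show "extend_op m B \<chi> ?R x" unfolding extend_op_def by blast
  qed
  then show "gfp (extend_op m B \<chi>) e" using assms(3) by (auto simp: le_fun_def)
qed

text \<open>De Morgan duality of fixpoints. It makes a complement definable as soon as the dual
  operator can be written positively in \<open>R\<close>.\<close>

lemma lfp_dual:
  fixes \<Phi> :: "('a \<Rightarrow> bool) \<Rightarrow> 'a \<Rightarrow> bool"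
  assumes "mono \<Phi>"
  shows "lfp (\<lambda>R x. \<not> \<Phi> (\<lambda>x. \<not> R x) x) = (\<lambda>x. \<not> gfp \<Phi> x)" (is "lfp ?\<Psi> = _")
proof (rule antisym)
  have "\<Phi> (gfp \<Phi>) = gfp \<Phi>" using gfp_unfold[OF assms] by simp
  then show "lfp ?\<Psi> \<le> (\<lambda>x. \<not> gfp \<Phi> x)"
    by (intro lfp_lowerbound) (simp add: le_fun_def)
  have "mono ?\<Psi>"
  proof (rule monoI, rule le_funI, rule le_boolI)
    fix R Q :: "'a \<Rightarrow> bool" and x
    assume "R \<le> Q" "\<not> \<Phi> (\<lambda>x. \<not> R x) x"
    then show "\<not> \<Phi> (\<lambda>x. \<not> Q x) x"
      using monoD[OF assms, of "\<lambda>x. \<not> Q x" "\<lambda>x. \<not> R x"] by (auto simp: le_fun_def)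
  qed
  note eq = fun_cong[OF lfp_unfold[OF this]]
  have "\<Phi> (\<lambda>x. \<not> lfp ?\<Psi> x) x \<longleftrightarrow> \<not> lfp ?\<Psi> x" for x
    using eq[of x] by argo
  then have "(\<lambda>x. \<not> lfp ?\<Psi> x) \<le> gfp \<Phi>"
    by (intro gfp_upperbound) (simp add: le_fun_def)
  then show "(\<lambda>x. \<not> gfp \<Phi> x) \<le> lfp ?\<Psi>" by (auto simp: le_fun_def)
qed

section \<open>Definability of the existence of sets and of its complement\<close>

context uniform_chain begin

lemma definable_map_advance:
  assumes "m + 17 \<le> N"
  shows "definable_map (advance m)"
proof -
  have lt: "m + 3 < N" "m + 4 < N" "m + 5 < N" "m + 6 < N" "m + 7 < N" using assms by auto
  show ?thesis
    unfolding advance_def[abs_def]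
    by (rule definable_map_comp[OF definable_map_copy[OF lt(3,5)] definable_map_comp[OF definable_map_copy[OF lt(2,4)] definable_map_suc[OF lt(1)]]])
qed

text \<open>The formulas use the variables below \<open>m + 11\<close>, and definability of
  arithmetic asks for six more entries; hence \<open>m + 17\<close>.\<close>

lemma definable_gfp_extend_op:
  assumes N: "m + 17 \<le> N" and "core m \<chi>"
  shows "definable {} (\<lambda>_. gfp (extend_op m B \<chi>))"
    and "definable {} (\<lambda>_ e. \<not> gfp (extend_op m B \<chi>) e)"
proof -
  have N': "m + 11 + 6 \<le> N" "m + 6 < N" "m + 7 < N" using N by auto
  note good = definable_arithmetic[OF N'(1) fo_below_good_fm[OF assms(2)], of B "\<lambda>_. {}"]
  note agree = definable_arithmetic[OF N'(1) fo_below_agree_fm, of "\<lambda>_. {}"]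
  let ?A = "\<lambda>e. so_sat (agree_fm m) e (\<lambda>_. {})"
  have adv: "definable {1} (\<lambda>R e. R (advance m e))"
    by (rule definable_subst[OF definable_rel definable_map_advance[OF N]])
  have "definable {1} (\<lambda>R e. \<exists>a b. (\<lambda>R e. ?A e \<and> R (advance m e)) R (e(m + 6 := a, m + 7 := b)))"
    by (intro definable_ex[where \<Phi> = "\<lambda>R e. \<exists>b. (\<lambda>R e. ?A e \<and> R (advance m e)) R (e(m + 7 := b))"]
        definable_ex[where \<Phi> = "\<lambda>R e. ?A e \<and> R (advance m e)"] definable_conj definable_const conjunct1[OF agree] adv N') auto
  then have "definable {1} (extend_op m B \<chi>)"
    unfolding extend_op_def[abs_def] by (intro definable_conj definable_const conjunct1[OF good])
  then show "definable {} (\<lambda>_. gfp (extend_op m B \<chi>))"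
    by (rule definable_gfp) (rule mono_extend_op)
  let ?\<Psi> = "\<lambda>R e. \<not> extend_op m B \<chi> (\<lambda>x. \<not> R x) e"
  \<comment> \<open>The two negations around \<open>R\<close> cancel, and the others fall on
    arithmetical relations, whose complements are definable.\<close>
  have \<Psi>: "?\<Psi> = (\<lambda>R e. \<not> so_sat (good_fm m B \<chi>) e (\<lambda>_. {}) \<or>
     (\<forall>a b. \<not> ?A (e(m + 6 := a, m + 7 := b)) \<or> R (advance m (e(m + 6 := a, m + 7 := b)))))"
    by (auto simp: extend_op_def fun_eq_iff)
  have "definable {1} (\<lambda>R e. \<forall>a b. (\<lambda>R e. \<not> ?A e \<or> R (advance m e)) R (e(m + 6 := a, m + 7 := b)))"
    by (intro definable_all[where \<Phi> = "\<lambda>R e. \<forall>b. (\<lambda>R e. \<not> ?A e \<or> R (advance m e)) R (e(m + 7 := b))"]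
        definable_all[where \<Phi> = "\<lambda>R e. \<not> ?A e \<or> R (advance m e)"] definable_disj definable_const conjunct2[OF agree] adv N') auto
  then have "definable {1} ?\<Psi>"
    unfolding \<Psi> by (intro definable_disj definable_const conjunct2[OF good])
  moreover have "mono ?\<Psi>" unfolding \<Psi> by (rule monoI) (auto simp: le_fun_def)
  ultimately have "definable {} (\<lambda>_. lfp ?\<Psi>)" by (rule definable_lfp)
  then show "definable {} (\<lambda>_ e. \<not> gfp (extend_op m B \<chi>) e)"
    unfolding lfp_dual[OF mono_extend_op] .
qed

lemma definable_exists_sets:
  fixes B :: "nat set"
  assumes N: "m + 17 \<le> N" and \<chi>: "core m \<chi>" "0 < m"
  defines "Z \<equiv> {n. \<exists>W. so_sat \<chi> ((\<lambda>_. 0)(0 := n)) (\<lambda>X. if X \<in> B then W X else {})}"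
  shows "definable {} (\<lambda>_ e. e (m + 10) \<in> Z)" and "definable {} (\<lambda>_ e. e (m + 10) \<notin> Z)"
proof -
  \<comment> \<open>Length 0 codes the empty prefix, whatever the code entries \<open>m + 4\<close>
    and \<open>m + 5\<close> contain.\<close>
  have eq: "gfp (extend_op m B \<chi>) (e(m + 3 := 0)) \<longleftrightarrow> e (m + 10) \<in> Z" for e
    using gfp_extend_op[OF \<chi>, of "e(m + 3 := 0)" B] good_iff_sat[OF \<chi>(1), of B] by (simp add: Z_def)
  have definable_map: "definable_map (\<lambda>e. e(m + 3 := 0))" by (rule definable_map_zero) (use N in auto)
  show "definable {} (\<lambda>_ e. e (m + 10) \<in> Z)" "definable {} (\<lambda>_ e. e (m + 10) \<notin> Z)"
    using definable_subst[OF definable_gfp_extend_op(1)[OF N \<chi>(1), of B] definable_map]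
      definable_subst[OF definable_gfp_extend_op(2)[OF N \<chi>(1), of B] definable_map] by (simp_all only: eq)
qed

end

section \<open>The reduction is computable\<close>

primrec const_rec :: "nat \<Rightarrow> recf" where
  "const_rec 0 = RZero"
| "const_rec (Suc c) = RComp RSucc [const_rec c]"

lemma reval_comp1: "reval g xs y \<Longrightarrow> reval f [y] z \<Longrightarrow> reval (RComp f [g]) xs z"
  by (rule reval.intros(4)[of "[y]"]) auto

lemma reval_comp2:
  "reval g xs y \<Longrightarrow> reval h xs y' \<Longrightarrow> reval f [y, y'] z \<Longrightarrow> reval (RComp f [g, h]) xs z"
  by (rule reval.intros(4)[of "[y, y']"]) (auto simp: less_Suc_eq)

lemma reval_proj: "i < length xs \<Longrightarrow> y = xs ! i \<Longrightarrow> reval (RProj i) xs y"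
  using reval.intros(3) by simp

lemma reval_const: "reval (const_rec c) xs c"
  by (induction c) (auto intro: reval.intros reval_comp1)

definition add_rec :: recf where
  "add_rec = RPrim (RProj 0) (RComp RSucc [RProj 1])"

lemma reval_add: "reval add_rec [x, y] (x + y)"
proof (induction x)
  case 0
  show ?case unfolding add_rec_def by (rule reval.intros(5), rule reval_proj) auto
next
  case (Suc x)
  have "reval (RComp RSucc [RProj 1]) [x, x + y, y] (Suc (x + y))"
    by (rule reval_comp1[OF reval_proj reval.intros(2)]) auto
  then show ?case using Suc reval.intros(6) unfolding add_rec_def by simp
qed

definition triangle_rec :: recf where
  "triangle_rec = RPrim RZero (RComp RSucc [RComp add_rec [RProj 0, RProj 1]])"

lemma reval_triangle: "reval triangle_rec [x] (triangle x)"
proof (induction x)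
  case 0
  show ?case unfolding triangle_rec_def by (auto intro: reval.intros)
next
  case (Suc x)
  have "reval (RComp add_rec [RProj 0, RProj 1]) [x, triangle x] (x + triangle x)"
    by (rule reval_comp2[OF reval_proj reval_proj reval_add]) auto
  then have "reval (RComp RSucc [RComp add_rec [RProj 0, RProj 1]]) [x, triangle x] (Suc (x + triangle x))"
    by (rule reval_comp1) (rule reval.intros(2))
  then show ?case using Suc reval.intros(6) unfolding triangle_rec_def by (simp add: add.commute)
qed

definition pair_rec :: recf where
  "pair_rec = RComp add_rec [RComp triangle_rec [add_rec], RProj 0]"

lemma reval_pair: "reval pair_rec [x, y] (prod_encode (x, y))"
  unfolding pair_rec_def prod_encode_def prod.case
  by (rule reval_comp2[OF reval_comp1[OF reval_add reval_triangle] reval_proj reval_add]) auto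

section \<open>Numerals as formulas and the reduction\<close>

context uniform_chain begin

text \<open>\<open>zero_upto N\<close> denotes the code of the zero assignment: \<open>q ^ 0\<close>
  is 1 at even states, and \<open>1 - q ^ 0\<close> is 0 at odd ones.\<close>

primrec zero_upto :: "nat \<Rightarrow> nat phfl" where
  "zero_upto 0 = And (Atom 0) (Atom sz)"
| "zero_upto (Suc k) = Or (zero_upto k) (Atom (2 * k))"

text \<open>Each step wraps the same redex around the previous formula, so the code of the result is
  primitive recursive in \<open>n\<close>.\<close>

primrec numeral_fm :: "nat phfl \<Rightarrow> nat \<Rightarrow> nat phfl" where
  "numeral_fm u 0 = zero_upto N"
| "numeral_fm u (Suc n) = App (Lam 0 Prp u) (numeral_fm u n)"

lemma sem_zero_upto: "k \<le> N \<Longrightarrow> sem M (zero_upto k) \<rho> = Base (\<lambda>s\<in>S. if even s \<and> s < 2 * k then 1 else 0)"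
proof (induction k)
  case 0
  then show ?case using sz_pos by (auto simp: label_M label_M_compl[of 0, simplified] intro!: restrict_ext)
next
  case (Suc k)
  have IH: "sem M (zero_upto k) \<rho> = Base (\<lambda>s\<in>S. if even s \<and> s < 2 * k then 1 else 0)"
    by (rule Suc.IH) (use Suc.prems in simp)
  have label: "label M (2 * k) = {2 * k}" using Suc.prems by (intro label_M slot_lt) simp
  have max: "max (if even s \<and> s < 2 * k then 1 else 0) (if s \<in> {2 * k} then 1 else 0)
      = (if even s \<and> s < 2 * Suc k then 1 else 0 :: real)" for s
  proof -
    have "even s \<and> s < 2 * Suc k \<longleftrightarrow> (even s \<and> s < 2 * k) \<or> s = 2 * k" by presburger
    then show ?thesis by (simp only: singleton_iff) simp
  qed
  show ?case
    unfolding zero_upto.simps sem.simps IH label states_M val.sel val.inject max[symmetric]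
    by (rule restrict_ext) simp
qed

lemma enc_zero: "sem M (zero_upto N) \<rho> = Base (enc (\<lambda>_. 0))"
  by (auto simp: sem_zero_upto enc_def sz_def intro!: restrict_ext)

lemma typing_zero_upto: "typing \<Gamma> (zero_upto k) Prp 0"
proof (induction k)
  case 0
  have "typing \<Gamma> (And (Atom 0) (Atom sz)) Prp (max 0 0)" by (intro typing.intros)
  then show ?case by simp
next
  case (Suc k)
  then have "typing \<Gamma> (Or (zero_upto k) (Atom (2 * k))) Prp (max 0 0)" by (intro typing.intros)
  then show ?case by simp
qed

lemma props_zero_upto: "k \<le> N \<Longrightarrow> props (zero_upto k) \<subseteq> {..<2 * sz}"
  using sz_pos by (induction k) (auto simp: sz_def)

lemma sem_numeral_fm:
  assumes "realizes_tr u (\<lambda>e. e(i := Suc (e i)))"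
  shows "sem M (numeral_fm u n) \<rho> = Base (enc ((\<lambda>_. 0)(i := n)))"
proof (induction n)
  case 0
  then show ?case by (simp add: enc_zero fun_upd_idem)
next
  case (Suc n)
  have eq: "(\<lambda>_. 0)(i := Suc n) = ((\<lambda>_. 0)(i := n))(i := Suc (((\<lambda>_. 0)(i := n)) i))" by simp
  show ?case
    unfolding numeral_fm.simps sem_subst[OF Suc enc_preds]
    by (subst eq, rule realizes_tr_sem[OF assms]) simp
qed

lemma typing_Lam_App:
  assumes "ok Prp {} \<psi>" "typing Map.empty \<phi> Prp k" "k \<le> 1"
  shows "typing Map.empty (App (Lam 0 Prp \<psi>) \<phi>) Prp 1"
proof -
  obtain l where l: "l \<le> 1" "typing (Map.empty(0 \<mapsto> Prp)) \<psi> Prp l"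
    using ok_typing[OF assms(1), of "Map.empty(0 \<mapsto> Prp)"] by (auto simp: wf_ctx_def)
  then have "typing Map.empty (App (Lam 0 Prp \<psi>) \<phi>) Prp (max (max l (ord_ty fn_ty)) k)"
    by (intro typing.intros(12)[OF typing.intros(11)] assms)
  moreover have "max (max l (ord_ty fn_ty)) k = 1" using l assms(3) by simp
  ultimately show ?thesis by simp
qed

lemma typing_numeral_fm:
  assumes "ok Prp {} u"
  shows "\<exists>k\<le>1. typing Map.empty (numeral_fm u n) Prp k"
proof (induction n)
  case 0
  then show ?case using typing_zero_upto by auto
next
  case (Suc n)
  then show ?case using typing_Lam_App[OF assms] by auto
qed

lemma props_numeral_fm: "ok Prp {} u \<Longrightarrow> props (numeral_fm u n) \<subseteq> {..<2 * sz}"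
  using props_zero_upto ok_props by (induction n) auto

text \<open>The chain and the formulas \<open>\<psi>\<close> and \<open>u\<close> are fixed once
  \<open>Z\<close> is given; only the number of successor applications varies with the
  input.\<close>

lemma reduction:
  assumes "definable {} (\<lambda>_ e. e i \<in> Z)" "i < N"
  shows "many_one_reducible Z order1_phfl_model_checking"
proof -
  obtain \<psi> u where \<psi>: "realizes {} \<psi> (\<lambda>_ e. e i \<in> Z)" and u: "realizes_tr u (\<lambda>e. e(i := Suc (e i)))"
    using assms(1) definable_map_suc[OF assms(2)] unfolding definable_def definable_map_def by blast
  define \<phi> where "\<phi> n = App (Lam 0 Prp \<psi>) (numeral_fm u n)" for n
  have closed: "closed_prop_formula (AP_of pres) 1 (\<phi> n)" for n
  proof -
    obtain k where "k \<le> 1" "typing Map.empty (numeral_fm u n) Prp k"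
      using typing_numeral_fm[OF realizes_tr_ok[OF u]] by blast
    then have "typing Map.empty (\<phi> n) Prp 1"
      unfolding \<phi>_def by (intro typing_Lam_App[OF realizes_ok[OF \<psi>]])
    then show ?thesis
      using ok_props[OF realizes_ok[OF \<psi>]] props_numeral_fm[OF realizes_tr_ok[OF u], of n]
      by (simp add: closed_prop_formula_def AP_of_pres \<phi>_def)
  qed
  have models: "chain_of pres \<Turnstile>\<^sub>P \<phi> n \<longleftrightarrow> n \<in> Z" for n
  proof -
    let ?\<rho> = "(\<lambda>_. undefined)(0 := Base (enc ((\<lambda>_. 0)(i := n)))) :: nat \<Rightarrow> nat val"
    have "sem M \<psi> ?\<rho> = Base (truth (n \<in> Z))"
      using realizes_sem[OF \<psi>, of ?\<rho> _ "(\<lambda>_. 0)(i := n)"] by (simp add: wf_env_def)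
    then have "sem M (\<phi> n) (\<lambda>_. undefined) = Base (truth (n \<in> Z))"
      unfolding \<phi>_def sem_subst[OF sem_numeral_fm[OF u] enc_preds] .
    then show ?thesis using sz_pos by (simp add: models_def truth_def flip: M_def)
  qed
  define f where "f n = instance_code pres (\<phi> n)" for n
  define h where "h n = phfl_code (numeral_fm u n)" for n
  \<comment> \<open>11 is the tag of \<open>App\<close> in \<open>phfl_code\<close>, and
    \<open>RProj 1\<close> is the previous value of the recursion.\<close>
  define r where "r = RPrim (const_rec (h 0)) (RComp pair_rec [const_rec 11,
     RComp pair_rec [const_rec (phfl_code (Lam 0 Prp u)), RProj 1]])"
  have h: "reval r [n] (h n)" for n
  proof (induction n)
    case 0
    then show ?case unfolding r_def by (intro reval.intros(5) reval_const)
  next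
    case (Suc n)
    show ?case
      unfolding r_def
    proof (rule reval.intros(6)[OF Suc[unfolded r_def]])
      have "reval (RComp pair_rec [const_rec 11, RComp pair_rec [const_rec (phfl_code (Lam 0 Prp u)), RProj 1]])
         [n, h n] (prod_encode (11, prod_encode (phfl_code (Lam 0 Prp u), h n)))"
        by (rule reval_comp2[OF reval_const reval_comp2[OF reval_const reval_proj reval_pair] reval_pair]) auto
      then show "reval (RComp pair_rec [const_rec 11, RComp pair_rec [const_rec (phfl_code (Lam 0 Prp u)), RProj 1]])
         [n, h n] (h (Suc n))" by (simp add: h_def)
    qed
  qed
  have "reval (RComp pair_rec [const_rec (mc_code pres), RComp pair_rec [const_rec 11,
      RComp pair_rec [const_rec (phfl_code (Lam 0 Prp \<psi>)), r]]]) [n]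
      (prod_encode (mc_code pres, prod_encode (11, prod_encode (phfl_code (Lam 0 Prp \<psi>), h n))))" for n
    by (rule reval_comp2[OF reval_const reval_comp2[OF reval_const reval_comp2[OF reval_const h reval_pair] reval_pair] reval_pair])
  moreover have "prod_encode (mc_code pres, prod_encode (11, prod_encode (phfl_code (Lam 0 Prp \<psi>), h n))) = f n" for n
    by (simp add: f_def instance_code_def \<phi>_def h_def)
  ultimately have "computable f" unfolding computable_def by metis
  moreover have "f n \<in> fst order1_phfl_model_checking \<and> (n \<in> Z \<longleftrightarrow> f n \<in> snd order1_phfl_model_checking)" for n
  proof -
    have "f n \<in> fst order1_phfl_model_checking"
      unfolding phfl_model_checking_def f_def fst_conv using pres_ok closed[of n] by blast
    moreover have "f n \<in> snd order1_phfl_model_checking \<longleftrightarrow> chain_of pres \<Turnstile>\<^sub>P \<phi> n"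
      unfolding phfl_model_checking_def f_def snd_conv mem_Collect_eq instance_code_inject
      using pres_ok closed[of n] by blast
    ultimately show ?thesis using models by simp
  qed
  ultimately show ?thesis unfolding many_one_reducible_def by blast
qed

end

section \<open>Set-quantifier prefixes and hardness\<close>

lemma Sigma11_formula_prefix:
  "Sigma11_formula \<phi> \<Longrightarrow> \<exists>\<chi> B. arithmetical \<chi> \<and> (\<forall>e V. so_sat \<phi> e V \<longleftrightarrow>
     (\<exists>W. so_sat \<chi> e (\<lambda>X. if X \<in> B then W X else V X)))"
proof (induction rule: Sigma11_formula.induct)
  case (1 \<phi>)
  then show ?case by (intro exI[of _ \<phi>] exI[of _ "{}"]) simp
next
  case (2 \<phi> X)
  then obtain \<chi> B where \<chi>: "arithmetical \<chi>"
    "\<And>e V. so_sat \<phi> e V \<longleftrightarrow> (\<exists>W. so_sat \<chi> e (\<lambda>X. if X \<in> B then W X else V X))" by blast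
  \<comment> \<open>The whole prefix merges into one family \<open>W\<close> of sets, constrained by
    \<open>B\<close> to the quantified variables; a repeated variable keeps its innermost
    value.\<close>
  have "so_sat (SExSet X \<phi>) e V \<longleftrightarrow> (\<exists>W. so_sat \<chi> e (\<lambda>Y. if Y \<in> insert X B then W Y else V Y))" for e V
  proof
    assume "so_sat (SExSet X \<phi>) e V"
    then obtain A W where "so_sat \<chi> e (\<lambda>Y. if Y \<in> B then W Y else (V(X := A)) Y)"
      by (auto simp: \<chi>(2))
    moreover have "(\<lambda>Y. if Y \<in> B then W Y else (V(X := A)) Y) =
      (\<lambda>Y. if Y \<in> insert X B then (if Y \<in> B then W Y else A) else V Y)" by (auto simp: fun_eq_iff)
    ultimately show "\<exists>W. so_sat \<chi> e (\<lambda>Y. if Y \<in> insert X B then W Y else V Y)"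
      by (intro exI[of _ "\<lambda>Y. if Y \<in> B then W Y else A"]) simp
  next
    assume "\<exists>W. so_sat \<chi> e (\<lambda>Y. if Y \<in> insert X B then W Y else V Y)"
    then obtain W where "so_sat \<chi> e (\<lambda>Y. if Y \<in> insert X B then W Y else V Y)" by blast
    moreover have "(\<lambda>Y. if Y \<in> insert X B then W Y else V Y) =
      (\<lambda>Y. if Y \<in> B then W Y else (V(X := W X)) Y)" by (auto simp: fun_eq_iff)
    ultimately show "so_sat (SExSet X \<phi>) e V" unfolding so_sat.simps \<chi>(2) by metis
  qed
  then show ?case using \<chi>(1) by blast
qed

lemma Pi11_formula_neg: "Pi11_formula \<phi> \<Longrightarrow> \<exists>\<psi>. Sigma11_formula \<psi> \<and> (\<forall>e V. so_sat \<psi> e V \<longleftrightarrow> \<not> so_sat \<phi> e V)"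
proof (induction rule: Pi11_formula.induct)
  case (1 \<phi>)
  then show ?case by (intro exI[of _ "SNot \<phi>"]) (auto intro: Sigma11_formula.intros)
next
  case (2 \<phi> X)
  then obtain \<psi> where "Sigma11_formula \<psi>" "\<And>e V. so_sat \<psi> e V \<longleftrightarrow> \<not> so_sat \<phi> e V" by blast
  then show ?case by (intro exI[of _ "SExSet X \<psi>"]) (auto intro: Sigma11_formula.intros)
qed

lemma Sigma11_reducible:
  assumes "Sigma11_formula \<phi>"
  shows "many_one_reducible (defined_set \<phi>) order1_phfl_model_checking"
    and "many_one_reducible (- defined_set \<phi>) order1_phfl_model_checking"
proof -
  obtain \<chi> B where \<chi>: "arithmetical \<chi>"
    "\<And>e V. so_sat \<phi> e V \<longleftrightarrow> (\<exists>W. so_sat \<chi> e (\<lambda>X. if X \<in> B then W X else V X))"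
    using Sigma11_formula_prefix[OF assms] by blast
  obtain m0 where "core m0 (nf \<chi>)" using ex_core_nf[OF \<chi>(1)] by blast
  \<comment> \<open>The successor makes the bound positive, so that variable 0, which holds the
    input, is among the recorded entries.\<close>
  then have core: "core (Suc m0) (nf \<chi>)" by (rule core_mono) simp
  define m where "m = Suc m0"
  interpret uniform_chain "m + 17" by unfold_locales simp
  have Z: "defined_set \<phi> = {n. \<exists>W. so_sat (nf \<chi>) ((\<lambda>_. 0)(0 := n)) (\<lambda>X. if X \<in> B then W X else {})}"
    unfolding defined_set_def by (simp add: \<chi>(2) so_sat_nf[OF \<chi>(1)])
  note d = definable_exists_sets[of m "nf \<chi>" B, folded Z]
  show "many_one_reducible (defined_set \<phi>) order1_phfl_model_checking"
    by (rule reduction[of "m + 10"]) (rule d(1), use core m_def in auto)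
  have "definable {} (\<lambda>_ e. e (m + 10) \<in> - defined_set \<phi>)"
    using d(2) core m_def by simp
  then show "many_one_reducible (- defined_set \<phi>) order1_phfl_model_checking"
    by (rule reduction) simp
qed

theorem theorem4p1:
  shows "hard_for Pi11 order1_phfl_model_checking \<and> hard_for Sigma11 order1_phfl_model_checking"
proof
  show "hard_for Sigma11 order1_phfl_model_checking"
    unfolding hard_for_def Sigma11_def using Sigma11_reducible(1) by blast
  show "hard_for Pi11 order1_phfl_model_checking"
    unfolding hard_for_def
  proof
    fix A assume "A \<in> Pi11"
    then obtain \<phi> where \<phi>: "Pi11_formula \<phi>" "A = defined_set \<phi>" unfolding Pi11_def by blast
    obtain \<psi> where \<psi>: "Sigma11_formula \<psi>" "\<And>e V. so_sat \<psi> e V \<longleftrightarrow> \<not> so_sat \<phi> e V"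
      using Pi11_formula_neg[OF \<phi>(1)] by blast
    then have "A = - defined_set \<psi>" by (auto simp: \<phi>(2) defined_set_def)
    then show "many_one_reducible A order1_phfl_model_checking"
      using Sigma11_reducible(2)[OF \<psi>(1)] by simp
  qed
qed

end
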